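(* Let $f:\mathbb{R}^d\times\mathbb{R}\to\mathbb{R}^d$ satisfy the Flux Assumption, let $I=(0,\infty)$ and $u_0\in L^\infty(\mathbb{R}^d)$. Let $u,\tilde u\in L^\infty(\mathbb{R}^d\times I)$ be two entropy solutions of the scalar conservation law with flux $f$ and the same initial data $u_0$. Set $M:=\max\{\|u\|_{L^\infty(\mathbb{R}^d\times I)},\|\tilde u\|_{L^\infty(\mathbb{R}^d\times I)}\}$ and, for $R\in(0,\infty)$, $$N_M(R):=\sup\Big\{\frac{|f(x,k)-f(x,k')|}{|k-k'|}\ :\ x\in B_R(0),\ k,k'\in[-M,M],\ k\ne k'\Big\}.$$ Assume that $$\lim_{R\to\infty}\frac{N_M(R)}{R}=0 .$$ Then $u=\tilde u$ almost everywhere in $\mathbb{R}^d\times I$.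
   Context: Notation: $\mathcal{L}^m$ is $m$-dimensional Lebesgue measure; "almost every" refers to Lebesgue measure; $B_R(0)=\{x\in\mathbb{R}^d:|x|<R\}$; $D_xf(x,k)$ is the differential of $f(\cdot,k)$ at $x$; $\operatorname{Lip}_c(\mathbb{R}^d\times I)$ is the set of Lipschitz functions of $(x,t)\in\mathbb{R}^d\times I$ with compact support in $\mathbb{R}^d\times I$. The supremum defining $N_M(R)$ is $0$ if $M=0$. Flux Assumption on $f=f(x,k):\mathbb{R}^d\times\mathbb{R}\to\mathbb{R}^d$: (1) $f$ is locally Lipschitz on $\mathbb{R}^d\times\mathbb{R}$. (2a) There is a set $\Theta\subset\mathbb{R}^d$ with $\mathcal{L}^d(\Theta)=0$ such that for every $k\in\mathbb{R}$ the function $f(\cdot,k)$ is differentiable at every $x\in\mathbb{R}^d\setminus\Theta$; moreover, for every $x\in\mathbb{R}^d\setminus\Theta$ the function $k\mapsto D_xf(x,k)$ is continuous. (2b) For every $x\in\mathbb{R}^d\setminus\Theta$ and every compact $K\subset\mathbb{R}$, $\displaystyle\lim_{y\to x}\sup_{k\in K}\frac{|f(y,k)-f(x,k)-D_xf(x,k)(y-x)|}{|y-x|}=0$. Entropy pair: for a convex $\eta\in C^2(\mathbb{R})$ and $k_0\in\mathbb{R}$, put $q(x,k)=\int_{k_0}^k\eta'(\omega)\,\partial_\omega f(x,\omega)\,d\omega$; then $(\eta,q)$ is called an entropy pair. Entropy solution: consider the Cauchy problem $\partial_tu+\operatorname{div}f(x,u)=0$ in $\mathbb{R}^d\times I$,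 $u(\cdot,0)=u_0$, with $u_0\in L^\infty(\mathbb{R}^d)$. A function $u\in L^\infty(\mathbb{R}^d\times I)$ is an entropy solution with initial data $u_0$ if: (i) for every entropy pair $(\eta,q)$ and every $0\le\varphi\in\operatorname{Lip}_c(\mathbb{R}^d\times I)$, $$\int_I\int_{\mathbb{R}^d}\Big[\partial_t\varphi\,\eta(u)+\varphi\big(\operatorname{div}_xq(x,u)-\eta'(u)\operatorname{div}_xf(x,u)\big)+\nabla_x\varphi\cdot q(x,u)\Big]dx\,dt\ge0,$$ where $u=u(x,t)$ and $\operatorname{div}_xf(x,u(x,t))$ means the divergence of $f(\cdot,k)$ at $x$ evaluated at $k=u(x,t)$ (derivative only in the explicit $x$-variable), and likewise for $q$ (these are defined for almost every $(x,t)$ and locally bounded); (ii) there is a set $\Psi\subset I$ with $\mathcal{L}^1(\Psi)=0$ such that for every $R\in(0,\infty)$, $\displaystyle\lim_{t\to0^+,\ t\in I\setminus\Psi}\int_{B_R(0)}|u(x,t)-u_0(x)|\,dx=0$. *)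

theory Defs
  imports "HOL-Probability.Essential_Supremum"
begin

text \<open>
  The space $R^d$ is an arbitrary Euclidean space \<open>'a\<close> with \<open>d = DIM('a)\<close>, and
  space-time is \<open>'a \<times> real\<close>. Functions on a subset \<open>S\<close> are total functions of which
  only the values on \<open>S\<close> are used.
\<close>

section \<open>Bounded measurable functions\<close>

definition Linf :: "'b::euclidean_space set \<Rightarrow> ('b \<Rightarrow> real) \<Rightarrow> bool" where
  "Linf S u \<longleftrightarrow> u \<in> borel_measurable (lebesgue_on S) \<and>
     (\<exists>C. AE z in lebesgue_on S. \<bar>u z\<bar> \<le> C)"

definition Linf_norm :: "'b::euclidean_space set \<Rightarrow> ('b \<Rightarrow> real) \<Rightarrow> real" where
  "Linf_norm S u = real_of_ereal (esssup (lebesgue_on S) (\<lambda>z. ereal \<bar>u z\<bar>))"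

section \<open>Spatial derivatives\<close>

text \<open>
  Where \<open>g\<close> is not differentiable, \<open>frechet_derivative\<close> is an unspecified map; below this happens
  only on null sets.
\<close>

definition divergence :: "('a::euclidean_space \<Rightarrow> 'a) \<Rightarrow> 'a \<Rightarrow> real" where
  "divergence g x = (\<Sum>b\<in>Basis. frechet_derivative g (at x) b \<bullet> b)"

definition gradient :: "('a::euclidean_space \<Rightarrow> real) \<Rightarrow> 'a \<Rightarrow> 'a" where
  "gradient g x = (\<Sum>b\<in>Basis. frechet_derivative g (at x) b *\<^sub>R b)"

definition Dx :: "('a::euclidean_space \<Rightarrow> real \<Rightarrow> 'a) \<Rightarrow> 'a \<Rightarrow> real \<Rightarrow> ('a \<Rightarrow>\<^sub>L 'a)" where
  "Dx f x k = Blinfun (frechet_derivative (\<lambda>y. f y k) (at x))"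

section \<open>The flux assumption\<close>

definition locally_Lipschitz ::
    "('b::metric_space \<Rightarrow> 'c::metric_space) \<Rightarrow> bool" where
  "locally_Lipschitz g \<longleftrightarrow> (\<forall>z. \<exists>r>0. \<exists>L. L-lipschitz_on (ball z r) g)"

text \<open>
  The empty set is excluded among the compact sets \<open>K\<close> because the supremum of the empty set of
  reals is an unspecified number.
\<close>

definition flux_assumption :: "('a::euclidean_space \<Rightarrow> real \<Rightarrow> 'a) \<Rightarrow> bool" where
  "flux_assumption f \<longleftrightarrow>
     locally_Lipschitz (\<lambda>(x, k). f x k) \<and>
     (\<exists>\<Theta>. \<Theta> \<in> null_sets lebesgue \<and>
        (\<forall>k. \<forall>x. x \<notin> \<Theta> \<longrightarrow> (\<lambda>y. f y k) differentiable (at x)) \<and>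
        (\<forall>x. x \<notin> \<Theta> \<longrightarrow> continuous_on UNIV (\<lambda>k. Dx f x k)) \<and>
        (\<forall>x K. x \<notin> \<Theta> \<longrightarrow> compact K \<longrightarrow> K \<noteq> {} \<longrightarrow>
           ((\<lambda>y. SUP k\<in>K. norm (f y k - f x k - Dx f x k (y - x)) / norm (y - x))
              \<longlongrightarrow> 0) (at x)))"

section \<open>Entropy solutions\<close>

definition C2 :: "(real \<Rightarrow> real) \<Rightarrow> bool" where
  "C2 \<eta> \<longleftrightarrow> (\<forall>x. \<eta> differentiable (at x)) \<and> (\<forall>x. deriv \<eta> differentiable (at x)) \<and>
     continuous_on UNIV (deriv (deriv \<eta>))"

text \<open>
  The derivative of the locally Lipschitz function \<open>f x\<close> exists almost everywhere, and the
  interval integral is oriented, so \<open>k < k0\<close> is allowed.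
\<close>

definition entropy_pair ::
    "('a::euclidean_space \<Rightarrow> real \<Rightarrow> 'a) \<Rightarrow> (real \<Rightarrow> real) \<Rightarrow> ('a \<Rightarrow> real \<Rightarrow> 'a) \<Rightarrow> bool" where
  "entropy_pair f \<eta> q \<longleftrightarrow> convex_on UNIV \<eta> \<and> C2 \<eta> \<and>
     (\<exists>k0. \<forall>x k. q x k =
        (LINT \<omega>=ereal k0..ereal k|lebesgue. (deriv \<eta> \<omega> *\<^sub>R vector_derivative (f x) (at \<omega>))))"

definition Lip_c :: "'b::euclidean_space set \<Rightarrow> ('b \<Rightarrow> real) \<Rightarrow> bool" where
  "Lip_c S \<phi> \<longleftrightarrow> (\<exists>L. L-lipschitz_on S \<phi>) \<and>
     compact (closure {z \<in> S. \<phi> z \<noteq> 0}) \<and> closure {z \<in> S. \<phi> z \<noteq> 0} \<subseteq> S"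

text \<open>
  In the initial condition, integrability is required explicitly because the Bochner integral of a
  non-integrable function is \<open>0\<close> by convention. It already holds for almost every time by Fubini's
  theorem, so it can always be achieved by enlarging the exceptional null set \<open>\<Psi>\<close>.
\<close>

definition entropy_solution ::
    "('a::euclidean_space \<Rightarrow> real \<Rightarrow> 'a) \<Rightarrow> real set \<Rightarrow> ('a \<Rightarrow> real) \<Rightarrow> ('a \<times> real \<Rightarrow> real) \<Rightarrow> bool"
  where
  "entropy_solution f I u0 u \<longleftrightarrow>
     Linf (UNIV \<times> I) u \<and>
     (\<forall>\<eta> q \<phi>. entropy_pair f \<eta> q \<longrightarrow> Lip_c (UNIV \<times> I) \<phi> \<longrightarrow> (\<forall>z\<in>UNIV \<times> I. 0 \<le> \<phi> z) \<longrightarrow>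
        (LINT (x, t)|lebesgue_on (UNIV \<times> I).
           (deriv (\<lambda>s. \<phi> (x, s)) t * \<eta> (u (x, t))
          + \<phi> (x, t) * (divergence (\<lambda>y. q y (u (x, t))) x
                         - deriv \<eta> (u (x, t)) * divergence (\<lambda>y. f y (u (x, t))) x)
          + gradient (\<lambda>y. \<phi> (y, t)) x \<bullet> q x (u (x, t)))) \<ge> 0) \<and>
     (\<exists>\<Psi>. \<Psi> \<subseteq> I \<and> \<Psi> \<in> null_sets lebesgue \<and>
        (\<forall>R>0. (\<forall>t\<in>I - \<Psi>. integrable (lebesgue_on (ball 0 R)) (\<lambda>x. u (x, t) - u0 x)) \<and>
           ((\<lambda>t. LINT x|lebesgue_on (ball 0 R). \<bar>u (x, t) - u0 x\<bar>) \<longlongrightarrow> 0)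
             (at 0 within ({0<..} \<inter> (I - \<Psi>)))))"

section \<open>The growth function of the flux\<close>

definition N_flux :: "('a::euclidean_space \<Rightarrow> real \<Rightarrow> 'a) \<Rightarrow> real \<Rightarrow> real \<Rightarrow> real" where
  "N_flux f M R = (if M = 0 then 0 else
     Sup {norm (f x k - f x k') / \<bar>k - k'\<bar> | x k k'.
            x \<in> ball 0 R \<and> k \<in> {-M..M} \<and> k' \<in> {-M..M} \<and> k \<noteq> k'})"

end

theory Submission
  imports Defs
begin

text \<open>
  The proof is Kruzhkov's doubling of variables. Smooth convex approximations of \<open>\<bar>s - k\<bar>\<close> turn the
  entropy inequalities into Kruzhkov's inequalities for \<open>\<bar>u - k\<bar>\<close>. This uses that the entropy flux can be
  integrated by parts in \<open>k\<close>, hence that Lipschitz functions of one real variable are differentiable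
  almost everywhere. In space-time the field \<open>(f(x,k), k)\<close> makes the inequalities stationary, so time
  plays no special role in the doubling. The doubled inequality is tested with
  \<open>\<psi>(z) \<rho>((z - w)/\<epsilon>)\<close>; as \<open>\<epsilon>\<close> tends to \<open>0\<close>, uniform differentiability of the flux turns the terms carrying
  \<open>\<nabla>\<rho>\<close> into \<open>\<integral> (A y \<bullet> \<nabla>\<rho>(y) + \<rho>(y) tr A) dy = \<integral> div (\<rho> A y) dy = 0\<close>. The
  resulting comparison inequality is tested with functions supported in the backward cones
  \<open>\<surd>(1 + \<bar>x\<bar>\<^sup>2) + (N(R) + 1) t < R\<close>, which exhaust space-time because \<open>N(R)/R\<close> tends to \<open>0\<close>.
\<close>

section \<open>Lipschitz functions of one real variable\<close>

text \<open>Two obstacles shape the limit in the doubled inequality. The divergence of the flux is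
  only measurable in \<open>x\<close>, so the terms without a gradient converge only for almost
  every translation and along a chosen sequence of \<epsilon>; as nothing but an inequality has to
  survive, one sequence is enough. And the state \<open>v (z - \<epsilon> *\<^sub>R y)\<close>
  inside the flux moves together with \<epsilon>, so a derivative for each fixed \<open>k\<close>
  would not do: here the uniformity of (2b) in \<open>k\<close> is essential. The gradient terms and
  the divergence terms need not vanish separately in the limit; the divergences of the two
  inequalities combine to the trace of the very linear map that appears in the gradient terms, and
  only the integral over \<open>y\<close> brings the two together. The initial data come in last,
  because every test function has compact support in open space-time. A ramp in time that rises on
  \<open>{a..2 * a}\<close>, at times early enough for the initial condition, carries them
  in.\<close>

text \<open>
  Adding \<open>(L + 1) x\<close> turns \<open>F\<close> into a bi-Lipschitz bijection \<open>H\<close>, and the Radon-Nikodym density of the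
  measure \<open>A \<mapsto> \<lambda>(H(A))\<close> is \<open>F' + L + 1\<close>.
\<close>

lemma lipschitz_density:
  fixes F :: "real \<Rightarrow> real"
  assumes F: "L-lipschitz_on UNIV F"
  obtains h where "\<And>a b. a \<le> b \<Longrightarrow> (h has_integral F b - F a) {a..b}"
proof -
  have L0: "L \<ge> 0" using F lipschitz_on_nonneg by blast
  have lip: "\<bar>F y - F x\<bar> \<le> L * \<bar>y - x\<bar>" for x y
    using lipschitz_onD[OF F, of y x] by (simp add: dist_real_def)
  \<comment> \<open>The extra slope \<open>L + 1\<close> leaves slopes between \<open>1\<close> and
    \<open>2 * L + 1\<close>: the lower bound makes \<open>H\<close> injective with monotone inverse
    \<open>G\<close>, the upper bound lets \<open>H\<close> carry null sets to null sets.\<close>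
  define H where "H = (\<lambda>x. F x + (L + 1) * x)"
  have low: "y - x \<le> H y - H x" and up: "H y - H x \<le> (2 * L + 1) * (y - x)" if "x \<le> y" for x y
    using lip[of y x] that by (auto simp: H_def algebra_simps abs_if split: if_splits)
  have contH: "continuous_on UNIV H"
    unfolding H_def by (intro continuous_intros lipschitz_on_continuous_on[OF F])
  have inj: "inj H"
  proof (rule injI)
    fix x y assume "H x = H y" then show "x = y" using low[of x y] low[of y x] by linarith
  qed
  have surj: "surj H"
  proof -
    have "\<exists>x. H x = y" for y
    proof -
      define c where "c = \<bar>y - H 0\<bar>"
      have "H (-c) \<le> y" "y \<le> H c" using low[of "-c" 0] low[of 0 c] by (auto simp: c_def)
      then have "\<exists>x\<ge>-c. x \<le> c \<and> H x = y"
        by (intro IVT') (auto simp: c_def intro: continuous_on_subset[OF contH])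
      then show ?thesis by blast
    qed
    then show ?thesis by (metis surjI someI_ex)
  qed
  define G where "G = inv H"
  have HG: "H (G y) = y" and GH: "G (H x) = x" for x y
    using inj surj by (auto simp: G_def surj_f_inv_f)
  have Gle: "G y \<le> b \<longleftrightarrow> y \<le> H b" "a \<le> G y \<longleftrightarrow> H a \<le> y" for y a b
    using low[of "G y" b] low[of b "G y"] low[of "G y" a] low[of a "G y"] HG[of y] by auto linarith+
  have "mono G"
    using Gle HG by (intro monoI) auto
  then have Gm[measurable]: "G \<in> borel_measurable borel" by (rule borel_measurable_mono)
  \<comment> \<open>Preimages under \<open>G\<close> are images under \<open>H\<close>, and a
    Lipschitz image of a null set is null; this is the absolute continuity that Radon-Nikodym asks
    for.\<close>
  have ac: "absolutely_continuous lborel (distr lborel borel G)"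
    unfolding absolutely_continuous_def
  proof
    fix A :: "real set" assume A: "A \<in> null_sets lborel"
    then have Ab: "A \<in> sets borel" by auto
    have "negligible A" using A negligible_iff_null_sets null_sets_completion_iff2 by (auto intro: null_sets_completionI)
    then have "negligible (H ` A)"
    proof (rule negligible_locally_Lipschitz_image[OF order_refl], intro exI[of _ UNIV] exI[of _ "2 * L + 1"] conjI ballI)
      fix x y show "norm (H y - H x) \<le> (2 * L + 1) * norm (y - x)"
        using low[of x y] up[of x y] low[of y x] up[of y x]  by (auto simp: abs_if algebra_simps)
    qed auto
    moreover have "G -` A = H ` A" using HG GH by (auto intro!: image_eqI[of _ H])
    moreover have "G -` A \<in> sets borel" using measurable_sets[OF Gm Ab] by simp
    ultimately have "G -` A \<in> null_sets lborel"
      using negligible_iff_null_sets null_sets_completion_iff by (metis sets_lborel)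
    then show "A \<in> null_sets (distr lborel borel G)"
      using Ab by (auto simp: null_sets_def emeasure_distr)
  qed
  obtain h0 where h0[measurable]: "h0 \<in> borel_measurable lborel" and h0d: "density lborel h0 = distr lborel borel G"
    using sigma_finite_measure.Radon_Nikodym[OF lborel.sigma_finite_measure_axioms ac] by auto
  \<comment> \<open>\<open>h0\<close> takes values in \<open>ennreal\<close> and
    \<open>enn2real\<close> sends \<infinity> to \<open>0\<close>; integrals over bounded intervals
    do not change, since \<open>h0\<close> is finite almost everywhere there.\<close>
  define h where "h = (\<lambda>x. enn2real (h0 x) - (L + 1))"
  have "(h has_integral F b - F a) {a..b}" if ab: "a \<le> b" for a b
  proof -
    have nn: "(\<integral>\<^sup>+x. h0 x * indicator {a..b} x \<partial>lborel) = ennreal (H b - H a)"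
    proof -
      have "(\<integral>\<^sup>+x. h0 x * indicator {a..b} x \<partial>lborel) = emeasure (density lborel h0) {a..b}"
        by (simp add: emeasure_density)
      also have "\<dots> = emeasure lborel (G -` {a..b})" unfolding h0d by (subst emeasure_distr) auto
      also have "G -` {a..b} = {H a..H b}" using Gle by auto
      also have "emeasure lborel \<dots> = ennreal (H b - H a)" using low[OF ab] ab by simp
      finally show ?thesis .
    qed
    have "AE x in lborel. h0 x * indicator {a..b} x \<noteq> \<infinity>"
      using nn by (intro nn_integral_PInf_AE) auto
    then have "(\<integral>\<^sup>+x. ennreal (enn2real (h0 x) * indicator {a..b} x) \<partial>lborel)
        = (\<integral>\<^sup>+x. h0 x * indicator {a..b} x \<partial>lborel)"
      by (intro nn_integral_cong_AE, eventually_elim)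
         (auto simp: ennreal_mult'' ennreal_enn2real_if less_top split: split_indicator)
    then have "(\<integral>\<^sup>+x. ennreal (enn2real (h0 x) * indicator {a..b} x) \<partial>lborel) = ennreal (H b - H a)"
      using nn by simp
    then have "((\<lambda>x. enn2real (h0 x) * indicator {a..b} x) has_integral (H b - H a)) UNIV"
      using low[OF ab] ab by (intro nn_integral_has_integral) (auto)
    then have "((\<lambda>x. enn2real (h0 x)) has_integral (H b - H a)) {a..b}"
      by (subst has_integral_restrict_UNIV[symmetric]) (simp add: indicator_def of_bool_def if_distrib cong: if_cong)
    from has_integral_diff[OF this has_integral_const_real[of "L+1" a b]]
    show ?thesis using ab by (simp add: h_def H_def algebra_simps)
  qed
  then show ?thesis using that by blast
qed

text \<open>Lebesgue differentiation is applied to intervals that have \<open>x\<close> as left end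
  point, so the density yields only the right derivative. The reflected density
  \<open>\<lambda>x. h (- x)\<close> supplies the left one, and off one null set both equal
  \<open>h x\<close>.\<close>

lemma lipschitz_has_derivative_AE:
  fixes F :: "real \<Rightarrow> real"
  assumes F: "L-lipschitz_on UNIV F"
  obtains h N where "negligible N" "\<And>x. x \<notin> N \<Longrightarrow> (F has_real_derivative h x) (at x)"
    "\<And>a b. a \<le> b \<Longrightarrow> (h has_integral F b - F a) {a..b}"
proof -
  obtain h where h: "\<And>a b. a \<le> b \<Longrightarrow> (h has_integral F b - F a) {a..b}"
    using lipschitz_density[OF F] by blast
  have hr: "((\<lambda>x. h (- x)) has_integral F (-a) - F (-b)) {a..b}" if "a \<le> b" for a b
    using has_integral_reflect_real[where f=h and i="F (-a) - F (-b)" and a="-b" and b="-a"] h[of "-b" "-a"] that by auto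
  have int: "h integrable_on cbox a b" "(\<lambda>x. h (- x)) integrable_on cbox a b" for a b
    using h[of a b] hr[of a b] by (cases "a \<le> b"; auto simp: integrable_on_def)+
  obtain N1 where N1: "negligible N1" "\<And>x e. x \<notin> N1 \<Longrightarrow> 0 < e \<Longrightarrow>
        \<exists>d>0. \<forall>t. 0 < t \<and> t < d \<longrightarrow> norm (integral (cbox x (x + t *\<^sub>R One)) h /\<^sub>R t ^ DIM(real) - h x) < e"
    using integrable_ccontinuous_explicit[of h] int by blast
  obtain N2 where N2: "negligible N2" "\<And>x e. x \<notin> N2 \<Longrightarrow> 0 < e \<Longrightarrow>
        \<exists>d>0. \<forall>t. 0 < t \<and> t < d \<longrightarrow> norm (integral (cbox x (x + t *\<^sub>R One)) (\<lambda>x. h (- x)) /\<^sub>R t ^ DIM(real) - h (- x)) < e"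
    using integrable_ccontinuous_explicit[of "\<lambda>x. h (- x)"] int by blast
  define N where "N = N1 \<union> uminus ` N2"
  have "negligible (uminus ` N2)"
    by (rule negligible_locally_Lipschitz_image[OF order_refl N2(1)], intro exI[of _ UNIV] exI[of _ 1]) auto
  then have "negligible N" using N1 by (simp add: N_def)
  moreover have "(F has_real_derivative h x) (at x)" if "x \<notin> N" for x
    unfolding DERIV_def LIM_eq
  proof (intro allI impI)
    fix e :: real assume "e > 0"
    have x: "x \<notin> N1" "- x \<notin> N2" using that by (force simp: N_def image_iff)+
    obtain d1 where d1: "d1 > 0" "\<And>t. 0 < t \<Longrightarrow> t < d1 \<Longrightarrow> \<bar>integral {x..x + t} h / t - h x\<bar> < e"
      using N1(2)[OF x(1) \<open>e > 0\<close>] by (auto simp: divide_inverse mult.commute)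
    obtain d2 where d2: "d2 > 0" "\<And>t. 0 < t \<Longrightarrow> t < d2 \<Longrightarrow> \<bar>integral {-x..-x + t} (\<lambda>x. h (- x)) / t - h x\<bar> < e"
      using N2(2)[OF x(2) \<open>e > 0\<close>] by (auto simp: divide_inverse mult.commute)
    have "norm ((F (x + t) - F x) / t - h x) < e" if "t \<noteq> 0" "norm (t - 0) < min d1 d2" for t
    proof (cases "t > 0")
      case True
      then show ?thesis using d1(2)[of t] that integral_unique[OF h[of x "x+t"]] by auto
    next
      case False
      have "integral {-x..-x + - t} (\<lambda>x. h (- x)) = F x - F (x + t)"
        using False integral_unique[OF hr[of "-x" "-x + - t"]] by (simp add: add.commute[of t x])
      moreover have "(F x - F (x + t)) / (- t) = (F (x + t) - F x) / t"
        using minus_divide_divide[of "F (x + t) - F x" t] by simp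
      ultimately show ?thesis using False d2(2)[of "-t"] that by simp
    qed
    then show "\<exists>s>0. \<forall>t. t \<noteq> 0 \<and> norm (t - 0) < s \<longrightarrow> norm ((F (x + t) - F x) / t - h x) < e"
      using d1(1) d2(1) by (intro exI[of _ "min d1 d2"]) auto
  qed
  ultimately show ?thesis using that h by blast
qed

section \<open>Vector-valued Lipschitz functions and integration by parts\<close>

lemma vector_derivative_lipschitz_bound:
  fixes G :: "real \<Rightarrow> 'a::real_normed_vector"
  assumes "L-lipschitz_on S G" "open S" "x \<in> S" "(G has_vector_derivative D) (at x)"
  shows "norm D \<le> L"
proof (rule tendsto_lowerbound)
  let ?q = "\<lambda>y. norm (G y - G x - (y - x) *\<^sub>R D) / norm (y - x)"
  have "(?q \<longlongrightarrow> 0) (at x)"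
    using assms(4) unfolding has_vector_derivative_def has_derivative_iff_norm by auto
  then have "((\<lambda>y. ?q y + L) \<longlongrightarrow> 0 + L) (at x)" by (rule tendsto_add[OF _ tendsto_const])
  then show "((\<lambda>y. ?q y + L) \<longlongrightarrow> L) (at x)" by simp
  have "eventually (\<lambda>y. y \<in> S - {x}) (at x)"
    using assms(2,3) by (simp add: eventually_at_topological) blast
  then show "eventually (\<lambda>y. norm D \<le> ?q y + L) (at x)"
  proof eventually_elim
    case (elim y)
    have "\<bar>y - x\<bar> * norm D = norm ((G y - G x) - (G y - G x - (y - x) *\<^sub>R D))" by simp
    also have "\<dots> \<le> norm (G y - G x) + norm (G y - G x - (y - x) *\<^sub>R D)" by (rule norm_triangle_ineq4)
    also have "norm (G y - G x) \<le> L * \<bar>y - x\<bar>"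
      using lipschitz_onD[OF assms(1), of y x] elim assms(3) by (auto simp: dist_norm)
    finally show ?case using elim by (simp add: field_simps)
  qed
qed auto

lemma lipschitz_has_integral_vector_derivative:
  fixes G :: "real \<Rightarrow> 'a::euclidean_space"
  assumes G: "L-lipschitz_on {a..b} G" and ab: "a \<le> b"
  obtains h N where "negligible N" "\<And>x. x \<in> {a<..<b} - N \<Longrightarrow> (G has_vector_derivative h x) (at x)"
    "(h has_integral G b - G a) {a..b}"
proof -
  \<comment> \<open>Clamping the argument extends \<open>G\<close> to the whole line with the same
    Lipschitz constant; inside the open interval nothing changes, so derivatives carry over.\<close>
  define G1 where "G1 = (\<lambda>x. G (max a (min b x)))"
  have L0: "L \<ge> 0" using G lipschitz_on_nonneg by blast
  have "L-lipschitz_on UNIV G1"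
  proof (rule lipschitz_onI[OF _ L0])
    fix x y :: real
    have "dist (G1 x) (G1 y) \<le> L * dist (max a (min b x)) (max a (min b y))"
      unfolding G1_def using ab by (intro lipschitz_onD[OF G]) auto
    also have "\<dots> \<le> L * dist x y"
      using L0 by (intro mult_left_mono) (auto simp: dist_real_def max_def min_def)
    finally show "dist (G1 x) (G1 y) \<le> L * dist x y" .
  qed
  then have "L-lipschitz_on UNIV (\<lambda>x. G1 x \<bullet> i)" if "i \<in> Basis" for i
    using that unfolding lipschitz_on_def dist_norm
    by (metis Basis_le_norm inner_diff_left order_trans real_norm_def)
  then have "\<exists>h N. negligible N \<and> (\<forall>x. x \<notin> N \<longrightarrow> ((\<lambda>x. G1 x \<bullet> i) has_real_derivative h x) (at x)) \<and>
      (h has_integral G1 b \<bullet> i - G1 a \<bullet> i) {a..b}" if "i \<in> Basis" for i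
    using that ab by (metis lipschitz_has_derivative_AE)
  then obtain h N where N: "\<And>i. i \<in> Basis \<Longrightarrow> negligible (N i)"
    and d: "\<And>i x. i \<in> Basis \<Longrightarrow> x \<notin> N i \<Longrightarrow> ((\<lambda>x. G1 x \<bullet> i) has_real_derivative h i x) (at x)"
    and hi: "\<And>i. i \<in> Basis \<Longrightarrow> (h i has_integral G1 b \<bullet> i - G1 a \<bullet> i) {a..b}"
    by metis
  show ?thesis
  proof (rule that[of "\<Union>i\<in>Basis. N i" "\<lambda>x. \<Sum>i\<in>Basis. h i x *\<^sub>R i"])
    show "negligible (\<Union>i\<in>Basis. N i)" using N by (intro negligible_Union) auto
    show "(G has_vector_derivative (\<Sum>i\<in>Basis. h i x *\<^sub>R i)) (at x)" if "x \<in> {a<..<b} - (\<Union>i\<in>Basis. N i)" for x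
    proof -
      have "((\<lambda>x. \<Sum>i\<in>Basis. (G1 x \<bullet> i) *\<^sub>R i) has_vector_derivative (\<Sum>i\<in>Basis. h i x *\<^sub>R i)) (at x)"
        using that d by (intro has_vector_derivative_sum)
          (auto intro!: derivative_eq_intros simp: has_real_derivative_iff_has_vector_derivative)
      then have "(G1 has_vector_derivative (\<Sum>i\<in>Basis. h i x *\<^sub>R i)) (at x)"
        by (simp add: euclidean_representation)
      then show ?thesis
        by (rule has_vector_derivative_transform_within_open[where S="{a<..<b}"])
           (use that in \<open>auto simp: G1_def\<close>)
    qed
    have "((\<lambda>x. \<Sum>i\<in>Basis. h i x *\<^sub>R i) has_integral (\<Sum>i\<in>Basis. (G1 b \<bullet> i - G1 a \<bullet> i) *\<^sub>R i)) {a..b}"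
      using hi by (intro has_integral_sum) (auto intro: has_integral_scaleR_left)
    also have "(\<Sum>i\<in>Basis. (G1 b \<bullet> i - G1 a \<bullet> i) *\<^sub>R i) = G b - G a"
      using ab by (simp add: inner_diff_left[symmetric] euclidean_representation G1_def)
    finally show "((\<lambda>x. \<Sum>i\<in>Basis. h i x *\<^sub>R i) has_integral G b - G a) {a..b}" .
  qed
qed

text \<open>With this weight the oriented integral from \<open>k\<close> to \<open>u\<close> becomes
  an integral over the whole line. A moving end point then sits in the integrand, where linearity
  and measurability in \<open>u\<close> are easy to obtain.\<close>

definition oriented_indicator :: "real \<Rightarrow> real \<Rightarrow> real \<Rightarrow> real" where
  "oriented_indicator k u \<omega> = (if k < \<omega> \<and> \<omega> < u then 1 else if u < \<omega> \<and> \<omega> < k then -1 else 0)"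

text \<open>Both \<open>G\<close> and its product with \<open>\<nu>\<close> are Lipschitz on the
  interval, hence primitives of their almost everywhere derivatives, and the product rule holds off
  a null set. The left side is an integral over \<open>lebesgue\<close>, as in
  \<open>entropy_pair\<close>: the derivative is controlled only up to a null set.\<close>

lemma integration_by_parts_lipschitz_Ioo:
  fixes G :: "real \<Rightarrow> 'a::euclidean_space"
  assumes G: "L-lipschitz_on {a..b} G" and ab: "a \<le> b"
    and \<nu>: "\<And>x. (\<nu> has_real_derivative \<nu>' x) (at x)" and \<nu>'c: "continuous_on UNIV \<nu>'"
  shows "(LINT \<omega>:{a<..<b}|lebesgue. \<nu> \<omega> *\<^sub>R vector_derivative G (at \<omega>))
     = \<nu> b *\<^sub>R G b - \<nu> a *\<^sub>R G a - (LINT \<omega>:{a<..<b}|lborel. \<nu>' \<omega> *\<^sub>R G \<omega>)"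
proof -
  have \<nu>c: "continuous_on S \<nu>" for S using \<nu> DERIV_isCont continuous_at_imp_continuous_on by blast
  have Gc: "continuous_on {a..b} G" using G lipschitz_on_continuous_on by blast
  have \<nu>'c: "continuous_on S \<nu>'" for S using \<nu>'c continuous_on_subset by blast
  obtain B where B: "B \<ge> 0" "\<And>x. x \<in> {a..b} \<Longrightarrow> \<bar>\<nu>' x\<bar> \<le> B" "\<And>x. x \<in> {a..b} \<Longrightarrow> \<bar>\<nu> x\<bar> \<le> B" "\<And>x. x \<in> {a..b} \<Longrightarrow> norm (G x) \<le> B"
  proof -
    have "bounded (\<nu>' ` {a..b})" "bounded (\<nu> ` {a..b})" "bounded (G ` {a..b})"
      using \<nu>'c \<nu>c Gc by (auto intro!: compact_imp_bounded compact_continuous_image)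
    then have "bounded (\<nu>' ` {a..b} \<union> \<nu> ` {a..b})" "bounded (G ` {a..b})" by auto
    then obtain B1 B2 where "\<forall>x\<in>\<nu>' ` {a..b} \<union> \<nu> ` {a..b}. norm x \<le> B1" "\<forall>x\<in>G ` {a..b}. norm x \<le> B2"
      by (meson bounded_iff)
    then show ?thesis by (intro that[of "max 0 (max B1 B2)"]) (auto simp: le_max_iff_disj)
  qed
  have L0: "L \<ge> 0" using G lipschitz_on_nonneg by blast
  have \<nu>l: "\<bar>\<nu> x - \<nu> y\<bar> \<le> B * \<bar>x - y\<bar>" if "x \<in> {a..b}" "y \<in> {a..b}" for x y
    using field_differentiable_bound[of "{a..b}" \<nu> \<nu>' B x y] that B(2) has_field_derivative_at_within[OF \<nu>]
    by auto
  have "(B * L + B * B)-lipschitz_on {a..b} (\<lambda>x. \<nu> x *\<^sub>R G x)"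
  proof (rule lipschitz_onI)
    fix x y assume xy: "x \<in> {a..b}" "y \<in> {a..b}"
    have "\<nu> x *\<^sub>R G x - \<nu> y *\<^sub>R G y = \<nu> x *\<^sub>R (G x - G y) + (\<nu> x - \<nu> y) *\<^sub>R G y"
      by (simp add: algebra_simps)
    also have "norm \<dots> \<le> B * (L * \<bar>x - y\<bar>) + (B * \<bar>x - y\<bar>) * B"
      using lipschitz_onD[OF G xy] \<nu>l[OF xy] B xy L0
      by (intro norm_triangle_mono) (auto simp: dist_norm intro!: mult_mono)
    finally show "dist (\<nu> x *\<^sub>R G x) (\<nu> y *\<^sub>R G y) \<le> (B * L + B * B) * dist x y"
      by (simp add: dist_norm algebra_simps)
  qed (use B L0 in auto)
  then obtain p N where N: "negligible N" and p: "\<And>x. x \<in> {a<..<b} - N \<Longrightarrow> ((\<lambda>x. \<nu> x *\<^sub>R G x) has_vector_derivative p x) (at x)"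
    and pint: "(p has_integral \<nu> b *\<^sub>R G b - \<nu> a *\<^sub>R G a) {a..b}"
    using lipschitz_has_integral_vector_derivative ab by (metis (no_types, lifting))
  obtain h N' where N': "negligible N'" and h: "\<And>x. x \<in> {a<..<b} - N' \<Longrightarrow> (G has_vector_derivative h x) (at x)"
    and hint: "(h has_integral G b - G a) {a..b}"
    using lipschitz_has_integral_vector_derivative[OF G ab] by metis
  let ?M = "N \<union> N' \<union> {a, b}"
  \<comment> \<open>Setting the function to \<open>0\<close> on the null set, which includes the end
    points, gives a version that is bounded on the whole interval; the bound upgrades gauge
    integrability to absolute integrability.\<close>
  define h' where "h' = (\<lambda>x. if x \<in> ?M then 0 else \<nu> x *\<^sub>R vector_derivative G (at x))"
  have neg: "negligible ?M" using N N' by auto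
  have eq: "p x = \<nu> x *\<^sub>R vector_derivative G (at x) + \<nu>' x *\<^sub>R G x" and hb: "norm (vector_derivative G (at x)) \<le> L"
    if "x \<in> {a..b} - ?M" for x
  proof -
    have x: "x \<in> {a<..<b} - N" "x \<in> {a<..<b} - N'" using that by auto
    have g: "vector_derivative G (at x) = h x" using h[OF x(2)] by (rule vector_derivative_at)
    have "((\<lambda>x. \<nu> x *\<^sub>R G x) has_vector_derivative (\<nu> x *\<^sub>R h x + \<nu>' x *\<^sub>R G x)) (at x)"
      using \<nu>[of x] h[OF x(2)] by (rule has_vector_derivative_scaleR)
    then show "p x = \<nu> x *\<^sub>R vector_derivative G (at x) + \<nu>' x *\<^sub>R G x"
      using vector_derivative_unique_at[OF p[OF x(1)]] g by simp
    have "L-lipschitz_on {a<..<b} G" using G by (rule lipschitz_on_subset) auto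
    then show "norm (vector_derivative G (at x)) \<le> L"
      using vector_derivative_lipschitz_bound[OF _ _ _ h[OF x(2)]] x g by auto
  qed
  have int1: "((\<lambda>x. \<nu>' x *\<^sub>R G x) has_integral integral {a..b} (\<lambda>x. \<nu>' x *\<^sub>R G x)) {a..b}"
    by (intro integrable_integral integrable_continuous_real continuous_intros \<nu>'c Gc)
  have "((\<lambda>x. p x - \<nu>' x *\<^sub>R G x) has_integral (\<nu> b *\<^sub>R G b - \<nu> a *\<^sub>R G a - integral {a..b} (\<lambda>x. \<nu>' x *\<^sub>R G x))) {a..b}"
    by (rule has_integral_diff[OF pint int1])
  then have h'i: "(h' has_integral (\<nu> b *\<^sub>R G b - \<nu> a *\<^sub>R G a - integral {a..b} (\<lambda>x. \<nu>' x *\<^sub>R G x))) {a..b}"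
    by (rule has_integral_spike[OF neg, rotated]) (auto simp: h'_def eq)
  have abs0: "h' absolutely_integrable_on {a..b}"
  proof (rule absolutely_integrable_integrable_bound[where g="\<lambda>_. B * L"])
    show "norm (h' x) \<le> B * L" if "x \<in> {a..b}" for x
      using that B L0 hb by (auto simp: h'_def intro!: mult_mono)
  qed (use h'i in auto)
  have abs: "(\<lambda>x. \<nu> x *\<^sub>R vector_derivative G (at x)) absolutely_integrable_on {a<..<b}"
  proof (rule set_integrable_subset)
    show "(\<lambda>x. \<nu> x *\<^sub>R vector_derivative G (at x)) absolutely_integrable_on {a..b}"
      by (rule absolutely_integrable_spike[OF abs0 neg]) (simp add: h'_def)
  qed auto
  have "(LINT \<omega>:{a<..<b}|lebesgue. \<nu> \<omega> *\<^sub>R vector_derivative G (at \<omega>)) = integral {a<..<b} (\<lambda>\<omega>. \<nu> \<omega> *\<^sub>R vector_derivative G (at \<omega>))"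
    by (rule set_lebesgue_integral_eq_integral[OF abs])
  also have "\<dots> = integral {a..b} h'"
    unfolding integral_open_interval_real[symmetric]
    by (rule integral_spike[OF neg]) (auto simp: h'_def)
  also have "\<dots> = \<nu> b *\<^sub>R G b - \<nu> a *\<^sub>R G a - integral {a<..<b} (\<lambda>x. \<nu>' x *\<^sub>R G x)"
    using integral_unique[OF h'i] by (simp only: integral_open_interval_real)
  also have "integral {a<..<b} (\<lambda>x. \<nu>' x *\<^sub>R G x) = (LINT \<omega>:{a<..<b}|lborel. \<nu>' \<omega> *\<^sub>R G \<omega>)"
  proof (rule set_borel_integral_eq_integral(2)[symmetric])
    have "set_integrable lborel {a..b} (\<lambda>x. \<nu>' x *\<^sub>R G x)"
      unfolding set_integrable_def by (intro borel_integrable_compact continuous_intros \<nu>'c Gc) auto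
    then show "set_integrable lborel {a<..<b} (\<lambda>x. \<nu>' x *\<^sub>R G x)"
      by (rule set_integrable_subset) auto
  qed
  finally show ?thesis .
qed

text \<open>This removes the derivative in \<open>k\<close> from the entropy flux. What is left
  depends on \<open>G\<close> only through its values, so for \<open>G = f x\<close> it can be
  differentiated in \<open>x\<close> under the integral.\<close>

lemma integration_by_parts_lipschitz:
  fixes G :: "real \<Rightarrow> 'a::euclidean_space"
  assumes G: "\<And>a b. \<exists>L. L-lipschitz_on {a..b} G"
    and \<nu>: "\<And>x. (\<nu> has_real_derivative \<nu>' x) (at x)" and \<nu>'c: "continuous_on UNIV \<nu>'"
  shows "(LINT \<omega>=ereal k..ereal u|lebesgue. (\<nu> \<omega> *\<^sub>R vector_derivative G (at \<omega>)))
     = \<nu> u *\<^sub>R G u - \<nu> k *\<^sub>R G k - (\<integral>\<omega>. oriented_indicator k u \<omega> *\<^sub>R (\<nu>' \<omega> *\<^sub>R G \<omega>) \<partial>lborel)"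
proof (cases "k \<le> u")
  case True
  obtain L where L: "L-lipschitz_on {k..u} G" using G by blast
  have "(LINT \<omega>:{k<..<u}|lborel. \<nu>' \<omega> *\<^sub>R G \<omega>) = (\<integral>\<omega>. oriented_indicator k u \<omega> *\<^sub>R (\<nu>' \<omega> *\<^sub>R G \<omega>) \<partial>lborel)"
    unfolding set_lebesgue_integral_def using True by (intro Bochner_Integration.integral_cong) (auto simp: oriented_indicator_def indicator_def)
  then show ?thesis using integration_by_parts_lipschitz_Ioo[OF L True \<nu> \<nu>'c] True
    by (simp add: interval_lebesgue_integral_def)
next
  case False
  then have ku: "u \<le> k" by simp
  obtain L where L: "L-lipschitz_on {u..k} G" using G by blast
  have "(LINT \<omega>:{u<..<k}|lborel. \<nu>' \<omega> *\<^sub>R G \<omega>) = (\<integral>\<omega>. - (oriented_indicator k u \<omega> *\<^sub>R (\<nu>' \<omega> *\<^sub>R G \<omega>)) \<partial>lborel)"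
    unfolding set_lebesgue_integral_def using False by (intro Bochner_Integration.integral_cong) (auto simp: oriented_indicator_def indicator_def)
  then show ?thesis using integration_by_parts_lipschitz_Ioo[OF L ku \<nu> \<nu>'c] False
    by (simp add: interval_lebesgue_integral_def)
qed

section \<open>Translations in the mean\<close>

lemma sets_borel_balls [measurable]: "ball (a::'e::metric_space) r \<in> sets borel" "cball a r \<in> sets borel"
  by auto

lemma integrable_indicator_bounded:
  "bounded S \<Longrightarrow> S \<in> sets borel \<Longrightarrow> integrable lborel (indicat_real S)"
  by (intro integrable_real_indicator emeasure_bounded_finite) auto

lemma measurable_lborel_pair:
  "f \<in> borel_measurable (borel \<Otimes>\<^sub>M borel) \<Longrightarrow> f \<in> borel_measurable (lborel \<Otimes>\<^sub>M lborel)"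
  by (subst measurable_cong_sets[OF sets_pair_measure_cong refl]) auto

text \<open>Continuous functions approximate \<open>p\<close> in the mean on the ball of radius
  \<open>r + 1\<close>, which contains all translates of the smaller ball by vectors shorter than
  \<open>1\<close>. For the approximant uniform continuity suffices, and by translation invariance
  the two approximation errors have the same bound.\<close>

lemma translation_continuous_L1:
  fixes p :: "'e::euclidean_space \<Rightarrow> real"
  assumes p[measurable]: "p \<in> borel_measurable borel"
    and C: "\<And>z. norm z < r + 1 \<Longrightarrow> \<bar>p z\<bar> \<le> C" and e: "e > 0"
  shows "\<exists>d>0. \<forall>h. norm h < d \<longrightarrow>
    (\<integral>\<^sup>+z. indicator (ball 0 r) z * ennreal \<bar>p (z - h) - p z\<bar> \<partial>lborel) \<le> ennreal e"
proof -
  define C' where "C' = max C 0"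
  have C': "\<bar>p z\<bar> \<le> C'" "C' \<ge> 0" if "norm z < r + 1" for z using C[OF that] by (auto simp: C'_def)
  have C'0: "C' \<ge> 0" by (simp add: C'_def)
  have "p measurable_on UNIV"
    by (intro lebesgue_measurable_imp_measurable_on measurable_completion) auto
  then obtain N g where N: "negligible N" and g: "\<And>n. continuous_on UNIV (g n)"
    and gl: "\<And>x. x \<notin> N \<Longrightarrow> (\<lambda>n. g n x) \<longlonglongrightarrow> p x"
    unfolding measurable_on_def by auto
  \<comment> \<open>Pointwise approximants of \<open>p\<close> come without a common bound.
    Truncation at \<open>C'\<close> provides a dominating function and keeps the limit, because
    \<open>p\<close> is bounded by \<open>C'\<close> on the larger ball.\<close>
  define G where "G = (\<lambda>n z. max (- C') (min C' (g n z)))"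
  have G: "continuous_on UNIV (G n)" for n
    unfolding G_def by (intro continuous_intros g)
  have [measurable]: "G n \<in> borel_measurable borel" for n
    using G by (rule borel_measurable_continuous_onI)
  have "(\<lambda>n. \<integral>z. indicator (ball 0 (r + 1)) z * \<bar>G n z - p z\<bar> \<partial>lborel) \<longlonglongrightarrow> (\<integral>z. 0 \<partial>(lborel :: 'e measure))"
  proof (rule integral_dominated_convergence[where w="\<lambda>z. indicator (ball 0 (r + 1)) z * (2 * C')"])
    have "AE z in lborel. z \<notin> N"
      using N by (metis AE_completion_iff AE_not_in negligible_iff_null_sets)
    then show "AE z in lborel. (\<lambda>n. indicator (ball 0 (r + 1)) z * \<bar>G n z - p z\<bar>) \<longlonglongrightarrow> 0"
    proof eventually_elim
      case (elim z)
      show ?case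
      proof (cases "norm z < r + 1")
        case True
        have "(\<lambda>n. \<bar>G n z - p z\<bar>) \<longlonglongrightarrow> \<bar>max (- C') (min C' (p z)) - p z\<bar>"
          unfolding G_def by (intro tendsto_intros gl elim)
        also have "max (- C') (min C' (p z)) = p z" using C'[OF True] by (auto simp: abs_le_iff)
        finally show ?thesis using True by (simp add: indicator_def)
      qed (simp add: indicator_def)
    qed
    show "AE z in lborel. norm (indicator (ball 0 (r + 1)) z * \<bar>G n z - p z\<bar>) \<le> indicator (ball 0 (r + 1)) z * (2 * C')" for n
    proof (rule AE_I2)
      fix z :: 'e
      have "\<bar>G n z\<bar> \<le> C'" using C'0 by (auto simp: G_def)
      then show "norm (indicator (ball 0 (r + 1)) z * \<bar>G n z - p z\<bar>) \<le> indicator (ball 0 (r + 1)) z * (2 * C')"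
        using C'[of z] by (auto simp: indicator_def)
    qed
    show "integrable lborel (\<lambda>z::'e. indicator (ball 0 (r + 1)) z * (2 * C'))"
      by (intro integrable_mult_left integrable_indicator_bounded) auto
  qed auto
  then have "eventually (\<lambda>n. (\<integral>z. indicator (ball 0 (r + 1)) z * \<bar>G n z - p z\<bar> \<partial>lborel) < e / 3) sequentially"
    using e by (intro order_tendstoD) auto
  then obtain n where n: "(\<integral>z. indicator (ball 0 (r + 1)) z * \<bar>G n z - p z\<bar> \<partial>lborel) < e / 3"
    using eventually_sequentially by auto
  define q where "q = (\<lambda>z. indicator (ball 0 (r + 1)) z * \<bar>G n z - p z\<bar>)"
  have [measurable]: "q \<in> borel_measurable borel" unfolding q_def by measurable
  have q0: "q z \<ge> 0" for z by (simp add: q_def)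
  have qint: "(\<integral>\<^sup>+z. ennreal (q z) \<partial>lborel) \<le> ennreal (e / 3)"
  proof -
    have "integrable lborel (\<lambda>z::'e. indicator (ball 0 (r + 1)) z * (2 * C'))"
      by (intro integrable_mult_left integrable_indicator_bounded) auto
    then have "integrable lborel q"
    proof (rule Bochner_Integration.integrable_bound)
      show "AE z in lborel. norm (q z) \<le> norm (indicator (ball 0 (r + 1)) z * (2 * C'))"
      proof (rule AE_I2)
        fix z :: 'e
        have "\<bar>G n z\<bar> \<le> C'" using C'0 by (auto simp: G_def)
        then show "norm (q z) \<le> norm (indicator (ball 0 (r + 1)) z * (2 * C'))"
          using C'[of z] C'0 by (auto simp: indicator_def q_def)
      qed
    qed auto
    then have "(\<integral>\<^sup>+z. ennreal (q z) \<partial>lborel) = ennreal (\<integral>z. q z \<partial>lborel)"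
      by (intro nn_integral_eq_integral) (auto simp: q0)
    then show ?thesis using n by (simp add: q_def[symmetric] ennreal_leI)
  qed
  \<comment> \<open>The middle term is uniformly small and contributes its bound times
    \<open>V\<close>; the tolerance uses \<open>V + 1\<close> so that it also makes sense when
    \<open>V\<close> is \<open>0\<close>.\<close>
  define V where "V = measure lborel (ball (0::'e) r)"
  have V0: "V \<ge> 0" by (simp add: V_def)
  have "uniformly_continuous_on (cball 0 (r + 1)) (G n)"
    by (intro compact_uniformly_continuous continuous_on_subset[OF G]) auto
  then obtain d where d: "d > 0" "\<And>x x'. x \<in> cball 0 (r + 1) \<Longrightarrow> x' \<in> cball 0 (r + 1) \<Longrightarrow> dist x' x < d \<Longrightarrow> dist (G n x') (G n x) < e / (3 * (V + 1))"
    using e V0 unfolding uniformly_continuous_on_def by (metis add_nonneg_pos divide_pos_pos mult_pos_pos zero_less_numeral zero_less_one)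
  show ?thesis
  proof (intro exI[of _ "min d 1"] conjI allI impI)
    fix h :: 'e assume h: "norm h < min d 1"
    have m1: "(\<lambda>z. ennreal (q (z - h))) \<in> borel_measurable lborel"
      and m2: "(\<lambda>z. indicator (ball (0::'e) r) z * ennreal (e / (3 * (V + 1)))) \<in> borel_measurable lborel"
      and m3: "(\<lambda>z. ennreal (q z)) \<in> borel_measurable lborel"
      by simp_all
    have m4: "(\<lambda>z. indicator (ball (0::'e) r) z * ennreal (e / (3 * (V + 1))) + ennreal (q z)) \<in> borel_measurable lborel"
      using m2 m3 by (rule borel_measurable_add)
    have "(\<integral>\<^sup>+z. indicator (ball 0 r) z * ennreal \<bar>p (z - h) - p z\<bar> \<partial>lborel)
       \<le> (\<integral>\<^sup>+z. ennreal (q (z - h)) + (indicator (ball 0 r) z * ennreal (e / (3 * (V + 1))) + ennreal (q z)) \<partial>lborel)"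
    proof (rule nn_integral_mono)
      fix z :: 'e
      show "indicator (ball 0 r) z * ennreal \<bar>p (z - h) - p z\<bar>
        \<le> ennreal (q (z - h)) + (indicator (ball 0 r) z * ennreal (e / (3 * (V + 1))) + ennreal (q z))"
      proof (cases "norm z < r")
        case True
        have zh: "norm (z - h) < r + 1" using True h norm_triangle_ineq4[of z h] by simp
        have "\<bar>G n (z - h) - G n z\<bar> < e / (3 * (V + 1))"
          using d(2)[of z "z - h"] True zh h by (simp add: dist_norm norm_minus_commute)
        then have "\<bar>p (z - h) - p z\<bar> \<le> q (z - h) + (e / (3 * (V + 1)) + q z)"
          using True zh by (simp add: q_def)
        then show ?thesis using True e V0 q0
          by (simp add: ennreal_plus[symmetric] ennreal_leI del: ennreal_plus)
      qed simp
    qed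
    also have "\<dots> = (\<integral>\<^sup>+z. ennreal (q (z - h)) \<partial>lborel) + ((\<integral>\<^sup>+z. indicator (ball (0::'e) r) z * ennreal (e / (3 * (V + 1))) \<partial>lborel) + (\<integral>\<^sup>+z. ennreal (q z) \<partial>lborel))"
      by (simp only: nn_integral_add[OF m1 m4] nn_integral_add[OF m2 m3])
    also have "(\<integral>\<^sup>+z. ennreal (q (z - h)) \<partial>lborel) = (\<integral>\<^sup>+z. ennreal (q z) \<partial>lborel)"
    proof -
      have "(\<integral>\<^sup>+z. ennreal (q z) \<partial>lborel) = (\<integral>\<^sup>+z. ennreal (q z) \<partial>(distr lborel borel ((+) (- h))))"
        by (simp add: lborel_distr_plus)
      then show ?thesis by (subst (asm) nn_integral_distr) auto
    qed
    also have "(\<integral>\<^sup>+z. indicator (ball (0::'e) r) z * ennreal (e / (3 * (V + 1))) \<partial>lborel) \<le> ennreal (e / 3)"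
    proof -
      have "emeasure lborel (ball (0::'e) r) = ennreal V"
        unfolding V_def by (rule emeasure_eq_ennreal_measure) (simp add: less_top emeasure_bounded_finite[unfolded infinity_ennreal_def])
      then have "(\<integral>\<^sup>+z. indicator (ball (0::'e) r) z * ennreal (e / (3 * (V + 1))) \<partial>lborel) = ennreal (V * (e / (3 * (V + 1))))"
        using V0 e by (subst nn_integral_multc) (auto simp: ennreal_mult'[symmetric])
      also have "\<dots> \<le> ennreal (e / 3)" using V0 e by (intro ennreal_leI) (simp add: field_simps)
      finally show ?thesis .
    qed
    also note qint
    also have "ennreal (e / 3) + (ennreal (e / 3) + ennreal (e / 3)) = ennreal e"
      using e by (simp add: ennreal_plus[symmetric] del: ennreal_plus)
    finally show "(\<integral>\<^sup>+z. indicator (ball 0 r) z * ennreal \<bar>p (z - h) - p z\<bar> \<partial>lborel) \<le> ennreal e"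
      by (simp add: add_mono)
  qed (use d in auto)
qed

text \<open>
  The sequence is chosen so sparse that the mean errors are summable for every \<open>i\<close>; this is why one
  sequence serves all countably many functions.
\<close>

lemma AE_translation_sequence:
  fixes p :: "nat \<Rightarrow> 'e::euclidean_space \<Rightarrow> real"
  assumes p[measurable]: "\<And>i. p i \<in> borel_measurable borel"
    and bd: "\<And>i r. \<exists>C. \<forall>z. norm z \<le> r \<longrightarrow> \<bar>p i z\<bar> \<le> C"
  obtains \<epsilon> :: "nat \<Rightarrow> real" where "\<And>n. 0 < \<epsilon> n" "\<epsilon> \<longlonglongrightarrow> 0"
    "AE x in lborel \<Otimes>\<^sub>M lborel. norm (snd x) \<le> 1 \<longrightarrow> (\<forall>i. (\<lambda>n. p i (fst x - \<epsilon> n *\<^sub>R snd x)) \<longlonglongrightarrow> p i (fst x))"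
proof -
  define a where "a = (\<lambda>i r \<epsilon> x. indicator (ball (0::'e) r) (fst x) * indicator (cball (0::'e) 1) (snd x) * \<bar>p i (fst x - \<epsilon> *\<^sub>R snd x) - p i (fst x)\<bar>)"
  have [measurable]: "a i r \<epsilon> \<in> borel_measurable (lborel \<Otimes>\<^sub>M lborel)" for i r \<epsilon>
  proof (rule measurable_lborel_pair)
    have [measurable]: "ball (0::'e) r \<in> sets borel" "cball (0::'e) 1 \<in> sets borel" by auto
    show "a i r \<epsilon> \<in> borel_measurable (borel \<Otimes>\<^sub>M borel)"
      unfolding a_def by measurable
  qed
  have a0: "a i r \<epsilon> x \<ge> 0" for i r \<epsilon> x by (simp add: a_def)
  define D where "D = (\<lambda>i r \<epsilon>. \<integral>\<^sup>+x. ennreal (a i r \<epsilon> x) \<partial>(lborel \<Otimes>\<^sub>M lborel))"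
  have D: "eventually (\<lambda>\<epsilon>. D i r \<epsilon> \<le> ennreal e) (at_right 0)" if e: "e > 0" for i e and r :: real
  proof -
    define V where "V = measure lborel (cball (0::'e) 1)"
    have V0: "V \<ge> 0" by (simp add: V_def)
    have V: "emeasure lborel (cball (0::'e) 1) = ennreal V"
      unfolding V_def by (rule emeasure_eq_ennreal_measure) (simp add: less_top emeasure_bounded_finite[unfolded infinity_ennreal_def])
    obtain C where C: "\<And>z. norm z \<le> r + 1 \<Longrightarrow> \<bar>p i z\<bar> \<le> C" using bd by meson
    have e': "e / (V + 1) > 0" using e V0 by simp
    obtain d where d: "d > 0" "\<And>h. norm h < d \<Longrightarrow>
      (\<integral>\<^sup>+z. indicator (ball 0 r) z * ennreal \<bar>p i (z - h) - p i z\<bar> \<partial>lborel) \<le> ennreal (e / (V + 1))"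
      using translation_continuous_L1[OF p _ e', of r i C] C by fastforce
    have "D i r \<epsilon> \<le> ennreal e" if \<epsilon>: "0 < \<epsilon>" "\<epsilon> < d" for \<epsilon>
    proof -
      have "D i r \<epsilon> = (\<integral>\<^sup>+y. (\<integral>\<^sup>+z. ennreal (a i r \<epsilon> (z, y)) \<partial>lborel) \<partial>lborel)"
        unfolding D_def by (rule lborel_pair.nn_integral_snd[symmetric]) auto
      also have "\<dots> \<le> (\<integral>\<^sup>+y. indicator (cball (0::'e) 1) y * ennreal (e / (V + 1)) \<partial>lborel)"
      proof (rule nn_integral_mono)
        fix y :: 'e
        show "(\<integral>\<^sup>+z. ennreal (a i r \<epsilon> (z, y)) \<partial>lborel) \<le> indicator (cball (0::'e) 1) y * ennreal (e / (V + 1))"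
        proof (cases "norm y \<le> 1")
          case True
          have "norm (\<epsilon> *\<^sub>R y) < d" using \<epsilon> True by (simp add: mult_left_le order_le_less_trans[of "\<epsilon> * norm y" \<epsilon>])
          from d(2)[OF this] True show ?thesis by (simp add: a_def ennreal_mult ennreal_indicator)
        qed (simp add: a_def)
      qed
      also have "\<dots> = ennreal (V * (e / (V + 1)))"
        using V V0 e by (subst nn_integral_multc) (auto simp: ennreal_mult'[symmetric])
      also have "\<dots> \<le> ennreal e" using V0 e by (intro ennreal_leI) (simp add: field_simps)
      finally show ?thesis .
    qed
    then show ?thesis using d(1) by (auto simp: eventually_at_right_field)
  qed
  \<comment> \<open>The \<open>n\<close>-th scale handles only the functions of index at most
    \<open>n\<close> on the ball of radius \<open>n\<close>: finitely many conditions, each true for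
    all small \<epsilon>.\<close>
  have "\<exists>\<epsilon>. 0 < \<epsilon> \<and> \<epsilon> < 1 / real (Suc n) \<and> (\<forall>i\<in>{..n}. D i (real n) \<epsilon> \<le> ennreal ((1/2) ^ n))" for n
  proof -
    have "eventually (\<lambda>\<epsilon>. 0 < \<epsilon> \<and> \<epsilon> < 1 / real (Suc n)) (at_right (0::real))"
      unfolding eventually_at_right_field by (intro exI[of _ "1 / real (Suc n)"]) auto
    moreover have "eventually (\<lambda>\<epsilon>. \<forall>i\<in>{..n}. D i (real n) \<epsilon> \<le> ennreal ((1/2) ^ n)) (at_right 0)"
      by (intro eventually_ball_finite ballI D) auto
    ultimately have "eventually (\<lambda>\<epsilon>. 0 < \<epsilon> \<and> \<epsilon> < 1 / real (Suc n) \<and> (\<forall>i\<in>{..n}. D i (real n) \<epsilon> \<le> ennreal ((1/2) ^ n))) (at_right 0)"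
      by eventually_elim auto
    then show ?thesis by (rule eventually_happens'[rotated]) simp
  qed
  then obtain \<epsilon> where \<epsilon>: "\<And>n. 0 < \<epsilon> n" "\<And>n. \<epsilon> n < 1 / real (Suc n)"
    "\<And>n i. i \<le> n \<Longrightarrow> D i (real n) (\<epsilon> n) \<le> ennreal ((1/2) ^ n)" by (metis atMost_iff)
  have lim: "\<epsilon> \<longlonglongrightarrow> 0"
  proof (rule tendsto_sandwich[OF _ _ tendsto_const])
    show "(\<lambda>n. 1 / real (Suc n)) \<longlonglongrightarrow> 0" using LIMSEQ_inverse_real_of_nat by (simp add: inverse_eq_divide)
  qed (use \<epsilon> in \<open>auto intro!: always_eventually less_imp_le\<close>)
  have "AE x in lborel \<Otimes>\<^sub>M lborel. \<forall>i r. (\<lambda>n. a i (real r) (\<epsilon> n) x) \<longlonglongrightarrow> 0"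
    unfolding AE_all_countable
  proof (intro allI)
    fix i r :: nat
    \<comment> \<open>From index \<open>max i r\<close> on, the fixed pair \<open>i\<close>,
      \<open>r\<close> is among those handled, with an error of at most \<open>(1/2) ^ n\<close>
      after the shift by \<open>m\<close>.\<close>
    define m where "m = max i r"
    have le: "D i (real r) (\<epsilon> (n + m)) \<le> ennreal ((1/2) ^ n)" for n
    proof -
      have "D i (real r) (\<epsilon> (n + m)) \<le> D i (real (n + m)) (\<epsilon> (n + m))"
        unfolding D_def by (intro nn_integral_mono ennreal_leI) (auto simp: a_def m_def indicator_def)
      also have "\<dots> \<le> ennreal ((1/2) ^ (n + m))" by (rule \<epsilon>) (simp add: m_def)
      also have "\<dots> \<le> ennreal ((1/2) ^ n)" by (intro ennreal_leI power_decreasing) auto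
      finally show ?thesis .
    qed
    have "(\<integral>\<^sup>+x. (\<Sum>n. ennreal (a i (real r) (\<epsilon> (n + m)) x)) \<partial>(lborel \<Otimes>\<^sub>M lborel)) = (\<Sum>n. D i (real r) (\<epsilon> (n + m)))"
      unfolding D_def by (rule nn_integral_suminf) simp
    also have "\<dots> \<le> (\<Sum>n. ennreal ((1/2) ^ n))" by (intro suminf_le le) auto
    also have "\<dots> = ennreal (\<Sum>n. (1/2) ^ n)" by (intro suminf_ennreal2) auto
    finally have fin0: "(\<integral>\<^sup>+x. (\<Sum>n. ennreal (a i (real r) (\<epsilon> (n + m)) x)) \<partial>(lborel \<Otimes>\<^sub>M lborel)) \<le> ennreal (\<Sum>n. (1/2) ^ n)" .
    have fin: "(\<integral>\<^sup>+x. (\<Sum>n. ennreal (a i (real r) (\<epsilon> (n + m)) x)) \<partial>(lborel \<Otimes>\<^sub>M lborel)) \<noteq> \<infinity>"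
      using le_less_trans[OF fin0 ennreal_less_top] by auto
    \<comment> \<open>A nonnegative series with finite integral converges almost everywhere, so its
      terms tend to \<open>0\<close>; convergence in the mean has become pointwise
      convergence.\<close>
    have "AE x in lborel \<Otimes>\<^sub>M lborel. (\<Sum>n. ennreal (a i (real r) (\<epsilon> (n + m)) x)) \<noteq> \<infinity>"
      by (rule nn_integral_PInf_AE[OF _ fin]) simp
    then show "AE x in lborel \<Otimes>\<^sub>M lborel. (\<lambda>n. a i (real r) (\<epsilon> n) x) \<longlonglongrightarrow> 0"
    proof eventually_elim
      case (elim x)
      then have "summable (\<lambda>n. a i (real r) (\<epsilon> (n + m)) x)" by (intro summable_suminf_not_top a0) auto
      from LIMSEQ_offset[OF summable_LIMSEQ_zero[OF this]] show ?case .
    qed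
  qed
  then have "AE x in lborel \<Otimes>\<^sub>M lborel. norm (snd x) \<le> 1 \<longrightarrow> (\<forall>i. (\<lambda>n. p i (fst x - \<epsilon> n *\<^sub>R snd x)) \<longlonglongrightarrow> p i (fst x))"
  proof eventually_elim
    case (elim x)
    show ?case
    proof (intro impI allI)
      fix i assume "norm (snd x) \<le> 1"
      moreover obtain r where "norm (fst x) < real r" using reals_Archimedean2 by blast
      ultimately have eq: "a i (real r) (\<epsilon> n) x = \<bar>p i (fst x - \<epsilon> n *\<^sub>R snd x) - p i (fst x)\<bar>" for n
        by (simp add: a_def)
      have "(\<lambda>n. a i (real r) (\<epsilon> n) x) \<longlonglongrightarrow> 0" using elim by blast
      then have "(\<lambda>n. \<bar>p i (fst x - \<epsilon> n *\<^sub>R snd x) - p i (fst x)\<bar>) \<longlonglongrightarrow> 0"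
        by (simp only: eq)
      then show "(\<lambda>n. p i (fst x - \<epsilon> n *\<^sub>R snd x)) \<longlonglongrightarrow> p i (fst x)"
        by (rule LIM_zero_cancel[OF tendsto_rabs_zero_cancel])
    qed
  qed
  with \<epsilon>(1) lim show ?thesis by (rule that)
qed

section \<open>A mollifier\<close>

lemma integrable_bounded_support:
  fixes f :: "'e::euclidean_space \<Rightarrow> 'b::{banach, second_countable_topology}"
  assumes [measurable]: "f \<in> borel_measurable borel" and B: "\<And>z. norm (f z) \<le> B"
    and supp: "\<And>z. norm z > r \<Longrightarrow> f z = 0"
  shows "integrable lborel f"
proof (rule Bochner_Integration.integrable_bound[where f="\<lambda>z. indicator (cball 0 r) z * B"])
  show "integrable lborel (\<lambda>z::'e. indicator (cball 0 r) z * B)"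
    by (intro integrable_mult_left integrable_indicator_bounded) auto
  show "AE z in lborel. norm (f z) \<le> norm (indicator (cball 0 r) z * B)"
  proof (rule AE_I2)
    fix z show "norm (f z) \<le> norm (indicator (cball 0 r) z * B)"
      using B[of z] supp[of z] by (auto simp: indicator_def not_le)
  qed
qed auto

lemma bounded_of_compact_support:
  fixes \<phi> :: "'e::euclidean_space \<Rightarrow> 'b::real_normed_vector"
  assumes "continuous_on UNIV \<phi>" "compact K" "\<And>z. z \<notin> K \<Longrightarrow> \<phi> z = 0"
  obtains B where "B \<ge> 0" "\<And>z. norm (\<phi> z) \<le> B"
proof -
  have "bounded (\<phi> ` K)"
    using assms(1,2) by (intro compact_imp_bounded compact_continuous_image) (auto intro: continuous_on_subset)
  then obtain B where "\<And>z. z \<in> K \<Longrightarrow> norm (\<phi> z) \<le> B" by (auto simp: bounded_iff)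
  then have "norm (\<phi> z) \<le> max 0 B" for z
    using assms(3)[of z] by (cases "z \<in> K") (auto simp: le_max_iff_disj)
  then show ?thesis using that[of "max 0 B"] by auto
qed

lemma lborel_integral_affine:
  fixes f :: "'e::euclidean_space \<Rightarrow> 'b::{banach, second_countable_topology}"
  assumes [measurable]: "f \<in> borel_measurable borel" and c: "c \<noteq> 0"
  shows "(\<integral>w. f w \<partial>lborel) = \<bar>c\<bar> ^ DIM('e) *\<^sub>R (\<integral>x. f (t + c *\<^sub>R x) \<partial>lborel)"
proof -
  have "(\<integral>w. f w \<partial>lborel) = (\<integral>w. f w \<partial>(density (distr lborel borel (\<lambda>x. t + c *\<^sub>R x)) (\<lambda>_. \<bar>c\<bar>^DIM('e))))"
    using lborel_affine[OF c, of t] by simp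
  also have "\<dots> = (\<integral>x. \<bar>c\<bar>^DIM('e) *\<^sub>R f (t + c *\<^sub>R x) \<partial>lborel)"
    by (subst integral_density) (auto simp: integral_distr)
  finally show ?thesis by simp
qed

text \<open>Difference quotients in direction \<open>b\<close> have integral zero by translation
  invariance, and they converge to the directional derivative under a common bound.\<close>

lemma integral_directional_derivative_eq_0:
  fixes \<phi> :: "'e::euclidean_space \<Rightarrow> real"
  assumes d: "\<And>z. (\<phi> has_derivative (\<lambda>h. \<phi>' z \<bullet> h)) (at z)" and c: "continuous_on UNIV \<phi>'"
    and K: "compact K" "\<And>z. z \<notin> K \<Longrightarrow> \<phi> z = 0 \<and> \<phi>' z = 0"
  shows "(\<integral>z. \<phi>' z \<bullet> b \<partial>lborel) = 0"
proof -
  obtain B where B: "B \<ge> 0" "\<And>z. norm (\<phi>' z) \<le> B"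
    using bounded_of_compact_support[OF c K(1)] K(2) by blast
  obtain r where r: "\<And>z. z \<in> K \<Longrightarrow> norm z \<le> r" using compact_imp_bounded[OF K(1)] by (auto simp: bounded_iff)
  have contp: "continuous_on UNIV \<phi>"
    using d has_derivative_continuous continuous_at_imp_continuous_on by blast
  have [measurable]: "\<phi> \<in> borel_measurable borel" "\<phi>' \<in> borel_measurable borel"
    using contp c by (auto intro: borel_measurable_continuous_onI)
  have int: "integrable lborel \<phi>"
  proof -
    obtain B' where "\<And>z. norm (\<phi> z) \<le> B'" using bounded_of_compact_support[OF contp K(1)] K(2) by blast
    then show ?thesis using K(2) r by (intro integrable_bounded_support[of \<phi> B' r]) force+
  qed
  have bound: "\<bar>\<phi> (z + h) - \<phi> z\<bar> \<le> B * norm h" for z h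
  proof -
    have "norm (\<phi> (z + h) - \<phi> z) \<le> B * norm ((z + h) - z)"
    proof (rule differentiable_bound[of UNIV \<phi> "\<lambda>z h. \<phi>' z \<bullet> h"])
      show "onorm (\<lambda>h. \<phi>' x \<bullet> h) \<le> B" for x
      proof (rule onorm_bound[OF B(1)])
        fix h show "norm (\<phi>' x \<bullet> h) \<le> B * norm h"
          using order_trans[OF Cauchy_Schwarz_ineq2 mult_right_mono[OF B(2)[of x] norm_ge_zero[of h]]] by simp
      qed
    qed (use d has_derivative_at_withinI in auto)
    then show ?thesis by simp
  qed
  define s where "s = (\<lambda>n. inverse (real (Suc n)))"
  have s: "s n > 0" "s n \<le> 1" "s \<longlonglongrightarrow> 0" for n
    using LIMSEQ_inverse_real_of_nat by (auto simp: s_def field_simps)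
  \<comment> \<open>The steps satisfy \<open>s n \<le> 1\<close>, so every difference quotient
    vanishes outside this radius.\<close>
  define R where "R = r + norm b"
  have lim: "(\<lambda>n. \<integral>z. (\<phi> (z + s n *\<^sub>R b) - \<phi> z) / s n \<partial>lborel) \<longlonglongrightarrow> (\<integral>z. \<phi>' z \<bullet> b \<partial>lborel)"
  proof (rule integral_dominated_convergence[where w="\<lambda>z. indicator (cball 0 R) z * (B * norm b)"])
    show "integrable lborel (\<lambda>z::'e. indicator (cball 0 R) z * (B * norm b))"
      by (intro integrable_mult_left integrable_indicator_bounded) auto
    show "AE z in lborel. (\<lambda>n. (\<phi> (z + s n *\<^sub>R b) - \<phi> z) / s n) \<longlonglongrightarrow> \<phi>' z \<bullet> b"
    proof (rule AE_I2)
      fix z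
      have "((\<lambda>t. z + t *\<^sub>R b) has_derivative (\<lambda>t. t *\<^sub>R b)) (at 0)"
        by (auto intro!: derivative_eq_intros)
      moreover have "(\<phi> has_derivative (\<lambda>h. \<phi>' z \<bullet> h)) (at (z + 0 *\<^sub>R b))" using d by simp
      ultimately have "((\<lambda>t. \<phi> (z + t *\<^sub>R b)) has_derivative (\<lambda>t. \<phi>' z \<bullet> (t *\<^sub>R b))) (at 0)"
        by (rule has_derivative_compose)
      then have "((\<lambda>t. \<phi> (z + t *\<^sub>R b)) has_field_derivative (\<phi>' z \<bullet> b)) (at 0)"
        by (rule has_derivative_imp_has_field_derivative) simp
      then have "(\<lambda>t. (\<phi> (z + t *\<^sub>R b) - \<phi> z) / t) \<midarrow>0\<rightarrow> \<phi>' z \<bullet> b"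
        by (simp add: has_field_derivative_iff)
      moreover have "filterlim s (at 0) sequentially"
        using s by (auto simp: filterlim_at intro!: always_eventually) (metis less_irrefl)
      ultimately show "(\<lambda>n. (\<phi> (z + s n *\<^sub>R b) - \<phi> z) / s n) \<longlonglongrightarrow> \<phi>' z \<bullet> b"
        by (rule filterlim_compose)
    qed
    show "AE z in lborel. norm ((\<phi> (z + s n *\<^sub>R b) - \<phi> z) / s n) \<le> indicator (cball 0 R) z * (B * norm b)" for n
    proof (rule AE_I2)
      fix z
      show "norm ((\<phi> (z + s n *\<^sub>R b) - \<phi> z) / s n) \<le> indicator (cball 0 R) z * (B * norm b)"
      proof (cases "norm z \<le> R")
        case True
        then show ?thesis using bound[of z "s n *\<^sub>R b"] s(1)[of n] by (simp add: field_simps)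
      next
        case False
        have "norm z \<le> norm (z + s n *\<^sub>R b) + norm (s n *\<^sub>R b)" by (metis add_diff_cancel norm_triangle_ineq4)
        moreover have "norm (s n *\<^sub>R b) \<le> norm b" using s(1,2)[of n] by (simp add: mult_left_le_one_le)
        ultimately have "norm (z + s n *\<^sub>R b) > r" "norm z > r" using False norm_ge_zero[of b] unfolding R_def by linarith+
        then have "\<phi> (z + s n *\<^sub>R b) = 0" "\<phi> z = 0" using K(2) r by force+
        then show ?thesis using False by simp
      qed
    qed
  qed auto
  have zero: "(\<integral>z. (\<phi> (z + s n *\<^sub>R b) - \<phi> z) / s n \<partial>lborel) = 0" for n
  proof -
    have eq: "(\<integral>z. \<phi> (z + s n *\<^sub>R b) \<partial>lborel) = (\<integral>z. \<phi> z \<partial>lborel)"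
      using lborel_integral_affine[of \<phi> 1 "s n *\<^sub>R b"] by (simp add: add.commute)
    have "integrable (distr lborel borel ((+) (s n *\<^sub>R b))) \<phi>" using int by (simp add: lborel_distr_plus)
    then have "integrable lborel (\<lambda>z. \<phi> (z + s n *\<^sub>R b))"
      by (subst (asm) integrable_distr_eq) (auto simp: add.commute)
    then show ?thesis using int eq by simp
  qed
  show ?thesis using lim unfolding zero by (simp add: LIMSEQ_const_iff)
qed

text \<open>The square of a positive part is a simple bump of class C1, which is all that the test
  functions need. It is not normalised: its integral becomes a positive factor in the limit and is
  divided out at the end.\<close>

definition bump :: "'e::euclidean_space \<Rightarrow> real" where
  "bump z = (max 0 (1 - z \<bullet> z))\<^sup>2"

definition bump_grad :: "'e::euclidean_space \<Rightarrow> 'e" where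
  "bump_grad z = (- 4 * max 0 (1 - z \<bullet> z)) *\<^sub>R z"

text \<open>From the second power on, the kink of \<open>max 0 s\<close> is smoothed to a C1
  function. \<open>bump\<close>, \<open>smooth_abs\<close>, \<open>ramp\<close> and
  \<open>cone_fn\<close> are all built from such powers, which keeps their derivatives
  explicit.\<close>

lemma has_real_derivative_pos_part_power:
  fixes s :: real
  shows "((\<lambda>s. (max 0 s) ^ Suc (Suc n)) has_real_derivative real (Suc (Suc n)) * (max 0 s) ^ Suc n) (at s)"
proof -
  consider "s < 0" | "s > 0" | "s = 0" by linarith
  then show ?thesis
  proof cases
    case 1
    have "((\<lambda>_. 0) has_real_derivative 0) (at s)" by simp
    then have "((\<lambda>s. (max 0 s) ^ Suc (Suc n)) has_real_derivative 0) (at s)"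
      by (rule has_field_derivative_transform_within_open[where S="{..<0}"]) (use 1 in auto)
    then show ?thesis using 1 by simp
  next
    case 2
    have "((\<lambda>s. s ^ Suc (Suc n)) has_real_derivative real (Suc (Suc n)) * s ^ Suc n) (at s)"
      by (rule derivative_eq_intros refl | simp)+
    then have "((\<lambda>s. (max 0 s) ^ Suc (Suc n)) has_real_derivative real (Suc (Suc n)) * s ^ Suc n) (at s)"
      by (rule has_field_derivative_transform_within_open[where S="{0<..}"]) (use 2 in auto)
    then show ?thesis using 2 by simp
  next
    case 3
    have "(\<lambda>h. (max 0 h) ^ Suc (Suc n) / h) = (\<lambda>h::real. (max 0 h) ^ Suc n)"
      by (auto simp: fun_eq_iff max_def)
    moreover have "((\<lambda>h::real. (max 0 h) ^ Suc n) \<longlongrightarrow> (max 0 0) ^ Suc n) (at 0)"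
      by (intro tendsto_intros)
    ultimately show ?thesis using 3 by (simp add: has_field_derivative_iff)
  qed
qed

lemma bump_has_derivative: "(bump has_derivative (\<lambda>h. bump_grad z \<bullet> h)) (at z)"
proof -
  have "((\<lambda>z::'a. 1 - z \<bullet> z) has_derivative (\<lambda>h. - 2 * (z \<bullet> h))) (at z)"
    by (auto intro!: derivative_eq_intros simp: inner_commute)
  moreover have "((\<lambda>s. (max 0 s)\<^sup>2) has_derivative (\<lambda>h. 2 * max 0 (1 - z \<bullet> z) * h)) (at (1 - z \<bullet> z))"
    using has_real_derivative_pos_part_power[of 0 "1 - z \<bullet> z"]
    by (simp add: has_field_derivative_def numeral_2_eq_2)
  ultimately have "((\<lambda>z. (max 0 (1 - z \<bullet> z))\<^sup>2) has_derivative (\<lambda>h. 2 * max 0 (1 - z \<bullet> z) * (- 2 * (z \<bullet> h)))) (at z)"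
    by (rule has_derivative_compose)
  then show ?thesis by (simp add: bump_def[abs_def] bump_grad_def mult_ac)
qed

lemma bump_facts:
  "continuous_on UNIV (bump :: 'e::euclidean_space \<Rightarrow> real)" "continuous_on UNIV (bump_grad :: 'e \<Rightarrow> 'e)"
  "0 \<le> bump (z::'e)" "bump z \<le> 1" "norm (bump_grad z) \<le> 4"
  "1 < norm z \<Longrightarrow> bump z = 0" "1 < norm z \<Longrightarrow> bump_grad z = 0"
proof -
  show "continuous_on UNIV (bump :: 'e \<Rightarrow> real)" "continuous_on UNIV (bump_grad :: 'e \<Rightarrow> 'e)"
    unfolding bump_def[abs_def] bump_grad_def[abs_def] by (intro continuous_intros)+
  show "0 \<le> bump z" by (simp add: bump_def)
  have m: "0 \<le> max 0 (1 - z \<bullet> z)" "max 0 (1 - z \<bullet> z) \<le> 1" by auto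
  then show "bump z \<le> 1" unfolding bump_def by (simp add: power_le_one)
  show b0: "bump z = 0" "bump_grad z = 0" if "1 < norm z" for z :: 'e
    using that by (auto simp: bump_def bump_grad_def norm_eq_sqrt_inner max_def)
  show "norm (bump_grad z) \<le> 4"
  proof (cases "1 < norm z")
    case False
    then have "max 0 (1 - z \<bullet> z) * norm z \<le> 1 * 1" using m by (intro mult_mono) auto
    then show ?thesis by (simp add: bump_grad_def abs_mult)
  qed (simp add: b0)
qed

lemma bump_measurable [measurable]:
  "(bump :: 'e::euclidean_space \<Rightarrow> real) \<in> borel_measurable borel" "(bump_grad :: 'e \<Rightarrow> 'e) \<in> borel_measurable borel"
  using bump_facts by (auto intro: borel_measurable_continuous_onI)

lemma bump_integrable: "integrable lborel (bump :: 'e::euclidean_space \<Rightarrow> real)"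
  by (rule integrable_bounded_support[where B=1 and r=1]) (auto simp: bump_facts)

lemma bump_integral_pos: "0 < (\<integral>z. bump (z::'e::euclidean_space) \<partial>lborel)"
proof (rule ccontr)
  assume "\<not> ?thesis"
  moreover have "0 \<le> (\<integral>z. bump (z::'e) \<partial>lborel)" by (simp add: bump_facts)
  ultimately have "(\<integral>z. bump (z::'e) \<partial>lborel) = 0" by simp
  moreover have "AE z in lborel. 0 \<le> bump (z::'e)" by (simp add: bump_facts)
  ultimately have "AE z in lborel. bump (z::'e) = 0"
    using integral_nonneg_eq_0_iff_AE[OF bump_integrable[where 'e='e]] by blast
  then have "AE z in lborel. (z::'e) \<notin> ball 0 1"
    by eventually_elim (auto simp: bump_def norm_eq_sqrt_inner)
  then have "emeasure lborel (ball (0::'e) 1) = 0"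
    by (subst (asm) AE_iff_measurable[of "ball 0 1"]) auto
  moreover have "\<not> negligible (ball (0::'e) 1)" by (simp add: open_not_negligible)
  ultimately show False
    using negligible_iff_emeasure0[of "ball (0::'e) 1"] by (simp add: emeasure_lborel_ball_finite)
qed

lemma bump_divergence_integral:
  fixes A :: "'e::euclidean_space \<Rightarrow> 'e"
  assumes A: "linear A"
  shows "(\<integral>z. A z \<bullet> bump_grad z + bump z * (\<Sum>b\<in>Basis. A b \<bullet> b) \<partial>lborel) = 0"
proof -
  have Ac: "continuous_on S A" for S using A linear_continuous_on linear_linear by blast
  have [measurable]: "A \<in> borel_measurable borel" using Ac by (rule borel_measurable_continuous_onI)
  \<comment> \<open>\<open>G b\<close> is the gradient of the \<open>b\<close>-component of the
    field \<open>bump z *\<^sub>R A z\<close>, so the sum of \<open>G b z \<bullet> b\<close> over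
    the basis is the divergence of that field.\<close>
  define G where "G = (\<lambda>b z. bump z *\<^sub>R adjoint A b + (A z \<bullet> b) *\<^sub>R bump_grad z)"
  have [measurable]: "G b \<in> borel_measurable borel" for b unfolding G_def by measurable
  have z: "(\<integral>z. G b z \<bullet> b \<partial>lborel) = 0" for b
  proof (rule integral_directional_derivative_eq_0[where \<phi>="\<lambda>z. (A z \<bullet> b) * bump z" and K="cball 0 1"])
    show "((\<lambda>z. (A z \<bullet> b) * bump z) has_derivative (\<lambda>h. G b z \<bullet> h)) (at z)" for z
    proof -
      have "(A has_derivative A) (at z)" using A linear_imp_has_derivative by blast
      then have "((\<lambda>z. (A z \<bullet> b) * bump z) has_derivative (\<lambda>h. (A z \<bullet> b) * (bump_grad z \<bullet> h) + (A h \<bullet> b) * bump z)) (at z)"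
        by (auto intro!: derivative_eq_intros bump_has_derivative)
      moreover have "A h \<bullet> b = adjoint A b \<bullet> h" for h
        using adjoint_works[OF A, of h b] by (simp add: inner_commute)
      ultimately show ?thesis by (simp add: G_def inner_add_left mult_ac add.commute)
    qed
    show "continuous_on UNIV (G b)"
      unfolding G_def by (intro continuous_intros bump_facts Ac)
  qed (auto simp: G_def bump_facts)
  have "A z \<bullet> bump_grad z + bump z * (\<Sum>b\<in>Basis. A b \<bullet> b) = (\<Sum>b\<in>Basis. G b z \<bullet> b)" for z
  proof -
    have "adjoint A b \<bullet> b = A b \<bullet> b" for b
      using adjoint_works[OF A, of b b] by (simp add: inner_commute)
    then show ?thesis
      by (simp add: G_def inner_add_left sum.distrib sum_distrib_left euclidean_inner[of "A z" "bump_grad z"])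
  qed
  moreover have "integrable lborel (\<lambda>z. G b z \<bullet> b)" for b
  proof -
    have "continuous_on UNIV (\<lambda>z. G b z \<bullet> b)"
      unfolding G_def by (intro continuous_intros bump_facts Ac)
    then obtain B where "\<And>z. norm (G b z \<bullet> b) \<le> B"
      by (rule bounded_of_compact_support[where K="cball 0 1"]) (auto simp: G_def bump_facts)
    then show ?thesis
      by (intro integrable_bounded_support[where r=1]) (auto simp: G_def bump_facts)
  qed
  ultimately show ?thesis using z by simp
qed

section \<open>Doubling of variables\<close>

text \<open>The gradient is carried as a second argument, so that inequalities can refer to it
  without choosing a derivative. The functions live on the whole space and vanish off a compact part
  of \<open>\<Omega>\<close>, which spares the integrals a restriction to
  \<open>\<Omega>\<close>.\<close>

definition test_fn :: "'e::euclidean_space set \<Rightarrow> ('e \<Rightarrow> real) \<Rightarrow> ('e \<Rightarrow> 'e) \<Rightarrow> bool" where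
  "test_fn \<Omega> \<phi> \<phi>' \<longleftrightarrow> (\<forall>z. (\<phi> has_derivative (\<lambda>h. \<phi>' z \<bullet> h)) (at z)) \<and> continuous_on UNIV \<phi>' \<and>
     (\<forall>z. 0 \<le> \<phi> z) \<and> (\<exists>K. compact K \<and> K \<subseteq> \<Omega> \<and> (\<forall>z. z \<notin> K \<longrightarrow> \<phi> z = 0 \<and> \<phi>' z = 0))"

lemma test_fn_continuous:
  assumes "test_fn \<Omega> \<phi> \<phi>'"
  shows "continuous_on UNIV \<phi>" "continuous_on UNIV \<phi>'"
proof -
  have d: "(\<phi> has_derivative (\<lambda>h. \<phi>' z \<bullet> h)) (at z)" for z using assms by (simp add: test_fn_def)
  show "continuous_on UNIV \<phi>"
    by (rule continuous_at_imp_continuous_on) (use has_derivative_continuous[OF d] in blast)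
  show "continuous_on UNIV \<phi>'" using assms by (simp add: test_fn_def)
qed

lemma test_fnE:
  assumes "test_fn \<Omega> \<phi> \<phi>'"
  obtains K r B where "compact K" "K \<subseteq> \<Omega>" "\<And>z. z \<notin> K \<Longrightarrow> \<phi> z = 0 \<and> \<phi>' z = 0" "\<And>z. z \<in> K \<Longrightarrow> norm z \<le> r"
    "B \<ge> 0" "\<And>z. \<phi> z \<le> B" "\<And>z. norm (\<phi>' z) \<le> B" "r \<ge> 0"
proof -
  note cp = test_fn_continuous(1)[OF assms] and cp' = test_fn_continuous(2)[OF assms]
  obtain K where K: "compact K" "K \<subseteq> \<Omega>" "\<And>z. z \<notin> K \<Longrightarrow> \<phi> z = 0 \<and> \<phi>' z = 0"
    using assms unfolding test_fn_def by blast
  obtain B1 where B1: "B1 \<ge> 0" "\<And>z. norm (\<phi> z) \<le> B1"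
    by (rule bounded_of_compact_support[OF cp K(1)]) (use K in auto)
  obtain B2 where B2: "B2 \<ge> 0" "\<And>z. norm (\<phi>' z) \<le> B2"
    by (rule bounded_of_compact_support[OF cp' K(1)]) (use K in auto)
  obtain r where r: "\<And>z. z \<in> K \<Longrightarrow> norm z \<le> r" using compact_imp_bounded[OF K(1)] by (auto simp: bounded_iff)
  show ?thesis
  proof (rule that[OF K, of "max 0 r" "max B1 B2"])
    show "norm z \<le> max 0 r" if "z \<in> K" for z using r[OF that] by simp
    show "\<phi> z \<le> max B1 B2" "norm (\<phi>' z) \<le> max B1 B2" for z using B1(2)[of z] B2(2)[of z] by auto
  qed (use B1 in auto)
qed

lemma test_fn_measurable:
  assumes "test_fn \<Omega> \<phi> \<phi>'"
  shows "\<phi> \<in> borel_measurable borel" "\<phi>' \<in> borel_measurable borel"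
  using test_fn_continuous[OF assms] by (auto intro: borel_measurable_continuous_onI)

text \<open>The zero-order term is what remains of the two divergences in the entropy inequality:
  \<open>g z (u z) - g z k\<close> minus \<open>g z (u z)\<close>, both with the factor
  \<open>sgn (u z - k)\<close>. Only \<open>k\<close> in \<open>{-M..M}\<close> is asked for, since
  \<open>k\<close> will be a value of the other solution.\<close>

definition kruzhkov :: "'e::euclidean_space set \<Rightarrow> ('e \<Rightarrow> real \<Rightarrow> 'e) \<Rightarrow> ('e \<Rightarrow> real \<Rightarrow> real) \<Rightarrow> real \<Rightarrow> ('e \<Rightarrow> real) \<Rightarrow> bool" where
  "kruzhkov \<Omega> F g M u \<longleftrightarrow> (\<forall>k\<in>{-M..M}. \<forall>\<phi> \<phi>'. test_fn \<Omega> \<phi> \<phi>' \<longrightarrow>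
     0 \<le> (\<integral>z. sgn (u z - k) * ((F z (u z) - F z k) \<bullet> \<phi>' z - g z k * \<phi> z) \<partial>lborel))"

text \<open>\<open>z\<close> will be a point of space-time and \<open>{-M..M}\<close> will contain
  the range of the solutions. \<open>diff\<close> combines (2a) and (2b): almost everywhere the
  derivative in \<open>z\<close> exists uniformly in \<open>k\<close>, depends continuously on
  \<open>k\<close>, and has trace \<open>g\<close>.\<close>

locale lipschitz_flux =
  fixes F :: "'e::euclidean_space \<Rightarrow> real \<Rightarrow> 'e" and g :: "'e \<Rightarrow> real \<Rightarrow> real" and M :: real
  assumes M0: "0 < M"
    and F_cont: "continuous_on UNIV (\<lambda>(z, k). F z k)"
    and F_lip: "\<And>r. \<exists>L. \<forall>k\<in>{-M..M}. L-lipschitz_on (cball 0 r) (\<lambda>z. F z k)"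
    and g_meas: "(\<lambda>(z, k). g z k) \<in> borel_measurable (borel \<Otimes>\<^sub>M borel)"
    and g_bound: "\<And>r. \<exists>C. \<forall>z k. norm z \<le> r \<longrightarrow> k \<in> {-M..M} \<longrightarrow> \<bar>g z k\<bar> \<le> C"
    and g_cont: "\<And>z. continuous_on {-M..M} (g z)"
    and diff: "AE z in lborel. \<exists>D :: real \<Rightarrow> 'e \<Rightarrow> 'e. (\<forall>k\<in>{-M..M}. linear (D k) \<and> g z k = (\<Sum>b\<in>Basis. D k b \<bullet> b)) \<and>
       (\<forall>h. continuous_on {-M..M} (\<lambda>k. D k h)) \<and>
       (\<forall>e>0. \<exists>d>0. \<forall>y. norm (y - z) < d \<longrightarrow>
          (\<forall>k\<in>{-M..M}. norm (F y k - F z k - D k (y - z)) \<le> e * norm (y - z)))"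
begin

lemma F_meas: "(\<lambda>(z, k). F z k) \<in> borel_measurable (borel \<Otimes>\<^sub>M borel)"
  unfolding borel_prod by (rule borel_measurable_continuous_onI[OF F_cont])

lemma Fg_measurable_compose [measurable (raw)]:
  assumes "f \<in> borel_measurable N" "k \<in> borel_measurable N"
  shows "(\<lambda>x. F (f x) (k x)) \<in> borel_measurable N" "(\<lambda>x. g (f x) (k x)) \<in> borel_measurable N"
  using measurable_compose[OF measurable_Pair[OF assms] F_meas] measurable_compose[OF measurable_Pair[OF assms] g_meas]
  by simp_all

lemma F_bound: "\<exists>C\<ge>0. \<forall>z k. norm z \<le> r \<longrightarrow> k \<in> {-M..M} \<longrightarrow> norm (F z k) \<le> C"
proof -
  have "compact ((\<lambda>(z, k). F z k) ` (cball 0 r \<times> {-M..M}))"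
    by (intro compact_continuous_image continuous_on_subset[OF F_cont] compact_Times) auto
  then obtain C where C: "\<forall>x\<in>(\<lambda>(z, k). F z k) ` (cball 0 r \<times> {-M..M}). norm x \<le> C"
    using compact_imp_bounded bounded_iff by blast
  have "norm (F z k) \<le> max 0 C" if "norm z \<le> r" "k \<in> {-M..M}" for z k
  proof -
    have "F z k \<in> (\<lambda>(z, k). F z k) ` (cball 0 r \<times> {-M..M})" using that by force
    from bspec[OF C this] show ?thesis by simp
  qed
  then show ?thesis by (intro exI[of _ "max 0 C"]) auto
qed

lemma F_cont_k: "continuous_on S (\<lambda>k. F z k)"
proof -
  have "continuous_on S (\<lambda>k. (\<lambda>(z, k). F z k) (z, k))"
    by (intro continuous_on_compose2[OF F_cont]) (auto intro!: continuous_intros)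
  then show ?thesis by simp
qed

end

section \<open>The doubled integrand\<close>

locale two_solutions = lipschitz_flux F g M
  for F :: "'e::euclidean_space \<Rightarrow> real \<Rightarrow> 'e" and g :: "'e \<Rightarrow> real \<Rightarrow> real" and M :: real +
  fixes u v :: "'e \<Rightarrow> real" and \<Omega> :: "'e set" and \<psi> :: "'e \<Rightarrow> real" and \<psi>' :: "'e \<Rightarrow> 'e"
  assumes \<Omega>: "open \<Omega>"
    and u_meas [measurable]: "u \<in> borel_measurable borel" and v_meas [measurable]: "v \<in> borel_measurable borel"
    and uM: "\<And>z. u z \<in> {-M..M}" and vM: "\<And>z. v z \<in> {-M..M}"
    and u_kruzhkov: "kruzhkov \<Omega> F g M u" and v_kruzhkov: "kruzhkov \<Omega> F g M v"
    and \<psi>: "test_fn \<Omega> \<psi> \<psi>'"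
begin

lemmas \<psi>_meas [measurable] = test_fn_measurable[OF \<psi>]

text \<open>Kruzhkov's inequality for \<open>u\<close> with \<open>k = v w\<close>;
  \<open>v_term\<close> is the one for \<open>v\<close> with \<open>k = u z\<close>. The cut-off
  \<psi> depends on \<open>z\<close> alone, so its gradient occurs in \<open>u_term\<close>
  only.\<close>

definition u_term :: "real \<Rightarrow> 'e \<times> 'e \<Rightarrow> real" where
  "u_term \<epsilon> = (\<lambda>(z, w). sgn (u z - v w) * ((F z (u z) - F z (v w)) \<bullet>
      (bump ((1/\<epsilon>) *\<^sub>R (z - w)) *\<^sub>R \<psi>' z + (\<psi> z / \<epsilon>) *\<^sub>R bump_grad ((1/\<epsilon>) *\<^sub>R (z - w)))
      - g z (v w) * (\<psi> z * bump ((1/\<epsilon>) *\<^sub>R (z - w)))))"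

definition v_term :: "real \<Rightarrow> 'e \<times> 'e \<Rightarrow> real" where
  "v_term \<epsilon> = (\<lambda>(z, w). sgn (v w - u z) * ((F w (v w) - F w (u z)) \<bullet>
      (- (\<psi> z / \<epsilon>) *\<^sub>R bump_grad ((1/\<epsilon>) *\<^sub>R (z - w)))
      - g w (u z) * (\<psi> z * bump ((1/\<epsilon>) *\<^sub>R (z - w)))))"

text \<open>The substitution \<open>w = z - \<epsilon> *\<^sub>R y\<close> blows up the diagonal.
  The flux terms are regrouped into differences of one and the same state at two positions, so that
  the factor \<open>1/\<epsilon>\<close> meets difference quotients in position.\<close>

definition doubled :: "real \<Rightarrow> 'e \<times> 'e \<Rightarrow> real" where
  "doubled \<epsilon> = (\<lambda>(z, y). let w = z - \<epsilon> *\<^sub>R y in sgn (u z - v w) * (bump y * ((F z (u z) - F z (v w)) \<bullet> \<psi>' z) +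
     \<psi> z * ((1/\<epsilon>) * (((F z (u z) - F w (u z)) - (F z (v w) - F w (v w))) \<bullet> bump_grad y)
       + bump y * (g w (u z) - g z (v w)))))"

lemma terms_eq_doubled: "\<epsilon> \<noteq> 0 \<Longrightarrow> u_term \<epsilon> (z, z - \<epsilon> *\<^sub>R y) + v_term \<epsilon> (z, z - \<epsilon> *\<^sub>R y) = doubled \<epsilon> (z, y)"
proof -
  assume "\<epsilon> \<noteq> 0"
  moreover have "sgn (v w - u z) = - sgn (u z - v w)" for w by (simp add: sgn_if)
  ultimately show ?thesis
    by (simp add: u_term_def v_term_def doubled_def Let_def inner_diff_left inner_add_right algebra_simps)
qed

lemma doubled_measurable [measurable]:
  "u_term \<epsilon> \<in> borel_measurable (borel \<Otimes>\<^sub>M borel)" "v_term \<epsilon> \<in> borel_measurable (borel \<Otimes>\<^sub>M borel)"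
  "doubled \<epsilon> \<in> borel_measurable (borel \<Otimes>\<^sub>M borel)"
  unfolding u_term_def v_term_def doubled_def Let_def case_prod_beta' by measurable

text \<open>Lipschitz continuity in position cancels the factor \<open>1/\<epsilon>\<close>, hence
  one bound serves all \<epsilon> up to \<open>1\<close>. It dominates both limits, the inner one in
  \<open>y\<close> and the outer one in \<open>z\<close>.\<close>

lemma doubled_bound: "\<exists>b r. b \<ge> 0 \<and> r \<ge> 0 \<and> (\<forall>\<epsilon> z y. 0 < \<epsilon> \<longrightarrow> \<epsilon> \<le> 1 \<longrightarrow> \<bar>doubled \<epsilon> (z, y)\<bar> \<le> b * indicator (cball 0 r) z * indicator (cball 0 1) y)"
proof -
  obtain K r b where K: "compact K" "K \<subseteq> \<Omega>" "\<And>z. z \<notin> K \<Longrightarrow> \<psi> z = 0 \<and> \<psi>' z = 0" "\<And>z. z \<in> K \<Longrightarrow> norm z \<le> r"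
    "b \<ge> 0" "\<And>z. \<psi> z \<le> b" "\<And>z. norm (\<psi>' z) \<le> b" "r \<ge> 0" using test_fnE[OF \<psi>] by metis
  have \<psi>0: "\<psi> z \<ge> 0" for z using \<psi> by (simp add: test_fn_def)
  obtain CF where CF: "CF \<ge> 0" "\<And>z k. norm z \<le> r + 1 \<Longrightarrow> k \<in> {-M..M} \<Longrightarrow> norm (F z k) \<le> CF"
    using F_bound[of "r+1"] by blast
  obtain Cg where Cg: "\<And>z k. norm z \<le> r + 1 \<Longrightarrow> k \<in> {-M..M} \<Longrightarrow> \<bar>g z k\<bar> \<le> Cg"
    using g_bound[of "r+1"] by blast
  obtain L where L: "\<And>k. k \<in> {-M..M} \<Longrightarrow> L-lipschitz_on (cball 0 (r+1)) (\<lambda>z. F z k)"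
    using F_lip[of "r+1"] by blast
  have L0: "L \<ge> 0" using L[of 0] M0 lipschitz_on_nonneg by force
  have Cg0: "Cg \<ge> 0" using Cg[of 0 0] K(8) M0 by force
  \<comment> \<open>\<open>b\<close> bounds \<psi> and its gradient, \<open>4\<close> bounds
    \<open>bump_grad\<close>, and each factor \<open>2\<close> counts the two terms of a
    difference.\<close>
  define b' where "b' = 2 * CF * b + b * (2 * L * 4 + 2 * Cg)"
  have b'0: "b' \<ge> 0" unfolding b'_def using CF(1) K(5) L0 Cg0 by (intro add_nonneg_nonneg mult_nonneg_nonneg) auto
  have "\<bar>doubled \<epsilon> (z, y)\<bar> \<le> b' * indicator (cball 0 r) z * indicator (cball 0 1) y" if \<epsilon>: "0 < \<epsilon>" "\<epsilon> \<le> 1" for \<epsilon> z y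
  proof (cases "z \<in> K \<and> norm y \<le> 1")
    case True
    define w where "w = z - \<epsilon> *\<^sub>R y"
    have ey: "norm (\<epsilon> *\<^sub>R y) \<le> 1" using \<epsilon> True by (simp add: mult_le_one)
    have z: "norm z \<le> r" "norm z \<le> r + 1" using K(4)[of z] True by auto
    have w: "norm w \<le> r + 1" unfolding w_def using norm_triangle_ineq4[of z "\<epsilon> *\<^sub>R y"] ey z by linarith
    have lip: "norm (F z k - F w k) \<le> L * \<epsilon>" if "k \<in> {-M..M}" for k
    proof -
      have "norm (F z k - F w k) \<le> L * norm (z - w)"
        using lipschitz_onD[OF L[OF that], of z w] z w by (simp add: dist_norm)
      also have "\<dots> \<le> L * (\<epsilon> * 1)" using L0 True \<epsilon> by (intro mult_left_mono) (auto simp: w_def)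
      finally show ?thesis by simp
    qed
    have 1: "\<bar>bump y * ((F z (u z) - F z (v w)) \<bullet> \<psi>' z)\<bar> \<le> 1 * (2 * CF * b)"
      unfolding abs_mult
    proof (intro mult_mono)
      have "\<bar>(F z (u z) - F z (v w)) \<bullet> \<psi>' z\<bar> \<le> norm (F z (u z) - F z (v w)) * norm (\<psi>' z)" by (rule Cauchy_Schwarz_ineq2)
      also have "\<dots> \<le> (CF + CF) * b"
        using CF(1) K(7) by (intro mult_mono norm_triangle_le_diff add_mono CF(2) z uM vM) auto
      finally show "\<bar>(F z (u z) - F z (v w)) \<bullet> \<psi>' z\<bar> \<le> 2 * CF * b" by simp
    qed (auto simp: bump_facts)
    have 2: "\<bar>(1/\<epsilon>) * (((F z (u z) - F w (u z)) - (F z (v w) - F w (v w))) \<bullet> bump_grad y)\<bar> \<le> 2 * L * 4"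
    proof -
      have "\<bar>((F z (u z) - F w (u z)) - (F z (v w) - F w (v w))) \<bullet> bump_grad y\<bar>
        \<le> norm ((F z (u z) - F w (u z)) - (F z (v w) - F w (v w))) * norm (bump_grad y)" by (rule Cauchy_Schwarz_ineq2)
      also have "\<dots> \<le> (L * \<epsilon> + L * \<epsilon>) * 4"
        using L0 \<epsilon> by (intro mult_mono norm_triangle_le_diff add_mono lip uM vM bump_facts) auto
      finally show ?thesis using \<epsilon> by (simp add: abs_mult field_simps)
    qed
    have 3: "\<bar>bump y * (g w (u z) - g z (v w))\<bar> \<le> 1 * (2 * Cg)"
      unfolding abs_mult using Cg[OF w uM[of z]] Cg[OF z(2) vM[of w]] by (intro mult_mono) (auto simp: bump_facts)
    have "\<bar>doubled \<epsilon> (z, y)\<bar> \<le> 1 * (2 * CF * b + b * (2 * L * 4 + 2 * Cg))"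
      unfolding doubled_def Let_def prod.case w_def[symmetric] abs_mult[of "sgn _"]
    proof (intro mult_mono order_trans[OF abs_triangle_ineq] add_mono)
      have "\<bar>(1/\<epsilon>) * (((F z (u z) - F w (u z)) - (F z (v w) - F w (v w))) \<bullet> bump_grad y) + bump y * (g w (u z) - g z (v w))\<bar> \<le> 2 * L * 4 + 2 * Cg"
        using 2 3 by linarith
      then show "\<bar>\<psi> z * ((1/\<epsilon>) * (((F z (u z) - F w (u z)) - (F z (v w) - F w (v w))) \<bullet> bump_grad y) + bump y * (g w (u z) - g z (v w)))\<bar> \<le> b * (2 * L * 4 + 2 * Cg)"
        unfolding abs_mult[of "\<psi> z"] using \<psi>0[of z] K(5,6) by (intro mult_mono) auto
    qed (use 1 in \<open>auto simp: sgn_if\<close>)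
    then show ?thesis using z True by (simp add: b'_def)
  next
    case False
    then have "doubled \<epsilon> (z, y) = 0"
      using K(3)[of z] bump_facts(6,7)[of y] by (auto simp: doubled_def Let_def not_le)
    then show ?thesis using b'0 by simp
  qed
  then show ?thesis using b'0 K(8) by blast
qed

end

lemma integrable_continuous_support:
  fixes f :: "'e::euclidean_space \<Rightarrow> real"
  assumes "continuous_on UNIV f" "\<And>z. norm z > r \<Longrightarrow> f z = 0"
  shows "integrable lborel f"
proof -
  obtain B where B: "\<And>z. norm (f z) \<le> B"
    by (rule bounded_of_compact_support[OF assms(1), of "cball 0 r"]) (use assms(2) in auto)
  show ?thesis
    by (rule integrable_bounded_support[OF borel_measurable_continuous_onI[OF assms(1)] B assms(2)])
qed

text \<open>
  On the set where the two solutions agree the sign may oscillate along the sequence, but there it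
  multiplies a quantity that vanishes in the limit.
\<close>

lemma tendsto_sgn_mult:
  fixes X :: "nat \<Rightarrow> real"
  assumes b: "b \<longlonglongrightarrow> \<beta>" and X: "X \<longlonglongrightarrow> x" and eq: "a = \<beta> \<Longrightarrow> x = 0"
  shows "(\<lambda>n. sgn (a - b n) * X n) \<longlonglongrightarrow> sgn (a - \<beta>) * x"
proof (cases "a = \<beta>")
  case True
  have "(\<lambda>n. sgn (a - b n) * X n) \<longlonglongrightarrow> 0"
  proof (rule tendsto_rabs_zero_cancel, rule tendsto_sandwich[OF _ _ tendsto_const])
    show "(\<lambda>n. \<bar>X n\<bar>) \<longlonglongrightarrow> 0" using X eq[OF True] tendsto_rabs_zero by blast
  qed (auto intro!: always_eventually simp: abs_mult sgn_if)
  then show ?thesis using True by simp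
next
  case False
  then have "(\<lambda>n. sgn (a - b n)) \<longlonglongrightarrow> sgn (a - \<beta>)" by (intro tendsto_sgn tendsto_diff tendsto_const b) simp
  then show ?thesis by (intro tendsto_mult X)
qed

lemma AE_translation_sequence_countable:
  fixes p :: "'i::countable \<Rightarrow> 'e::euclidean_space \<Rightarrow> real"
  assumes p: "\<And>i. p i \<in> borel_measurable borel"
    and bd: "\<And>i r. \<exists>C. \<forall>z. norm z \<le> r \<longrightarrow> \<bar>p i z\<bar> \<le> C"
  obtains \<epsilon> :: "nat \<Rightarrow> real" where "\<And>n. 0 < \<epsilon> n" "\<epsilon> \<longlonglongrightarrow> 0"
    "AE x in lborel \<Otimes>\<^sub>M lborel. norm (snd x) \<le> 1 \<longrightarrow> (\<forall>i. (\<lambda>n. p i (fst x - \<epsilon> n *\<^sub>R snd x)) \<longlonglongrightarrow> p i (fst x))"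
proof -
  obtain \<epsilon> :: "nat \<Rightarrow> real" where \<epsilon>: "\<And>n. 0 < \<epsilon> n" "\<epsilon> \<longlonglongrightarrow> 0"
    and ae: "AE x in lborel \<Otimes>\<^sub>M lborel. norm (snd x) \<le> 1 \<longrightarrow>
      (\<forall>i. (\<lambda>n. p (from_nat i) (fst x - \<epsilon> n *\<^sub>R snd x)) \<longlonglongrightarrow> p (from_nat i) (fst x))"
    using AE_translation_sequence[of "\<lambda>i. p (from_nat i)", OF p bd] by blast
  from ae have "AE x in lborel \<Otimes>\<^sub>M lborel. norm (snd x) \<le> 1 \<longrightarrow> (\<forall>i. (\<lambda>n. p i (fst x - \<epsilon> n *\<^sub>R snd x)) \<longlonglongrightarrow> p i (fst x))"
    by eventually_elim (metis from_nat_to_nat)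
  with \<epsilon> show ?thesis by (rule that)
qed

section \<open>Convergence of translates of the divergence\<close>

context lipschitz_flux
begin

text \<open>
  The divergence \<open>g\<close> is only measurable in \<open>z\<close>, so \<open>g(z - \<epsilon> y, u z)\<close> need not converge to \<open>g(z, u z)\<close> for
  translation reasons alone. It does so once the countably many functions \<open>g(\<cdot>, q)\<close> and the moduli of
  continuity \<open>osc m\<close> converge under translation.
\<close>

definition clip :: "rat \<Rightarrow> real" where "clip q = max (- M) (min M (of_rat q))"

lemma clip_mem: "clip q \<in> {-M..M}" using M0 by (auto simp: clip_def)

lemma clip_dense:
  assumes "k \<in> {-M..M}" obtains q where "(\<lambda>n. clip (q n)) \<longlonglongrightarrow> k"
proof -
  have "\<exists>q. \<bar>of_rat q - k\<bar> < 1 / real (Suc n)" for n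
    using of_rat_dense[of "k - 1 / real (Suc n)" "k + 1 / real (Suc n)"] by (auto simp: abs_less_iff algebra_simps)
  then obtain q where q: "\<And>n. \<bar>of_rat (q n) - k\<bar> < 1 / real (Suc n)" by metis
  have "(\<lambda>n. of_rat (q n) - k) \<longlonglongrightarrow> 0"
    by (rule Lim_null_comparison[OF _ LIMSEQ_inverse_real_of_nat])
       (use q in \<open>auto intro!: always_eventually less_imp_le simp: inverse_eq_divide\<close>)
  then have "(\<lambda>n. of_rat (q n)) \<longlonglongrightarrow> k" by (rule LIM_zero_cancel)
  then have "(\<lambda>n. clip (q n)) \<longlonglongrightarrow> max (- M) (min M k)" unfolding clip_def by (intro tendsto_intros)
  also have "max (- M) (min M k) = k" using assms by auto
  finally show ?thesis by (rule that)
qed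

text \<open>Pairs of clipped rationals keep the supremum countable, hence Borel in \<open>z\<close>;
  by continuity in \<open>k\<close> it still controls the oscillation when one of the two arguments
  is an arbitrary real in \<open>{-M..M}\<close>.\<close>

definition osc :: "nat \<Rightarrow> 'e \<Rightarrow> real" where
  "osc m z = (SUP (q, q') \<in> {(q, q'). \<bar>clip q - clip q'\<bar> \<le> 1 / real (Suc m)}. \<bar>g z (clip q) - g z (clip q')\<bar>)"

lemma osc_bdd: "bdd_above ((\<lambda>(q, q'). \<bar>g z (clip q) - g z (clip q')\<bar>) ` S)"
proof -
  obtain C where C: "\<And>k. k \<in> {-M..M} \<Longrightarrow> \<bar>g z k\<bar> \<le> C" using g_bound[of "norm z"] by blast
  have "\<bar>g z (clip q) - g z (clip q')\<bar> \<le> 2 * C" for q q'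
    using C[OF clip_mem[of q]] C[OF clip_mem[of q']] by linarith
  then show ?thesis by (intro bdd_aboveI[of _ "2 * C"]) auto
qed

lemma osc_mem: "(0, 0) \<in> {(q, q'). \<bar>clip q - clip q'\<bar> \<le> 1 / real (Suc m)}" by simp

lemma osc_nonneg: "0 \<le> osc m z"
  unfolding osc_def by (rule cSUP_upper2[OF osc_bdd osc_mem]) simp

lemma osc_measurable: "osc m \<in> borel_measurable borel"
proof -
  have "(\<lambda>z. SUP x \<in> {(q, q'). \<bar>clip q - clip q'\<bar> \<le> 1 / real (Suc m)}. (\<lambda>(q, q'). \<bar>g z (clip q) - g z (clip q')\<bar>) x) \<in> borel_measurable borel"
  proof (rule borel_measurable_cSUP)
    show "(\<lambda>z. case x of (q, q') \<Rightarrow> \<bar>g z (clip q) - g z (clip q')\<bar>) \<in> borel_measurable borel" for x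
      by (cases x) simp
  qed (auto intro: osc_bdd)
  then show ?thesis unfolding osc_def[abs_def] by simp
qed

lemma osc_bounded: "\<exists>C. \<forall>z. norm z \<le> r \<longrightarrow> \<bar>osc m z\<bar> \<le> C"
proof -
  obtain C where C: "\<And>z k. norm z \<le> r \<Longrightarrow> k \<in> {-M..M} \<Longrightarrow> \<bar>g z k\<bar> \<le> C" using g_bound[of r] by blast
  have "osc m z \<le> 2 * C" if "norm z \<le> r" for z
    unfolding osc_def
  proof (rule cSUP_least)
    fix x show "(case x of (q, q') \<Rightarrow> \<bar>g z (clip q) - g z (clip q')\<bar>) \<le> 2 * C"
      using C[OF that clip_mem[of "fst x"]] C[OF that clip_mem[of "snd x"]] by (cases x) simp
  qed (use osc_mem in blast)
  then show ?thesis using osc_nonneg by (intro exI[of _ "2 * C"]) simp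
qed

lemma osc_estimate:
  assumes k: "k \<in> {-M..M}" and q: "\<bar>k - clip q\<bar> < 1 / real (Suc m)"
  shows "\<bar>g z k - g z (clip q)\<bar> \<le> osc m z"
proof -
  obtain s where s: "(\<lambda>n. clip (s n)) \<longlonglongrightarrow> k" using clip_dense[OF k] by blast
  have "(\<lambda>n. g z (clip (s n))) \<longlonglongrightarrow> g z k"
    by (rule continuous_on_tendsto_compose[OF g_cont s k]) (auto simp: clip_mem[simplified])
  then have lim: "(\<lambda>n. \<bar>g z (clip (s n)) - g z (clip q)\<bar>) \<longlonglongrightarrow> \<bar>g z k - g z (clip q)\<bar>"
    by (intro tendsto_intros)
  have "(\<lambda>n. \<bar>clip (s n) - clip q\<bar>) \<longlonglongrightarrow> \<bar>k - clip q\<bar>" by (intro tendsto_intros s)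
  then have "eventually (\<lambda>n. \<bar>clip (s n) - clip q\<bar> < 1 / real (Suc m)) sequentially"
    by (rule order_tendstoD(2)[OF _ q])
  then have "eventually (\<lambda>n. \<bar>g z (clip (s n)) - g z (clip q)\<bar> \<le> osc m z) sequentially"
  proof eventually_elim
    case (elim n)
    then have mem: "(s n, q) \<in> {(q, q'). \<bar>clip q - clip q'\<bar> \<le> 1 / real (Suc m)}" by simp
    show ?case unfolding osc_def using cSUP_upper[OF mem osc_bdd[of z]] by simp
  qed
  with lim show ?thesis by (intro tendsto_upperbound) auto
qed

lemma osc_small:
  assumes e: "e > 0" shows "\<exists>m. osc m z < e"
proof -
  have "uniformly_continuous_on {-M..M} (g z)" by (rule compact_uniformly_continuous[OF g_cont]) simp
  then obtain d where d: "d > 0" "\<And>k k'. k \<in> {-M..M} \<Longrightarrow> k' \<in> {-M..M} \<Longrightarrow> dist k' k < d \<Longrightarrow> dist (g z k') (g z k) < e / 2"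
    unfolding uniformly_continuous_on_def using e by (meson half_gt_zero)
  obtain m where m: "1 / real (Suc m) < d" using d(1) nat_approx_posE by blast
  have "osc m z \<le> e / 2"
    unfolding osc_def
  proof (rule cSUP_least)
    fix x assume "x \<in> {(q, q'). \<bar>clip q - clip q'\<bar> \<le> 1 / real (Suc m)}"
    then show "(case x of (q, q') \<Rightarrow> \<bar>g z (clip q) - g z (clip q')\<bar>) \<le> e / 2"
      using d(2)[OF clip_mem clip_mem, of "fst x" "snd x"] m by (cases x) (auto simp: dist_real_def)
  qed (use osc_mem in blast)
  then show ?thesis using e by (intro exI[of _ m]) linarith
qed

lemma g_tendsto:
  assumes k: "k \<in> {-M..M}" and q: "\<And>q. (\<lambda>n. g (w n) (clip q)) \<longlonglongrightarrow> g z (clip q)" and o: "\<And>m. (\<lambda>n. osc m (w n)) \<longlonglongrightarrow> osc m z"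
  shows "(\<lambda>n. g (w n) k) \<longlonglongrightarrow> g z k"
proof (rule tendstoI)
  fix e :: real assume e: "e > 0"
  obtain m where m: "osc m z < e / 3" using osc_small[of "e/3"] e by auto
  obtain s where s: "(\<lambda>n. clip (s n)) \<longlonglongrightarrow> k" using clip_dense[OF k] by blast
  have "eventually (\<lambda>n. dist (clip (s n)) k < 1 / real (Suc m)) sequentially" by (rule tendstoD[OF s]) simp
  then obtain n0 where "dist (clip (s n0)) k < 1 / real (Suc m)" by (auto simp: eventually_sequentially)
  then obtain q0 where q0: "\<bar>k - clip q0\<bar> < 1 / real (Suc m)" by (auto simp: dist_real_def abs_minus_commute)
  \<comment> \<open>The modulus at \<open>w n\<close> inherits its smallness from the one at
    \<open>z\<close>, so that replacing \<open>k\<close> by \<open>clip q0\<close> is a small error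
    at \<open>w n\<close> too.\<close>
  have "eventually (\<lambda>n. osc m (w n) < e / 3) sequentially" by (rule order_tendstoD(2)[OF o m])
  moreover have "eventually (\<lambda>n. dist (g (w n) (clip q0)) (g z (clip q0)) < e / 3) sequentially"
    using e by (intro tendstoD[OF q]) simp
  ultimately show "eventually (\<lambda>n. dist (g (w n) k) (g z k) < e) sequentially"
  proof eventually_elim
    case (elim n)
    then show ?case using osc_estimate[OF k q0, of "w n"] osc_estimate[OF k q0, of z] m unfolding dist_real_def by linarith
  qed
qed

end

section \<open>The doubled inequality and its limit\<close>

context two_solutions
begin

lemma scaled_bump_derivative:
  "((\<lambda>z. bump (c *\<^sub>R (z - w))) has_derivative (\<lambda>h. (c *\<^sub>R bump_grad (c *\<^sub>R (z - w))) \<bullet> h)) (at z)"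
  "((\<lambda>w. bump (c *\<^sub>R (z - w))) has_derivative (\<lambda>h. (- c *\<^sub>R bump_grad (c *\<^sub>R (z - w))) \<bullet> h)) (at w)"
proof -
  have "((\<lambda>z. c *\<^sub>R (z - w)) has_derivative (\<lambda>h. c *\<^sub>R h)) (at z)" by (auto intro!: derivative_eq_intros)
  from has_derivative_compose[OF this bump_has_derivative]
  show "((\<lambda>z. bump (c *\<^sub>R (z - w))) has_derivative (\<lambda>h. (c *\<^sub>R bump_grad (c *\<^sub>R (z - w))) \<bullet> h)) (at z)" by simp
  have "((\<lambda>w. c *\<^sub>R (z - w)) has_derivative (\<lambda>h. - c *\<^sub>R h)) (at w)" by (auto intro!: derivative_eq_intros)
  from has_derivative_compose[OF this bump_has_derivative]
  show "((\<lambda>w. bump (c *\<^sub>R (z - w))) has_derivative (\<lambda>h. (- c *\<^sub>R bump_grad (c *\<^sub>R (z - w))) \<bullet> h)) (at w)" by simp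
qed

lemma scaled_bump_continuous:
  "continuous_on UNIV (\<lambda>z. bump (c *\<^sub>R (z - w)))" "continuous_on UNIV (\<lambda>z. bump_grad (c *\<^sub>R (z - w)))"
  "continuous_on UNIV (\<lambda>w. bump_grad (c *\<^sub>R (z - w)))" for z w :: 'e
  by (auto intro!: continuous_on_compose2[OF bump_facts(1)] continuous_on_compose2[OF bump_facts(2)] continuous_intros)

text \<open>Each of the two inequalities is integrated over the variable that supplied its constant,
  and Fubini lets the results be added.\<close>

lemma doubled_inequality: "\<exists>\<delta>>0. \<forall>\<epsilon>. 0 < \<epsilon> \<longrightarrow> \<epsilon> < \<delta> \<longrightarrow> 0 \<le> (\<integral>z. (\<integral>y. doubled \<epsilon> (z, y) \<partial>lborel) \<partial>lborel)"
proof -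
  obtain K r b where K: "compact K" "K \<subseteq> \<Omega>" "\<And>z. z \<notin> K \<Longrightarrow> \<psi> z = 0 \<and> \<psi>' z = 0" "\<And>z. z \<in> K \<Longrightarrow> norm z \<le> r"
    "b \<ge> 0" "\<And>z. \<psi> z \<le> b" "\<And>z. norm (\<psi>' z) \<le> b" "r \<ge> 0" using test_fnE[OF \<psi>] by metis
  have \<psi>0: "\<psi> z \<ge> 0" and \<psi>d: "(\<psi> has_derivative (\<lambda>h. \<psi>' z \<bullet> h)) (at z)" for z using \<psi> by (auto simp: test_fn_def)
  note \<psi>c = test_fn_continuous[OF \<psi>]
  \<comment> \<open>In the inequality for \<open>v\<close> the test function of \<open>w\<close>
    lives within \<epsilon> of a point of \<open>K\<close>; for \<epsilon> below this \<delta> it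
    stays inside \<Omega>.\<close>
  obtain \<delta> where \<delta>: "\<delta> > 0" "(\<Union>z\<in>K. cball z \<delta>) \<subseteq> \<Omega>"
    using compact_subset_open_imp_cball_epsilon_subset[OF K(1) \<Omega> K(2)] by blast
  have "0 \<le> (\<integral>z. (\<integral>y. doubled \<epsilon> (z, y) \<partial>lborel) \<partial>lborel)" if \<epsilon>: "0 < \<epsilon>" "\<epsilon> < \<delta>" for \<epsilon>
  proof -
    let ?c = "1 / \<epsilon>"
    have far: "bump (?c *\<^sub>R (z - w)) = 0 \<and> bump_grad (?c *\<^sub>R (z - w)) = 0" if "norm (z - w) > \<epsilon>" for z w :: 'e
    proof -
      have "1 < norm (?c *\<^sub>R (z - w))" using that \<epsilon> unfolding norm_scaleR by (simp add: field_simps)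
      then show ?thesis by (intro conjI bump_facts)
    qed
    have test1: "test_fn \<Omega> (\<lambda>z. \<psi> z * bump (?c *\<^sub>R (z - w)))
        (\<lambda>z. bump (?c *\<^sub>R (z - w)) *\<^sub>R \<psi>' z + (\<psi> z / \<epsilon>) *\<^sub>R bump_grad (?c *\<^sub>R (z - w)))" for w
      unfolding test_fn_def
    proof (intro conjI allI exI[of _ K])
      show "((\<lambda>z. \<psi> z * bump (?c *\<^sub>R (z - w))) has_derivative
         (\<lambda>h. (bump (?c *\<^sub>R (z - w)) *\<^sub>R \<psi>' z + (\<psi> z / \<epsilon>) *\<^sub>R bump_grad (?c *\<^sub>R (z - w))) \<bullet> h)) (at z)" for z
        by (rule has_derivative_eq_rhs[OF has_derivative_mult[OF \<psi>d scaled_bump_derivative(1)]])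
           (auto simp: inner_add_left algebra_simps)
      show "continuous_on UNIV (\<lambda>z. bump (?c *\<^sub>R (z - w)) *\<^sub>R \<psi>' z + (\<psi> z / \<epsilon>) *\<^sub>R bump_grad (?c *\<^sub>R (z - w)))"
        using \<epsilon> by (intro continuous_intros scaled_bump_continuous \<psi>c) auto
    qed (use K \<psi>0 in \<open>auto simp: bump_facts\<close>)
    \<comment> \<open>For \<open>z\<close> outside \<open>K\<close> the factor
      \<open>\<psi> z\<close> makes the function of \<open>w\<close> vanish identically, and the
      empty set serves as its support.\<close>
    have test2: "test_fn \<Omega> (\<lambda>w. \<psi> z * bump (?c *\<^sub>R (z - w))) (\<lambda>w. - (\<psi> z / \<epsilon>) *\<^sub>R bump_grad (?c *\<^sub>R (z - w)))" for z
      unfolding test_fn_def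
    proof (intro conjI allI exI[of _ "if z \<in> K then cball z \<epsilon> else {}"] impI)
      show "((\<lambda>w. \<psi> z * bump (?c *\<^sub>R (z - w))) has_derivative (\<lambda>h. (- (\<psi> z / \<epsilon>) *\<^sub>R bump_grad (?c *\<^sub>R (z - w))) \<bullet> h)) (at w)" for w
        by (rule has_derivative_eq_rhs[OF has_derivative_mult_right[OF scaled_bump_derivative(2)]])
           (auto simp: algebra_simps)
      show "continuous_on UNIV (\<lambda>w. - (\<psi> z / \<epsilon>) *\<^sub>R bump_grad (?c *\<^sub>R (z - w)))"
        using \<epsilon> by (intro continuous_intros scaled_bump_continuous) auto
      have "cball z \<epsilon> \<subseteq> \<Omega>" if "z \<in> K"
        using \<delta>(2) that subset_cball[of \<epsilon> \<delta> z] \<epsilon> by (meson UN_subset_iff less_imp_le subset_trans)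
      then show "(if z \<in> K then cball z \<epsilon> else {}) \<subseteq> \<Omega>" by simp
      show "\<psi> z * bump (?c *\<^sub>R (z - w)) = 0" "- (\<psi> z / \<epsilon>) *\<^sub>R bump_grad (?c *\<^sub>R (z - w)) = 0"
        if w: "w \<notin> (if z \<in> K then cball z \<epsilon> else {})" for w
      proof -
        have "\<psi> z = 0 \<or> bump (?c *\<^sub>R (z - w)) = 0 \<and> bump_grad (?c *\<^sub>R (z - w)) = 0"
        proof (cases "z \<in> K")
          case True
          then have "norm (z - w) > \<epsilon>" using w by (simp add: dist_norm not_le)
          then show ?thesis using far by blast
        qed (use K(3) in simp)
        then show "\<psi> z * bump (?c *\<^sub>R (z - w)) = 0" "- (\<psi> z / \<epsilon>) *\<^sub>R bump_grad (?c *\<^sub>R (z - w)) = 0"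
          by auto
      qed
      show "compact (if z \<in> K then cball z \<epsilon> else {})" by simp
      show "0 \<le> \<psi> z * bump (?c *\<^sub>R (z - w))" for w using \<psi>0 by (simp add: bump_facts)
    qed
    obtain CF where CF: "CF \<ge> 0" "\<And>z k. norm z \<le> r + \<epsilon> \<Longrightarrow> k \<in> {-M..M} \<Longrightarrow> norm (F z k) \<le> CF"
      using F_bound[of "r+\<epsilon>"] by blast
    obtain Cg where Cg: "\<And>z k. norm z \<le> r + \<epsilon> \<Longrightarrow> k \<in> {-M..M} \<Longrightarrow> \<bar>g z k\<bar> \<le> Cg"
      using g_bound[of "r+\<epsilon>"] by blast
    have Cg0: "Cg \<ge> 0" using Cg[of 0 0] K(8) \<epsilon> M0 by force
    define b' where "b' = 2 * CF * (b + b / \<epsilon> * 4) + Cg * (b * 1)"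
    have b'0: "b' \<ge> 0" unfolding b'_def using CF(1) K(5) Cg0 \<epsilon> by (intro add_nonneg_nonneg mult_nonneg_nonneg) auto
    have gen: "\<bar>s * ((F x k - F x l) \<bullet> p - g x l * q)\<bar> \<le> b'"
      if "norm x \<le> r + \<epsilon>" "k \<in> {-M..M}" "l \<in> {-M..M}" "norm p \<le> b + b / \<epsilon> * 4" "\<bar>q\<bar> \<le> b * 1" "\<bar>s\<bar> \<le> 1" for x k l p q s
    proof -
      have "\<bar>(F x k - F x l) \<bullet> p\<bar> \<le> norm (F x k - F x l) * norm p" by (rule Cauchy_Schwarz_ineq2)
      also have "\<dots> \<le> (CF + CF) * (b + b / \<epsilon> * 4)"
        using CF(1) by (intro mult_mono norm_triangle_le_diff add_mono CF(2) that) auto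
      finally have 1: "\<bar>(F x k - F x l) \<bullet> p\<bar> \<le> 2 * CF * (b + b / \<epsilon> * 4)" by simp
      have 2: "\<bar>g x l * q\<bar> \<le> Cg * (b * 1)" unfolding abs_mult using that Cg Cg0 by (intro mult_mono) auto
      have "\<bar>s\<bar> * \<bar>(F x k - F x l) \<bullet> p - g x l * q\<bar> \<le> 1 * b'"
        using 1 2 that(6) by (intro mult_mono) (auto simp: b'_def)
      then show ?thesis by (simp add: abs_mult)
    qed
    have near: "norm z \<le> r + \<epsilon> \<and> norm w \<le> r + \<epsilon> \<and> norm (z, w) \<le> 2 * (r + \<epsilon>)" if "z \<in> K" "norm (z - w) \<le> \<epsilon>" for z w
    proof -
      have "norm w \<le> norm z + norm (z - w)" by (metis add.commute norm_triangle_sub norm_minus_commute)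
      then show ?thesis using K(4)[OF that(1)] that(2) \<epsilon> norm_Pair_le[of z w] by auto
    qed
    have p1: "norm (bump y *\<^sub>R \<psi>' z + (\<psi> z / \<epsilon>) *\<^sub>R bump_grad y) \<le> b + b / \<epsilon> * 4"
      and p2: "norm (- (\<psi> z / \<epsilon>) *\<^sub>R bump_grad y) \<le> b + b / \<epsilon> * 4" and p3: "\<bar>\<psi> z * bump y\<bar> \<le> b * 1" for z y
    proof -
      have 1: "norm ((\<psi> z / \<epsilon>) *\<^sub>R bump_grad y) \<le> b / \<epsilon> * 4"
        using \<psi>0[of z] K(5,6) \<epsilon> bump_facts(5)[of y] unfolding norm_scaleR by (intro mult_mono) (auto simp: divide_right_mono)
      have "norm (bump y *\<^sub>R \<psi>' z) \<le> 1 * b"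
        unfolding norm_scaleR using K(5,7) by (intro mult_mono) (auto simp: bump_facts)
      then show "norm (bump y *\<^sub>R \<psi>' z + (\<psi> z / \<epsilon>) *\<^sub>R bump_grad y) \<le> b + b / \<epsilon> * 4"
        using 1 by (intro norm_triangle_mono) auto
      show "norm (- (\<psi> z / \<epsilon>) *\<^sub>R bump_grad y) \<le> b + b / \<epsilon> * 4" using 1 K(5) by simp
      show "\<bar>\<psi> z * bump y\<bar> \<le> b * 1"
        unfolding abs_mult using \<psi>0[of z] K(5,6) by (intro mult_mono) (auto simp: bump_facts)
    qed
    have ABle: "\<bar>u_term \<epsilon> (z, w)\<bar> \<le> b' \<and> \<bar>v_term \<epsilon> (z, w)\<bar> \<le> b'" and AB0: "2 * (r + \<epsilon>) < norm (z, w) \<Longrightarrow> u_term \<epsilon> (z, w) = 0 \<and> v_term \<epsilon> (z, w) = 0" for z w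
    proof -
      have zero: "u_term \<epsilon> (z, w) = 0 \<and> v_term \<epsilon> (z, w) = 0" if "\<not> (z \<in> K \<and> norm (z - w) \<le> \<epsilon>)"
        using that K(3)[of z] far[of z w] by (auto simp: u_term_def v_term_def not_le)
      show "\<bar>u_term \<epsilon> (z, w)\<bar> \<le> b' \<and> \<bar>v_term \<epsilon> (z, w)\<bar> \<le> b'"
      proof (cases "z \<in> K \<and> norm (z - w) \<le> \<epsilon>")
        case True
        then show ?thesis unfolding u_term_def v_term_def prod.case using near[of z w] uM vM
          by (intro conjI gen p1 p2 p3) (auto simp: sgn_if)
      qed (use zero b'0 in auto)
      show "u_term \<epsilon> (z, w) = 0 \<and> v_term \<epsilon> (z, w) = 0" if "2 * (r + \<epsilon>) < norm (z, w)"
        using zero near[of z w] that by force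
    qed
    have int: "integrable (lborel \<Otimes>\<^sub>M lborel) (u_term \<epsilon>)" "integrable (lborel \<Otimes>\<^sub>M lborel) (v_term \<epsilon>)"
      unfolding lborel_prod
      by (rule integrable_bounded_support[where B=b' and r="2 * (r + \<epsilon>)"];
          use ABle AB0 doubled_measurable[unfolded borel_prod] in \<open>auto simp: split_paired_all\<close>)+
    have "0 \<le> integral\<^sup>L (lborel \<Otimes>\<^sub>M lborel) (u_term \<epsilon>)"
    proof -
      have "0 \<le> (\<integral>w. (\<integral>z. u_term \<epsilon> (z, w) \<partial>lborel) \<partial>lborel)"
      proof (rule Bochner_Integration.integral_nonneg)
        fix w show "0 \<le> (\<integral>z. u_term \<epsilon> (z, w) \<partial>lborel)"
          using u_kruzhkov[unfolded kruzhkov_def, rule_format, OF vM[of w] test1[of w]] by (simp add: u_term_def)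
      qed
      also have "\<dots> = integral\<^sup>L (lborel \<Otimes>\<^sub>M lborel) (u_term \<epsilon>)"
        using lborel_pair.integral_snd[of "\<lambda>z w. u_term \<epsilon> (z, w)"] int by simp
      finally show ?thesis .
    qed
    moreover have "0 \<le> integral\<^sup>L (lborel \<Otimes>\<^sub>M lborel) (v_term \<epsilon>)"
    proof -
      have "0 \<le> (\<integral>z. (\<integral>w. v_term \<epsilon> (z, w) \<partial>lborel) \<partial>lborel)"
      proof (rule Bochner_Integration.integral_nonneg)
        fix z show "0 \<le> (\<integral>w. v_term \<epsilon> (z, w) \<partial>lborel)"
          using v_kruzhkov[unfolded kruzhkov_def, rule_format, OF uM[of z] test2[of z]] by (simp add: v_term_def)
      qed
      also have "\<dots> = integral\<^sup>L (lborel \<Otimes>\<^sub>M lborel) (v_term \<epsilon>)"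
        using lborel_pair.integral_fst'[of "v_term \<epsilon>"] int by simp
      finally show ?thesis .
    qed
    ultimately have "0 \<le> integral\<^sup>L (lborel \<Otimes>\<^sub>M lborel) (\<lambda>x. u_term \<epsilon> x + v_term \<epsilon> x)" using int by simp
    also have "\<dots> = (\<integral>z. (\<integral>w. u_term \<epsilon> (z, w) + v_term \<epsilon> (z, w) \<partial>lborel) \<partial>lborel)"
      using lborel_pair.integral_fst'[of "\<lambda>x. u_term \<epsilon> x + v_term \<epsilon> x"] int by simp
    \<comment> \<open>The substitution of \<open>z - \<epsilon> *\<^sub>R y\<close> for
      \<open>w\<close> produces the Jacobian \<open>\<epsilon> ^ DIM('e)\<close>, a positive
      constant that does not affect the sign.\<close>
    also have "\<dots> = (\<integral>z. \<epsilon> ^ DIM('e) * (\<integral>y. doubled \<epsilon> (z, y) \<partial>lborel) \<partial>lborel)"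
    proof (rule Bochner_Integration.integral_cong[OF refl])
      fix z
      have "(\<lambda>w. u_term \<epsilon> (z, w) + v_term \<epsilon> (z, w)) \<in> borel_measurable borel" by measurable
      from lborel_integral_affine[OF this, of "- \<epsilon>" z] \<epsilon>
      show "(\<integral>w. u_term \<epsilon> (z, w) + v_term \<epsilon> (z, w) \<partial>lborel) = \<epsilon> ^ DIM('e) * (\<integral>y. doubled \<epsilon> (z, y) \<partial>lborel)"
        using terms_eq_doubled[of \<epsilon> z] by simp
    qed
    also have "\<dots> = \<epsilon> ^ DIM('e) * (\<integral>z. (\<integral>y. doubled \<epsilon> (z, y) \<partial>lborel) \<partial>lborel)" by simp
    finally show ?thesis using zero_less_power[OF \<epsilon>(1), of "DIM('e)"] by (simp add: zero_le_mult_iff)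
  qed
  then show ?thesis using \<delta>(1) by blast
qed

end

context two_solutions
begin

lemma doubled_tendsto:
  assumes D: "\<And>k. k \<in> {-M..M} \<Longrightarrow> linear (D k)" "\<And>h. continuous_on {-M..M} (\<lambda>k. D k h)"
      "\<And>e. e > 0 \<Longrightarrow> \<exists>d>0. \<forall>y. norm (y - z) < d \<longrightarrow> (\<forall>k\<in>{-M..M}. norm (F y k - F z k - D k (y - z)) \<le> e * norm (y - z))"
    and \<epsilon>: "\<And>n. 0 < \<epsilon> n" "\<epsilon> \<longlonglongrightarrow> 0" and y: "norm y \<le> 1"
    and v: "(\<lambda>n. v (z - \<epsilon> n *\<^sub>R y)) \<longlonglongrightarrow> v z" and g: "(\<lambda>n. g (z - \<epsilon> n *\<^sub>R y) (u z)) \<longlonglongrightarrow> g z (u z)"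
  shows "(\<lambda>n. doubled (\<epsilon> n) (z, y)) \<longlonglongrightarrow> sgn (u z - v z) * (bump y * ((F z (u z) - F z (v z)) \<bullet> \<psi>' z) +
     \<psi> z * ((D (u z) y - D (v z) y) \<bullet> bump_grad y + bump y * (g z (u z) - g z (v z))))"
proof -
  define w where "w = (\<lambda>n. z - \<epsilon> n *\<^sub>R y)"
  define b where "b = (\<lambda>n. v (w n))"
  have bM: "b n \<in> {-M..M}" for n unfolding b_def by (rule vM)
  have b: "b \<longlonglongrightarrow> v z" using v by (simp add: b_def w_def)
  \<comment> \<open>The state \<open>k n\<close> may vary with \<open>n\<close>, as it does for
    \<open>b\<close>; this is the point where differentiability has to be uniform in the
    state.\<close>
  have quot: "(\<lambda>n. (1 / \<epsilon> n) *\<^sub>R (F z (k n) - F (w n) (k n)) - D (k n) y) \<longlonglongrightarrow> 0" if k: "\<And>n. k n \<in> {-M..M}" for k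
  proof (rule tendstoI)
    fix e :: real assume e: "e > 0"
    obtain d where d: "d > 0" "\<And>y k. norm (y - z) < d \<Longrightarrow> k \<in> {-M..M} \<Longrightarrow> norm (F y k - F z k - D k (y - z)) \<le> e / 2 * norm (y - z)"
      using D(3)[of "e/2"] e by auto
    have "eventually (\<lambda>n. \<epsilon> n < d) sequentially" by (rule order_tendstoD(2)[OF \<epsilon>(2) d(1)])
    then show "eventually (\<lambda>n. dist ((1 / \<epsilon> n) *\<^sub>R (F z (k n) - F (w n) (k n)) - D (k n) y) 0 < e) sequentially"
    proof eventually_elim
      case (elim n)
      have wz: "w n - z = - \<epsilon> n *\<^sub>R y" by (simp add: w_def)
      have nw: "norm (w n - z) \<le> \<epsilon> n" unfolding wz using y \<epsilon>(1)[of n] by (simp add: mult_left_le)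
      have "F (w n) (k n) - F z (k n) - D (k n) (w n - z) = - \<epsilon> n *\<^sub>R ((1 / \<epsilon> n) *\<^sub>R (F z (k n) - F (w n) (k n)) - D (k n) y)"
        unfolding wz linear_scale[OF D(1)[OF k]] using \<epsilon>(1)[of n] by (simp add: algebra_simps)
      then have "\<epsilon> n * norm ((1 / \<epsilon> n) *\<^sub>R (F z (k n) - F (w n) (k n)) - D (k n) y) = norm (F (w n) (k n) - F z (k n) - D (k n) (w n - z))"
        using \<epsilon>(1)[of n] by simp
      also have "\<dots> \<le> e / 2 * norm (w n - z)" using nw elim by (intro d(2) k) auto
      also have "\<dots> \<le> e / 2 * \<epsilon> n" using nw e by simp
      finally have "norm ((1 / \<epsilon> n) *\<^sub>R (F z (k n) - F (w n) (k n)) - D (k n) y) \<le> e / 2"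
        using \<epsilon>(1)[of n] by (simp add: field_simps)
      then show ?case using e by simp
    qed
  qed
  have "(\<lambda>n. D (b n) y) \<longlonglongrightarrow> D (v z) y"
    by (rule continuous_on_tendsto_compose[OF D(2) b vM]) (use bM in auto)
  from tendsto_add[OF quot[of b, OF bM] this]
  have q1: "(\<lambda>n. (1 / \<epsilon> n) *\<^sub>R (F z (b n) - F (w n) (b n))) \<longlonglongrightarrow> D (v z) y" by simp
  from tendsto_add[OF quot[of "\<lambda>_. u z", OF uM] tendsto_const[of "D (u z) y"]]
  have q2: "(\<lambda>n. (1 / \<epsilon> n) *\<^sub>R (F z (u z) - F (w n) (u z))) \<longlonglongrightarrow> D (u z) y" by simp
  have Fb: "(\<lambda>n. F z (b n)) \<longlonglongrightarrow> F z (v z)"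
    by (rule continuous_on_tendsto_compose[OF F_cont_k[of "{-M..M}"] b vM]) (use bM in auto)
  have gb: "(\<lambda>n. g z (b n)) \<longlonglongrightarrow> g z (v z)"
    by (rule continuous_on_tendsto_compose[OF g_cont b vM]) (use bM in auto)
  have "(\<lambda>n. sgn (u z - b n) * (bump y * ((F z (u z) - F z (b n)) \<bullet> \<psi>' z) +
     \<psi> z * (((1 / \<epsilon> n) *\<^sub>R (F z (u z) - F (w n) (u z)) - (1 / \<epsilon> n) *\<^sub>R (F z (b n) - F (w n) (b n))) \<bullet> bump_grad y
      + bump y * (g (w n) (u z) - g z (b n)))))
    \<longlonglongrightarrow> sgn (u z - v z) * (bump y * ((F z (u z) - F z (v z)) \<bullet> \<psi>' z) +
     \<psi> z * ((D (u z) y - D (v z) y) \<bullet> bump_grad y + bump y * (g z (u z) - g z (v z))))"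
    by (intro tendsto_sgn_mult b tendsto_intros Fb gb q1 q2 g[folded w_def[THEN fun_cong]]) auto
  then show ?thesis
    by (simp add: doubled_def Let_def w_def b_def scaleR_diff_right[symmetric] del: scaleR_diff_right)
qed

lemma doubled_integral_tendsto_AE:
  obtains \<epsilon> :: "nat \<Rightarrow> real" where "\<And>n. 0 < \<epsilon> n" "\<epsilon> \<longlonglongrightarrow> 0"
    "AE z in lborel. (\<lambda>n. \<integral>y. doubled (\<epsilon> n) (z, y) \<partial>lborel) \<longlonglongrightarrow>
        (\<integral>y. bump (y::'e) \<partial>lborel) * (sgn (u z - v z) * ((F z (u z) - F z (v z)) \<bullet> \<psi>' z))"
proof -
  \<comment> \<open>One sequence has to serve \<open>v\<close>, all functions
    \<open>\<lambda>z. g z (clip q)\<close> and all \<open>osc m\<close> at once; the index type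
    encodes them as \<open>Inr 0\<close>, \<open>Inl q\<close> and
    \<open>Inr (Suc m)\<close>.\<close>
  define p where "p = (\<lambda>i::rat + nat. case i of Inl q \<Rightarrow> (\<lambda>z. g z (clip q)) | Inr n \<Rightarrow> (case n of 0 \<Rightarrow> v | Suc m \<Rightarrow> osc m))"
  have pm: "p i \<in> borel_measurable borel" for i
    unfolding p_def by (auto split: sum.split nat.split intro: osc_measurable)
  have pb: "\<exists>Q. \<forall>z. norm z \<le> r \<longrightarrow> \<bar>p i z\<bar> \<le> Q" for i r
  proof (cases i)
    case (Inl q)
    then show ?thesis using g_bound[of r] clip_mem by (auto simp: p_def)
  next
    case (Inr n)
    then show ?thesis using osc_bounded[of r] vM by (cases n) (auto simp: p_def abs_le_iff intro!: exI[of _ M] dest: minus_le_iff[THEN iffD1])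
  qed
  obtain \<epsilon> :: "nat \<Rightarrow> real" where \<epsilon>: "\<And>n. 0 < \<epsilon> n" "\<epsilon> \<longlonglongrightarrow> 0"
    and ae: "AE x in lborel \<Otimes>\<^sub>M lborel. norm (snd x) \<le> 1 \<longrightarrow> (\<forall>i. (\<lambda>n. p i (fst x - \<epsilon> n *\<^sub>R snd x)) \<longlonglongrightarrow> p i (fst x))"
    using AE_translation_sequence_countable[of p, OF pm pb] by blast
  obtain b r where br: "b \<ge> 0" "r \<ge> 0"
    "\<And>\<epsilon> z y. 0 < \<epsilon> \<Longrightarrow> \<epsilon> \<le> 1 \<Longrightarrow> \<bar>doubled \<epsilon> (z, y)\<bar> \<le> b * indicator (cball 0 r) z * indicator (cball 0 1) y"
    using doubled_bound by blast
  \<comment> \<open>\<open>doubled_bound\<close> applies to \<epsilon> up to \<open>1\<close>, so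
    the sequence is shifted to start at \<open>n0\<close>.\<close>
  obtain n0 where n0: "\<And>n. n \<ge> n0 \<Longrightarrow> \<epsilon> n \<le> 1"
    using order_tendstoD(2)[OF \<epsilon>(2), of 1] by (auto simp: eventually_sequentially intro: less_imp_le)
  have ae': "AE z in lborel. AE y in lborel. norm y \<le> 1 \<longrightarrow> (\<forall>i. (\<lambda>n. p i (z - \<epsilon> n *\<^sub>R y)) \<longlonglongrightarrow> p i z)"
    using lborel_pair.AE_pair[OF ae] by simp
  show ?thesis
  proof (rule that[of "\<lambda>n. \<epsilon> (n + n0)"])
    show "(\<lambda>n. \<epsilon> (n + n0)) \<longlonglongrightarrow> 0" using \<epsilon>(2) by (rule LIMSEQ_ignore_initial_segment)
    show "AE z in lborel. (\<lambda>n. \<integral>y. doubled (\<epsilon> (n + n0)) (z, y) \<partial>lborel) \<longlonglongrightarrow>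
        (\<integral>y. bump (y::'e) \<partial>lborel) * (sgn (u z - v z) * ((F z (u z) - F z (v z)) \<bullet> \<psi>' z))"
      using ae' diff
    proof eventually_elim
      case (elim z)
      then obtain D where D: "\<And>k. k \<in> {-M..M} \<Longrightarrow> linear (D k)" "\<And>k. k \<in> {-M..M} \<Longrightarrow> g z k = (\<Sum>b\<in>Basis. D k b \<bullet> b)"
        "\<And>h. continuous_on {-M..M} (\<lambda>k. D k h)"
        "\<And>e. e > 0 \<Longrightarrow> \<exists>d>0. \<forall>y. norm (y - z) < d \<longrightarrow> (\<forall>k\<in>{-M..M}. norm (F y k - F z k - D k (y - z)) \<le> e * norm (y - z))"
        by blast
      \<comment> \<open>The trace of this single linear map is the difference of the divergences
        \<open>g\<close>, so \<open>bump_divergence_integral\<close> removes the whole factor of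
        \<open>\<psi> z\<close> from the integral over \<open>y\<close>.\<close>
      define E where "E = (\<lambda>y. D (u z) y - D (v z) y)"
      have E: "linear E" unfolding E_def by (intro linear_compose_sub D(1) uM vM)
      have Ec: "continuous_on S E" for S using E linear_continuous_on linear_linear by blast
      have [measurable]: "E \<in> borel_measurable borel" using Ec by (rule borel_measurable_continuous_onI)
      define c where "c = (F z (u z) - F z (v z)) \<bullet> \<psi>' z"
      define l where "l = (\<lambda>y. sgn (u z - v z) * (bump y * c + \<psi> z * (E y \<bullet> bump_grad y + bump y * (g z (u z) - g z (v z)))))"
      have tr: "g z (u z) - g z (v z) = (\<Sum>b\<in>Basis. E b \<bullet> b)"
        using D(2) uM vM by (simp add: E_def inner_diff_left sum_subtractf)
      have lim0: "(\<lambda>n. doubled (\<epsilon> (n + n0)) (z, y)) \<longlonglongrightarrow> l y"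
        if y: "norm y \<le> 1 \<longrightarrow> (\<forall>i. (\<lambda>n. p i (z - \<epsilon> n *\<^sub>R y)) \<longlonglongrightarrow> p i z)" for y
      proof (cases "norm y \<le> 1")
        case True
        with y have conv: "\<And>i. (\<lambda>n. p i (z - \<epsilon> n *\<^sub>R y)) \<longlonglongrightarrow> p i z" by blast
        have 1: "(\<lambda>n. v (z - \<epsilon> n *\<^sub>R y)) \<longlonglongrightarrow> v z" using conv[of "Inr 0"] by (simp add: p_def)
        have 2: "(\<lambda>n. g (z - \<epsilon> n *\<^sub>R y) (u z)) \<longlonglongrightarrow> g z (u z)"
        proof (rule g_tendsto[OF uM])
          show "(\<lambda>n. g (z - \<epsilon> n *\<^sub>R y) (clip q)) \<longlonglongrightarrow> g z (clip q)" for q using conv[of "Inl q"] by (simp add: p_def)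
          show "(\<lambda>n. osc m (z - \<epsilon> n *\<^sub>R y)) \<longlonglongrightarrow> osc m z" for m using conv[of "Inr (Suc m)"] by (simp add: p_def)
        qed
        have "(\<lambda>n. doubled (\<epsilon> n) (z, y)) \<longlonglongrightarrow> l y"
          using doubled_tendsto[OF D(1,3,4) \<epsilon> True 1 2] by (simp add: l_def c_def E_def)
        then show ?thesis by (rule LIMSEQ_ignore_initial_segment)
      next
        case False
        have "doubled (\<epsilon> (n + n0)) (z, y) = 0" for n using br(3)[OF \<epsilon>(1) n0[of "n + n0"], of z y] False by simp
        moreover have "l y = 0" using False by (simp add: l_def bump_facts)
        ultimately show ?thesis by simp
      qed
      have "(\<lambda>n. \<integral>y. doubled (\<epsilon> (n + n0)) (z, y) \<partial>lborel) \<longlonglongrightarrow> (\<integral>y. l y \<partial>lborel)"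
      proof (rule integral_dominated_convergence[where w="\<lambda>y. indicator (cball 0 1) y * (b * indicator (cball 0 r) z)"])
        show "integrable lborel (\<lambda>y::'e. indicator (cball 0 1) y * (b * indicator (cball 0 r) z))"
          by (intro integrable_mult_left integrable_indicator_bounded) auto
        show "AE y in lborel. (\<lambda>n. doubled (\<epsilon> (n + n0)) (z, y)) \<longlonglongrightarrow> l y"
          using elim(1) by eventually_elim (rule lim0)
        show "AE y in lborel. norm (doubled (\<epsilon> (n + n0)) (z, y)) \<le> indicator (cball 0 1) y * (b * indicator (cball 0 r) z)" for n
          using br(3)[OF \<epsilon>(1) n0[of "n + n0"], of z] by (intro AE_I2) (simp add: mult_ac)
        show "l \<in> borel_measurable lborel" unfolding l_def by measurable
        show "(\<lambda>y. doubled (\<epsilon> (n + n0)) (z, y)) \<in> borel_measurable lborel" for n by measurable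
      qed
      also have "(\<integral>y. l y \<partial>lborel) = (\<integral>y. bump (y::'e) \<partial>lborel) * (sgn (u z - v z) * c)"
      proof -
        have i1: "integrable lborel (\<lambda>y. bump (y::'e) * c)" by (intro integrable_mult_left bump_integrable)
        have i2: "integrable lborel (\<lambda>y. E y \<bullet> bump_grad y + bump y * (\<Sum>b\<in>Basis. E b \<bullet> b))"
          by (rule integrable_continuous_support[where r=1]) (auto intro!: continuous_intros bump_facts Ec simp: bump_facts)
        show ?thesis
          unfolding l_def tr using i1 i2 bump_divergence_integral[OF E] by simp
      qed
      finally show ?case by (simp add: c_def)
    qed
  qed (use \<epsilon> in simp)
qed

text \<open>No zero-order term survives: each Kruzhkov inequality has a source, but the comparison
  of the two solutions is a conservation inequality without one.\<close>

lemma comparison_inequality: "0 \<le> (\<integral>z. sgn (u z - v z) * ((F z (u z) - F z (v z)) \<bullet> \<psi>' z) \<partial>lborel)"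
proof -
  obtain \<epsilon> :: "nat \<Rightarrow> real" where \<epsilon>: "\<And>n. 0 < \<epsilon> n" "\<epsilon> \<longlonglongrightarrow> 0"
    and ae: "AE z in lborel. (\<lambda>n. \<integral>y. doubled (\<epsilon> n) (z, y) \<partial>lborel) \<longlonglongrightarrow>
        (\<integral>y. bump (y::'e) \<partial>lborel) * (sgn (u z - v z) * ((F z (u z) - F z (v z)) \<bullet> \<psi>' z))"
    using doubled_integral_tendsto_AE by blast
  obtain b r where br: "b \<ge> 0" "r \<ge> 0"
    "\<And>\<epsilon> z y. 0 < \<epsilon> \<Longrightarrow> \<epsilon> \<le> 1 \<Longrightarrow> \<bar>doubled \<epsilon> (z, y)\<bar> \<le> b * indicator (cball 0 r) z * indicator (cball 0 1) y"
    using doubled_bound by blast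
  obtain \<delta> where \<delta>: "\<delta> > 0" "\<And>\<epsilon>. 0 < \<epsilon> \<Longrightarrow> \<epsilon> < \<delta> \<Longrightarrow> 0 \<le> (\<integral>z. (\<integral>y. doubled \<epsilon> (z, y) \<partial>lborel) \<partial>lborel)"
    using doubled_inequality by blast
  obtain n0 where n0: "\<And>n. n \<ge> n0 \<Longrightarrow> \<epsilon> n < min \<delta> 1"
    using order_tendstoD(2)[OF \<epsilon>(2), of "min \<delta> 1"] \<delta>(1) by (auto simp: eventually_sequentially)
  \<comment> \<open>The volume of the ball that carries \<open>y\<close>: integrated over
    \<open>y\<close>, the bound of \<open>doubled_bound\<close> becomes \<open>b * V\<close> on the
    ball that carries \<open>z\<close>.\<close>
  define V where "V = measure lborel (cball (0::'e) 1)"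
  have "(\<lambda>n. \<integral>z. (\<integral>y. doubled (\<epsilon> (n + n0)) (z, y) \<partial>lborel) \<partial>lborel) \<longlonglongrightarrow>
     (\<integral>z. (\<integral>y. bump (y::'e) \<partial>lborel) * (sgn (u z - v z) * ((F z (u z) - F z (v z)) \<bullet> \<psi>' z)) \<partial>lborel)"
  proof (rule integral_dominated_convergence[where w="\<lambda>z. indicator (cball 0 r) z * (b * V)"])
    show "integrable lborel (\<lambda>z::'e. indicator (cball 0 r) z * (b * V))"
      by (intro integrable_mult_left integrable_indicator_bounded) auto
    show "AE z in lborel. (\<lambda>n. \<integral>y. doubled (\<epsilon> (n + n0)) (z, y) \<partial>lborel) \<longlonglongrightarrow>
        (\<integral>y. bump (y::'e) \<partial>lborel) * (sgn (u z - v z) * ((F z (u z) - F z (v z)) \<bullet> \<psi>' z))"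
      using ae by eventually_elim (rule LIMSEQ_ignore_initial_segment)
    show "AE z in lborel. norm (\<integral>y. doubled (\<epsilon> (n + n0)) (z, y) \<partial>lborel) \<le> indicator (cball 0 r) z * (b * V)" for n
    proof (rule AE_I2)
      fix z
      have "norm (\<integral>y. doubled (\<epsilon> (n + n0)) (z, y) \<partial>lborel) \<le> (\<integral>y. indicator (cball (0::'e) 1) y * (b * indicator (cball 0 r) z) \<partial>lborel)"
      proof -
        have i: "integrable lborel (\<lambda>y::'e. indicator (cball 0 1) y * (b * indicator (cball 0 r) z))"
          by (intro integrable_mult_left integrable_indicator_bounded) auto
        have bd: "norm (doubled (\<epsilon> (n + n0)) (z, y)) \<le> indicator (cball 0 1) y * (b * indicator (cball 0 r) z)" for y
          using br(3)[OF \<epsilon>(1), of "n + n0" z y] n0[of "n + n0"] by (simp add: mult_ac)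
        have iC: "integrable lborel (\<lambda>y. doubled (\<epsilon> (n + n0)) (z, y))"
          by (rule Bochner_Integration.integrable_bound[OF i])
             (use bd in \<open>auto intro!: AE_I2 intro: order_trans[OF _ abs_ge_self]\<close>)
        show ?thesis
          by (rule order_trans[OF integral_norm_bound integral_mono[OF integrable_norm[OF iC] i bd]])
      qed
      also have "\<dots> = indicator (cball 0 r) z * (b * V)" by (simp add: V_def)
      finally show "norm (\<integral>y. doubled (\<epsilon> (n + n0)) (z, y) \<partial>lborel) \<le> indicator (cball 0 r) z * (b * V)" .
    qed
    show "(\<lambda>z. \<integral>y. doubled (\<epsilon> (n + n0)) (z, y) \<partial>lborel) \<in> borel_measurable lborel" for n
    proof -
      have "case_prod (\<lambda>z y. doubled (\<epsilon> (n + n0)) (z, y)) \<in> borel_measurable (lborel \<Otimes>\<^sub>M lborel)"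
        using measurable_lborel_pair[OF doubled_measurable(3)] by simp
      then show ?thesis by (rule lborel.borel_measurable_lebesgue_integral)
    qed
    show "(\<lambda>z. (\<integral>y. bump (y::'e) \<partial>lborel) * (sgn (u z - v z) * ((F z (u z) - F z (v z)) \<bullet> \<psi>' z))) \<in> borel_measurable lborel"
      unfolding measurable_lborel1 by measurable
  qed
  then have "0 \<le> (\<integral>z. (\<integral>y. bump (y::'e) \<partial>lborel) * (sgn (u z - v z) * ((F z (u z) - F z (v z)) \<bullet> \<psi>' z)) \<partial>lborel)"
  proof (rule LIMSEQ_le_const)
    show "\<exists>N. \<forall>n\<ge>N. 0 \<le> (\<integral>z. (\<integral>y. doubled (\<epsilon> (n + n0)) (z, y) \<partial>lborel) \<partial>lborel)"
      using \<delta>(2) \<epsilon>(1) n0 by simp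
  qed
  then show ?thesis using bump_integral_pos[where 'e='e] by (simp add: zero_le_mult_iff)
qed

end

section \<open>The space-time flux\<close>

lemma locally_Lipschitz_imp_lipschitz_on_cball:
  fixes h :: "'b::euclidean_space \<Rightarrow> 'c::metric_space"
  assumes "locally_Lipschitz h"
  shows "\<exists>L. L-lipschitz_on (cball 0 r) h"
proof -
  \<comment> \<open>The time argument of \<open>local_lipschitz\<close> is a dummy ranging over
    \<open>{0}\<close>; compactness of the ball merges the local constants into one.\<close>
  have ll: "local_lipschitz {0::real} (cball 0 r) (\<lambda>_. h)"
    unfolding local_lipschitz_def
  proof (intro ballI)
    fix z t
    obtain s L where s: "s > 0" "L-lipschitz_on (ball z s) h" using assms unfolding locally_Lipschitz_def by blast
    have "cball z (s / 2) \<subseteq> ball z s" using s(1) by auto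
    then have "L-lipschitz_on (cball z (s / 2) \<inter> cball 0 r) h" using s(2) by (meson inf.coboundedI1 lipschitz_on_subset)
    then show "\<exists>u>0. \<exists>L. \<forall>t\<in>cball t u \<inter> {0::real}. L-lipschitz_on (cball z u \<inter> cball 0 r) h"
      using s(1) by (intro exI[of _ "s / 2"]) auto
  qed
  obtain L where "\<And>t. t \<in> {0::real} \<Longrightarrow> L-lipschitz_on (cball 0 r) h"
    using local_lipschitz_compact_implies_lipschitz[OF ll] by auto
  then show ?thesis by blast
qed

lemma AE_lborel_fst:
  fixes T :: "'a::euclidean_space set"
  assumes "T \<in> null_sets lborel"
  shows "AE z in (lborel :: ('a \<times> 'b::euclidean_space) measure). fst z \<notin> T"
proof -
  have T: "T \<in> sets borel" "emeasure lborel T = 0" using assms by (auto simp: null_sets_def)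
  have "emeasure (lborel \<Otimes>\<^sub>M lborel) (T \<times> (UNIV :: 'b set)) = 0"
    using T by (subst lborel.emeasure_pair_measure_Times) auto
  moreover have "T \<times> (UNIV :: 'b set) \<in> sets (lborel \<Otimes>\<^sub>M lborel)" using T by auto
  ultimately have "T \<times> (UNIV :: 'b set) \<in> null_sets lborel" unfolding lborel_prod by auto
  from AE_not_in[OF this] show ?thesis by eventually_elim auto
qed

text \<open>\<open>T\<close> will be a Borel null set that contains the exceptional set of the flux
  assumption. \<open>Dx_uniform\<close> is (2b) with the quotient multiplied out, which also makes
  sense at \<open>y = x\<close> and for empty \<open>K\<close>.\<close>

locale divergence_flux =
  fixes f :: "'a::euclidean_space \<Rightarrow> real \<Rightarrow> 'a" and T :: "'a set"
  assumes f_lip: "\<And>r. \<exists>L. L-lipschitz_on (cball 0 r) (\<lambda>(x, k). f x k)"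
    and T_null: "T \<in> null_sets lborel"
    and Dx_derivative: "\<And>x k. x \<notin> T \<Longrightarrow> ((\<lambda>y. f y k) has_derivative Dx f x k) (at x)"
    and Dx_continuous: "\<And>x. x \<notin> T \<Longrightarrow> continuous_on UNIV (\<lambda>k. Dx f x k)"
    and Dx_uniform: "\<And>x K e. x \<notin> T \<Longrightarrow> compact K \<Longrightarrow> 0 < e \<Longrightarrow> \<exists>d>0. \<forall>y k. norm (y - x) < d \<longrightarrow> k \<in> K \<longrightarrow>
       norm (f y k - f x k - Dx f x k (y - x)) \<le> e * norm (y - x)"

lemma flux_assumption_imp_divergence_flux:
  assumes "flux_assumption f"
  obtains T where "divergence_flux f T"
proof -
  have ll: "locally_Lipschitz (\<lambda>(x, k). f x k)" using assms by (simp add: flux_assumption_def)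
  obtain \<Theta> where \<Theta>: "\<Theta> \<in> null_sets lebesgue" "\<And>k x. x \<notin> \<Theta> \<Longrightarrow> (\<lambda>y. f y k) differentiable (at x)"
     "\<And>x. x \<notin> \<Theta> \<Longrightarrow> continuous_on UNIV (\<lambda>k. Dx f x k)"
     and lim: "\<And>x K. x \<notin> \<Theta> \<Longrightarrow> compact K \<Longrightarrow> K \<noteq> {} \<Longrightarrow>
           ((\<lambda>y. SUP k\<in>K. norm (f y k - f x k - Dx f x k (y - x)) / norm (y - x)) \<longlongrightarrow> 0) (at x)"
    using assms unfolding flux_assumption_def by blast
  obtain T where T: "T \<in> null_sets lborel" "\<Theta> \<subseteq> T" using \<Theta>(1) by (auto simp: null_sets_completion_iff2)
  have lip: "\<exists>L. L-lipschitz_on (cball 0 r) (\<lambda>(x, k). f x k)" for r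
    using ll by (rule locally_Lipschitz_imp_lipschitz_on_cball)
  have fc: "continuous_on K (\<lambda>k. f y k)" if "compact K" for y K
  proof -
    obtain r where r: "\<forall>k\<in>K. norm k \<le> r" using compact_imp_bounded[OF \<open>compact K\<close>] by (auto simp: bounded_iff)
    obtain L where L: "L-lipschitz_on (cball 0 (norm y + r)) (\<lambda>(x, k). f x k)" using lip by blast
    have "continuous_on K (\<lambda>k. (\<lambda>(x, k). f x k) (y, k))"
    proof (rule continuous_on_compose2[OF lipschitz_on_continuous_on[OF L]])
      show "(\<lambda>k. (y, k)) ` K \<subseteq> cball 0 (norm y + r)"
      proof
        fix p assume "p \<in> (\<lambda>k. (y, k)) ` K"
        then obtain k where "p = (y, k)" "k \<in> K" by auto
        then show "p \<in> cball 0 (norm y + r)" using r norm_Pair_le[of y k] by force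
      qed
    qed (intro continuous_intros)
    then show ?thesis by simp
  qed
  have der: "((\<lambda>y. f y k) has_derivative Dx f x k) (at x)" if "x \<notin> T" for x k
  proof -
    have "(\<lambda>y. f y k) differentiable (at x)" using \<Theta>(2) T that by blast
    then have d: "((\<lambda>y. f y k) has_derivative frechet_derivative (\<lambda>y. f y k) (at x)) (at x)"
      by (simp add: frechet_derivative_works)
    then have "blinfun_apply (Dx f x k) = frechet_derivative (\<lambda>y. f y k) (at x)"
      unfolding Dx_def by (intro bounded_linear_Blinfun_apply has_derivative_bounded_linear)
    with d show ?thesis by simp
  qed
  have "divergence_flux f T"
  proof
    show "\<exists>d>0. \<forall>y k. norm (y - x) < d \<longrightarrow> k \<in> K \<longrightarrow> norm (f y k - f x k - Dx f x k (y - x)) \<le> e * norm (y - x)"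
      if x: "x \<notin> T" and K: "compact K" and e: "0 < e" for x K e
    proof (cases "K = {}")
      case False
      have x': "x \<notin> \<Theta>" using x T by blast
      have "eventually (\<lambda>y. (SUP k\<in>K. norm (f y k - f x k - Dx f x k (y - x)) / norm (y - x)) < e) (at x)"
        by (rule order_tendstoD(2)[OF lim[OF x' K False] e])
      then obtain d where d: "d > 0"
        "\<And>y. y \<noteq> x \<Longrightarrow> dist y x < d \<Longrightarrow> (SUP k\<in>K. norm (f y k - f x k - Dx f x k (y - x)) / norm (y - x)) < e"
        unfolding eventually_at by auto
      have "norm (f y k - f x k - Dx f x k (y - x)) \<le> e * norm (y - x)" if y: "norm (y - x) < d" and k: "k \<in> K" for y k
      proof (cases "y = x")
        case False
        have "continuous_on K (\<lambda>k. Dx f x k)" using \<Theta>(3)[OF x'] continuous_on_subset by blast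
        then have "continuous_on K (\<lambda>k. norm (f y k - f x k - Dx f x k (y - x)) / norm (y - x))"
          using False by (intro continuous_intros fc K) auto
        \<comment> \<open>A real supremum bounds the members of a set only if the set is bounded
          above; compactness of \<open>K\<close> and continuity in \<open>k\<close> ensure
          this.\<close>
        then have "bdd_above ((\<lambda>k. norm (f y k - f x k - Dx f x k (y - x)) / norm (y - x)) ` K)"
          by (intro bounded_imp_bdd_above compact_imp_bounded compact_continuous_image K)
        from cSUP_upper[OF k this] d(2)[OF False] y
        have "norm (f y k - f x k - Dx f x k (y - x)) / norm (y - x) < e" by (simp add: dist_norm)
        then show ?thesis using False by (simp add: divide_less_eq)
      qed simp
      then show ?thesis using d(1) by blast
    qed (auto intro: exI[of _ 1])
  qed (use lip T \<Theta>(3) der in auto)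
  then show ?thesis by (rule that)
qed

context divergence_flux
begin

definition st_flux :: "'a \<times> real \<Rightarrow> real \<Rightarrow> 'a \<times> real" where "st_flux z k = (f (fst z) k, k)"

text \<open>
  The value \<open>0\<close> on \<open>T\<close> makes \<open>flux_div x\<close> continuous for every \<open>x\<close> and jointly Borel measurable.
\<close>

definition flux_div :: "'a \<Rightarrow> real \<Rightarrow> real" where
  "flux_div x k = (if x \<in> T then 0 else divergence (\<lambda>y. f y k) x)"

lemma f_continuous: "continuous_on UNIV (\<lambda>(x, k). f x k)"
proof -
  have "continuous (at z) (\<lambda>(x, k). f x k)" for z
  proof -
    obtain L where L: "L-lipschitz_on (cball 0 (norm z + 1)) (\<lambda>(x, k). f x k)" using f_lip by blast
    have "continuous_on (ball 0 (norm z + 1)) (\<lambda>(x, k). f x k)"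
      using lipschitz_on_continuous_on[OF L] by (rule continuous_on_subset) auto
    then show ?thesis by (simp add: continuous_on_eq_continuous_at)
  qed
  then show ?thesis by (simp add: continuous_at_imp_continuous_on)
qed

lemma f_measurable: "(\<lambda>(x, k). f x k) \<in> borel_measurable (borel \<Otimes>\<^sub>M borel)"
  unfolding borel_prod by (rule borel_measurable_continuous_onI[OF f_continuous])

lemma f_continuous_compose:
  "continuous_on S a \<Longrightarrow> continuous_on S b \<Longrightarrow> continuous_on S (\<lambda>s. f (a s) (b s))"
  using continuous_on_compose2[OF f_continuous, of S "\<lambda>s. (a s, b s)"] by (auto intro: continuous_on_Pair)

lemma f_lip_x: "\<exists>L. \<forall>k\<in>{-m..m}. L-lipschitz_on (cball 0 r) (\<lambda>x. f x k)"
proof -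
  obtain L where L: "L-lipschitz_on (cball 0 (\<bar>r\<bar> + \<bar>m\<bar>)) (\<lambda>(x, k). f x k)" using f_lip by blast
  have "L-lipschitz_on (cball 0 r) (\<lambda>x. f x k)" if "k \<in> {-m..m}" for k
  proof (rule lipschitz_onI)
    fix x y assume xy: "x \<in> cball (0::'a) r" "y \<in> cball (0::'a) r"
    have "norm (x, k) \<le> \<bar>r\<bar> + \<bar>m\<bar>" "norm (y, k) \<le> \<bar>r\<bar> + \<bar>m\<bar>"
      using norm_Pair_le[of x k] norm_Pair_le[of y k] xy that by auto
    then have "dist (f x k) (f y k) \<le> L * dist (x, k) (y, k)" using lipschitz_onD[OF L, of "(x, k)" "(y, k)"] by simp
    then show "dist (f x k) (f y k) \<le> L * dist x y" by (simp add: dist_Pair_Pair)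
  qed (rule lipschitz_on_nonneg[OF L])
  then show ?thesis by blast
qed

lemma f_lip_k: "\<exists>L. \<forall>x. norm x \<le> r \<longrightarrow> L-lipschitz_on {a..b} (f x)"
proof -
  define m where "m = \<bar>a\<bar> + \<bar>b\<bar>"
  obtain L where L: "L-lipschitz_on (cball 0 (r + m)) (\<lambda>(x, k). f x k)" using f_lip by blast
  have "L-lipschitz_on {a..b} (f x)" if x: "norm x \<le> r" for x
  proof (rule lipschitz_onI)
    fix k l assume kl: "k \<in> {a..b}" "l \<in> {a..b}"
    have "norm (x, k) \<le> r + m" "norm (x, l) \<le> r + m"
      using norm_Pair_le[of x k] norm_Pair_le[of x l] kl x by (auto simp: m_def)
    then have "dist (f x k) (f x l) \<le> L * dist (x, k) (x, l)" using lipschitz_onD[OF L, of "(x, k)" "(x, l)"] by simp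
    then show "dist (f x k) (f x l) \<le> L * dist k l" by (simp add: dist_Pair_Pair)
  qed (rule lipschitz_on_nonneg[OF L])
  then show ?thesis by blast
qed

lemma flux_div_eq: "x \<notin> T \<Longrightarrow> flux_div x k = (\<Sum>b\<in>Basis. Dx f x k b \<bullet> b)"
  using frechet_derivative_at[OF Dx_derivative, of x k] by (simp add: flux_div_def divergence_def)

lemma flux_div_continuous: "continuous_on S (flux_div x)"
proof (cases "x \<in> T")
  case False
  have "continuous_on S (\<lambda>k. Dx f x k)" using Dx_continuous[OF False] continuous_on_subset by blast
  then have "continuous_on S (\<lambda>k. \<Sum>b\<in>Basis. Dx f x k b \<bullet> b)" by (intro continuous_intros)
  then show ?thesis using flux_div_eq[OF False] by simp
qed (simp add: flux_div_def[abs_def])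

lemma Dx_quotient:
  assumes "x \<notin> T"
  shows "(\<lambda>n. real (Suc n) *\<^sub>R (f (x + (1 / real (Suc n)) *\<^sub>R b) k - f x k)) \<longlonglongrightarrow> Dx f x k b"
proof -
  have "((\<lambda>t. x + t *\<^sub>R b) has_derivative (\<lambda>t. t *\<^sub>R b)) (at 0)"
    by (auto intro!: derivative_eq_intros)
  moreover have "((\<lambda>y. f y k) has_derivative Dx f x k) (at (x + 0 *\<^sub>R b))" using Dx_derivative[OF assms] by simp
  ultimately have "((\<lambda>t. f (x + t *\<^sub>R b) k) has_derivative (\<lambda>t. Dx f x k (t *\<^sub>R b))) (at 0)"
    by (rule has_derivative_compose)
  then have lim: "(\<lambda>t. norm (f (x + t *\<^sub>R b) k - f x k - t *\<^sub>R Dx f x k b) / norm t) \<midarrow>0\<rightarrow> 0"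
    unfolding has_derivative_at by (simp add: blinfun.scaleR_right)
  have "(\<lambda>t. norm ((f (x + t *\<^sub>R b) k - f x k) /\<^sub>R t - Dx f x k b)) \<midarrow>0\<rightarrow> 0"
  proof (rule Lim_transform_eventually[OF lim])
    show "\<forall>\<^sub>F t in at 0. norm (f (x + t *\<^sub>R b) k - f x k - t *\<^sub>R Dx f x k b) / norm t = norm ((f (x + t *\<^sub>R b) k - f x k) /\<^sub>R t - Dx f x k b)"
      unfolding eventually_at
    proof (intro exI[of _ 1] conjI ballI impI; (elim conjE)?)
      fix t :: real assume t: "t \<noteq> 0"
      have "f (x + t *\<^sub>R b) k - f x k - t *\<^sub>R Dx f x k b = t *\<^sub>R ((f (x + t *\<^sub>R b) k - f x k) /\<^sub>R t - Dx f x k b)"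
        using t by (simp add: algebra_simps)
      then show "norm (f (x + t *\<^sub>R b) k - f x k - t *\<^sub>R Dx f x k b) / norm t = norm ((f (x + t *\<^sub>R b) k - f x k) /\<^sub>R t - Dx f x k b)"
        using t by simp
    qed simp
  qed
  then have "(\<lambda>t. (f (x + t *\<^sub>R b) k - f x k) /\<^sub>R t) \<midarrow>0\<rightarrow> Dx f x k b"
    by (rule LIM_zero_cancel[OF tendsto_norm_zero_cancel])
  moreover have "filterlim (\<lambda>n. 1 / real (Suc n)) (at 0) sequentially"
    using LIMSEQ_inverse_real_of_nat by (auto simp: filterlim_at inverse_eq_divide)
  ultimately have "(\<lambda>n. (f (x + (1 / real (Suc n)) *\<^sub>R b) k - f x k) /\<^sub>R (1 / real (Suc n))) \<longlonglongrightarrow> Dx f x k b"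
    by (rule filterlim_compose)
  then show ?thesis by simp
qed

text \<open>Difference quotients with the steps \<open>1 / real (Suc n)\<close> present the
  divergence off \<open>T\<close> as a sequential limit of continuous functions of \<open>x\<close>
  and \<open>k\<close>; the bound and the Borel measurability of \<open>flux_div\<close> pass to the
  limit.\<close>

lemma flux_div_quotient:
  assumes "x \<notin> T"
  shows "(\<lambda>n. \<Sum>b\<in>Basis. (real (Suc n) *\<^sub>R (f (x + (1 / real (Suc n)) *\<^sub>R b) k - f x k)) \<bullet> b) \<longlonglongrightarrow> flux_div x k"
  unfolding flux_div_eq[OF assms] by (intro tendsto_intros Dx_quotient assms)

lemma flux_div_bound: "\<exists>C\<ge>0. \<forall>x k. norm x \<le> r \<longrightarrow> k \<in> {-m..m} \<longrightarrow> \<bar>flux_div x k\<bar> \<le> C"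
proof -
  \<comment> \<open>The radius is \<open>r + 1\<close> because the quotients evaluate the flux up to
    one unit away from \<open>x\<close>.\<close>
  obtain L where L: "\<And>k. k \<in> {-m..m} \<Longrightarrow> L-lipschitz_on (cball 0 (r + 1)) (\<lambda>x. f x k)" using f_lip_x by blast
  have bd: "\<bar>flux_div x k\<bar> \<le> real DIM('a) * max 0 L" if x: "norm x \<le> r" and k: "k \<in> {-m..m}" for x k
  proof (cases "x \<in> T")
    case False
    have L0: "L \<ge> 0" using L[OF k] lipschitz_on_nonneg by blast
    have "\<bar>\<Sum>b\<in>Basis. (real (Suc n) *\<^sub>R (f (x + (1 / real (Suc n)) *\<^sub>R b) k - f x k)) \<bullet> b\<bar> \<le> real DIM('a) * max 0 L" for n
    proof -
      have "\<bar>(real (Suc n) *\<^sub>R (f (x + (1 / real (Suc n)) *\<^sub>R b) k - f x k)) \<bullet> b\<bar> \<le> max 0 L" if b: "b \<in> Basis" for b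
      proof -
        have "norm ((1 / real (Suc n)) *\<^sub>R b) \<le> 1" using b by simp
        then have xb: "norm (x + (1 / real (Suc n)) *\<^sub>R b) \<le> r + 1" using norm_triangle_ineq[of x "(1 / real (Suc n)) *\<^sub>R b"] x by linarith
        have "norm (f (x + (1 / real (Suc n)) *\<^sub>R b) k - f x k) \<le> L * norm ((1 / real (Suc n)) *\<^sub>R b)"
        proof -
          have "x + (1 / real (Suc n)) *\<^sub>R b \<in> cball 0 (r + 1)" "x \<in> cball 0 (r + 1)"
            using xb x unfolding mem_cball_0 by linarith+
          from lipschitz_onD[OF L[OF k] this] show ?thesis by (simp only: dist_norm add_diff_cancel_left')
        qed
        also have "\<dots> = L / real (Suc n)" using b by simp
        finally have "norm (real (Suc n) *\<^sub>R (f (x + (1 / real (Suc n)) *\<^sub>R b) k - f x k)) \<le> L"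
          unfolding norm_scaleR by (simp add: field_simps)
        then show ?thesis using Basis_le_norm[OF b] by (meson le_max_iff_disj order_trans)
      qed
      then show ?thesis by (intro order_trans[OF sum_abs] sum_bounded_above[where K="max 0 L", simplified]) auto
    qed
    note bd = this
    show ?thesis
      by (rule tendsto_upperbound[OF tendsto_rabs[OF flux_div_quotient[OF False]] always_eventually[OF allI[OF bd]]]) simp
  qed (simp add: flux_div_def)
  then show ?thesis by (intro exI[of _ "real DIM('a) * max 0 L"]) auto
qed

lemma flux_div_measurable: "(\<lambda>(x, k). flux_div x k) \<in> borel_measurable (borel \<Otimes>\<^sub>M borel)"
proof -
  have [measurable]: "T \<in> sets borel" using T_null by auto
  define Q where "Q = (\<lambda>n (x, k). if x \<in> T then 0 else \<Sum>b\<in>Basis. (real (Suc n) *\<^sub>R (f (x + (1 / real (Suc n)) *\<^sub>R b) k - f x k)) \<bullet> b)"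
  have Qm: "Q n \<in> borel_measurable (borel \<Otimes>\<^sub>M borel)" for n
  proof -
    have "(\<lambda>z. \<Sum>b\<in>Basis. (real (Suc n) *\<^sub>R (f (fst z + (1 / real (Suc n)) *\<^sub>R b) (snd z) - f (fst z) (snd z))) \<bullet> b) \<in> borel_measurable (borel \<Otimes>\<^sub>M borel)"
      unfolding borel_prod by (intro borel_measurable_continuous_onI continuous_intros f_continuous_compose)
    then show ?thesis unfolding Q_def case_prod_beta' by measurable
  qed
  have Ql: "(\<lambda>n. Q n x) \<longlonglongrightarrow> (case x of (x, k) \<Rightarrow> flux_div x k)" for x
  proof (cases "fst x \<in> T")
    case False
    then show ?thesis using flux_div_quotient[OF False, of "snd x"] by (simp add: Q_def split_beta del: of_nat_Suc)
  qed (simp add: Q_def flux_div_def split_beta)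
  show ?thesis by (rule borel_measurable_LIMSEQ_metric[OF Qm Ql])
qed

lemma lipschitz_flux_st_flux: "0 < M \<Longrightarrow> lipschitz_flux st_flux (\<lambda>z. flux_div (fst z)) M"
proof
  assume M: "0 < M"
  then show "0 < M" .
  show "continuous_on UNIV (\<lambda>(z, k). st_flux z k)"
    unfolding st_flux_def case_prod_beta' by (intro continuous_intros f_continuous_compose)
  show "\<exists>L. \<forall>k\<in>{-M..M}. L-lipschitz_on (cball 0 r) (\<lambda>z. st_flux z k)" for r
  proof -
    obtain L where L: "\<And>k. k \<in> {-M..M} \<Longrightarrow> L-lipschitz_on (cball 0 r) (\<lambda>x. f x k)" using f_lip_x by blast
    have "L-lipschitz_on (cball 0 r) (\<lambda>z. st_flux z k)" if k: "k \<in> {-M..M}" for k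
    proof (rule lipschitz_onI)
      have L0: "L \<ge> 0" using L[OF k] lipschitz_on_nonneg by blast
      fix z w :: "'a \<times> real" assume zw: "z \<in> cball 0 r" "w \<in> cball 0 r"
      have "norm (fst z) \<le> r" "norm (fst w) \<le> r" using zw norm_fst_le[of "fst z" "snd z"] norm_fst_le[of "fst w" "snd w"] by auto
      then have "dist (f (fst z) k) (f (fst w) k) \<le> L * dist (fst z) (fst w)" using lipschitz_onD[OF L[OF k]] by simp
      also have "\<dots> \<le> L * dist z w" by (intro mult_left_mono L0 dist_fst_le)
      finally show "dist (st_flux z k) (st_flux w k) \<le> L * dist z w" by (simp add: st_flux_def dist_Pair_Pair)
    qed (use L[OF k] lipschitz_on_nonneg in blast)
    then show ?thesis by blast
  qed
  show "(\<lambda>(z::'a\<times>real, k). flux_div (fst z) k) \<in> borel_measurable (borel \<Otimes>\<^sub>M borel)"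
  proof -
    have "(\<lambda>x::('a \<times> real) \<times> real. (fst (fst x), snd x)) \<in> borel \<Otimes>\<^sub>M borel \<rightarrow>\<^sub>M borel \<Otimes>\<^sub>M borel"
      unfolding borel_prod by (intro borel_measurable_continuous_onI continuous_intros)
    from measurable_compose[OF this flux_div_measurable] show ?thesis by (simp add: split_beta')
  qed
  show "\<exists>C. \<forall>(z :: 'a \<times> real) k. norm z \<le> r \<longrightarrow> k \<in> {-M..M} \<longrightarrow> \<bar>flux_div (fst z) k\<bar> \<le> C" for r
  proof -
    obtain C where C: "\<And>x k. norm x \<le> r \<Longrightarrow> k \<in> {-M..M} \<Longrightarrow> \<bar>flux_div x k\<bar> \<le> C" using flux_div_bound by blast
    have "norm (fst z) \<le> norm z" for z :: "'a \<times> real" using norm_fst_le[of "fst z" "snd z"] by simp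
    then have "\<bar>flux_div (fst z) k\<bar> \<le> C" if "norm z \<le> r" "k \<in> {-M..M}" for z :: "'a \<times> real" and k
      using C[of "fst z" k] that order_trans[of "norm (fst z)" "norm z" r] by blast
    then show ?thesis by blast
  qed
  show "continuous_on {-M..M} (flux_div (fst z))" for z :: "'a \<times> real" by (rule flux_div_continuous)
  show "AE z in lborel. \<exists>D :: real \<Rightarrow> 'a \<times> real \<Rightarrow> 'a \<times> real.
       (\<forall>k\<in>{-M..M}. linear (D k) \<and> flux_div (fst z) k = (\<Sum>b\<in>Basis. D k b \<bullet> b)) \<and>
       (\<forall>h. continuous_on {-M..M} (\<lambda>k. D k h)) \<and>
       (\<forall>e>0. \<exists>d>0. \<forall>y. norm (y - z) < d \<longrightarrow>
          (\<forall>k\<in>{-M..M}. norm (st_flux y k - st_flux z k - D k (y - z)) \<le> e * norm (y - z)))"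
    using AE_lborel_fst[OF T_null]
  proof eventually_elim
    case (elim z)
    \<comment> \<open>The flux does not depend on time, nor the last component of
      \<open>st_flux\<close> on position. So the space-time derivative is the spatial one padded
      with zeros, and it has the same trace.\<close>
    let ?D = "\<lambda>k h. (Dx f (fst z) k (fst h), 0::real)"
    have fst_le: "norm (fst h) \<le> norm h" for h :: "'a \<times> real" using norm_fst_le[of "fst h" "snd h"] by simp
    show ?case
    proof (intro exI[of _ ?D] conjI ballI allI impI)
      show "linear (?D k)" for k
        by (rule linearI) (auto simp: blinfun.add_right blinfun.scaleR_right)
      show "flux_div (fst z) k = (\<Sum>b\<in>Basis. ?D k b \<bullet> b)" for k
      proof -
        have "(\<Sum>b\<in>Basis. ?D k b \<bullet> b) = (\<Sum>b\<in>(\<lambda>a. (a, 0)) ` Basis. ?D k b \<bullet> b) + (\<Sum>b\<in>(\<lambda>c. (0, c)) ` Basis. ?D k b \<bullet> b)"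
          unfolding Basis_prod_def by (rule sum.union_disjoint) auto
        also have "\<dots> = (\<Sum>b\<in>Basis. Dx f (fst z) k b \<bullet> b)"
          by (subst (1 2) sum.reindex) (auto simp: inj_on_def)
        finally show ?thesis unfolding flux_div_eq[OF elim] by simp
      qed
      show "continuous_on {-M..M} (\<lambda>k. ?D k h)" for h
        using continuous_on_subset[OF Dx_continuous[OF elim]] by (intro continuous_intros) auto
      fix e :: real assume e: "e > 0"
      obtain d where d: "d > 0" "\<And>y k. norm (y - fst z) < d \<Longrightarrow> k \<in> {-M..M} \<Longrightarrow>
         norm (f y k - f (fst z) k - Dx f (fst z) k (y - fst z)) \<le> e * norm (y - fst z)"
        using Dx_uniform[OF elim _ e, of "{-M..M}"] by auto
      have "norm (st_flux y k - st_flux z k - ?D k (y - z)) \<le> e * norm (y - z)" if y: "norm (y - z) < d" and k: "k \<in> {-M..M}" for y k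
      proof -
        have "norm (fst y - fst z) < d" using fst_le[of "y - z"] y by simp
        from d(2)[OF this k] have "norm (st_flux y k - st_flux z k - ?D k (y - z)) \<le> e * norm (fst (y - z))"
          by (simp add: st_flux_def)
        also have "\<dots> \<le> e * norm (y - z)" using e by (intro mult_left_mono fst_le) auto
        finally show ?thesis .
      qed
      then show "\<exists>d>0. \<forall>y. norm (y - z) < d \<longrightarrow> (\<forall>k\<in>{-M..M}. norm (st_flux y k - st_flux z k - ?D k (y - z)) \<le> e * norm (y - z))"
        using d(1) by blast
    qed
  qed
qed

end

section \<open>From entropy inequalities to Kruzhkov inequalities\<close>

text \<open>
  \<open>smooth_abs\<close> is an antiderivative of an antiderivative of a tent function on \<open>[-1, 1]\<close>; the compact support
  of the second derivative localises the entropy flux integral near \<open>k\<close>.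
\<close>

definition smooth_abs :: "real \<Rightarrow> real" where
  "smooth_abs s = (1/3) * ((max 0 (s + 1)) ^ 3 - 2 * (max 0 s) ^ 3 + (max 0 (s - 1)) ^ 3) - s - 1/3"

definition smooth_abs' :: "real \<Rightarrow> real" where
  "smooth_abs' s = (max 0 (s + 1))\<^sup>2 - 2 * (max 0 s)\<^sup>2 + (max 0 (s - 1))\<^sup>2 - 1"

definition smooth_abs'' :: "real \<Rightarrow> real" where
  "smooth_abs'' s = 2 * max 0 (s + 1) - 4 * max 0 s + 2 * max 0 (s - 1)"

lemma pos_part_shift_derivative:
  "((\<lambda>s::real. (max 0 (s + a)) ^ 3) has_real_derivative 3 * (max 0 (s + a))\<^sup>2) (at s)"
  "((\<lambda>s::real. (max 0 (s + a))\<^sup>2) has_real_derivative 2 * max 0 (s + a)) (at s)"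
proof -
  have d: "((\<lambda>s. s + a) has_real_derivative 1) (at s)" by (auto intro!: derivative_eq_intros)
  show "((\<lambda>s::real. (max 0 (s + a)) ^ 3) has_real_derivative 3 * (max 0 (s + a))\<^sup>2) (at s)"
    using DERIV_chain2[OF has_real_derivative_pos_part_power[of 1 "s + a"] d] by (simp add: numeral_3_eq_3 numeral_2_eq_2)
  show "((\<lambda>s::real. (max 0 (s + a))\<^sup>2) has_real_derivative 2 * max 0 (s + a)) (at s)"
    using DERIV_chain2[OF has_real_derivative_pos_part_power[of 0 "s + a"] d] by (simp add: numeral_2_eq_2)
qed

lemma smooth_abs_derivative: "(smooth_abs has_real_derivative smooth_abs' s) (at s)"
proof -
  note p = pos_part_shift_derivative(1)
  have "(smooth_abs has_real_derivative (1/3) * (3 * (max 0 (s + 1))\<^sup>2 - 2 * (3 * (max 0 s)\<^sup>2) + 3 * (max 0 (s - 1))\<^sup>2) - 1 - 0) (at s)"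
    unfolding smooth_abs_def[abs_def]
    by (intro DERIV_diff DERIV_add DERIV_cmult DERIV_ident DERIV_const p[of 1] p[of 0, simplified] p[of "-1", simplified])
  then show ?thesis by (simp add: smooth_abs'_def add_divide_distrib diff_divide_distrib)
qed

lemma smooth_abs'_derivative: "(smooth_abs' has_real_derivative smooth_abs'' s) (at s)"
proof -
  note p = pos_part_shift_derivative(2)
  have "(smooth_abs' has_real_derivative 2 * max 0 (s + 1) - 2 * (2 * max 0 s) + 2 * max 0 (s - 1) - 0) (at s)"
    unfolding smooth_abs'_def[abs_def]
    by (intro DERIV_diff DERIV_add DERIV_cmult DERIV_const p[of 1] p[of 0, simplified] p[of "-1", simplified])
  then show ?thesis by (simp add: smooth_abs''_def)
qed

lemma smooth_abs''_continuous: "continuous_on S smooth_abs''"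
  unfolding smooth_abs''_def[abs_def] by (intro continuous_intros)

lemma smooth_abs''_measurable [measurable]: "smooth_abs'' \<in> borel_measurable borel" "smooth_abs' \<in> borel_measurable borel" "smooth_abs \<in> borel_measurable borel"
  unfolding smooth_abs''_def[abs_def] smooth_abs'_def[abs_def] smooth_abs_def[abs_def] by measurable

lemma smooth_abs''_bounds: "0 \<le> smooth_abs'' s" "smooth_abs'' s \<le> 2" "1 \<le> \<bar>s\<bar> \<Longrightarrow> smooth_abs'' s = 0"
  by (auto simp: smooth_abs''_def max_def)

lemma smooth_abs'_values: "1 \<le> s \<Longrightarrow> smooth_abs' s = 1" "s \<le> -1 \<Longrightarrow> smooth_abs' s = -1" "smooth_abs' 0 = 0"
  by (auto simp: smooth_abs'_def max_def power2_eq_square algebra_simps)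

lemma smooth_abs'_mono: "s \<le> t \<Longrightarrow> smooth_abs' s \<le> smooth_abs' t"
  by (rule DERIV_nonneg_imp_nondecreasing) (use smooth_abs'_derivative smooth_abs''_bounds(1) in blast)+

lemma smooth_abs'_bound: "\<bar>smooth_abs' s\<bar> \<le> 1"
  using smooth_abs'_mono[of s "max s 1"] smooth_abs'_mono[of "min s (-1)" s] smooth_abs'_values(1)[of "max s 1"] smooth_abs'_values(2)[of "min s (-1)"]
  by (auto simp: abs_le_iff)

text \<open>For \<open>s \<ge> 1\<close> the second difference of cubes is \<open>6 * s\<close>,
  which gives \<open>2 * s - s - 1/3\<close>; the offset \<open>1/3\<close> comes from normalising
  the value at \<open>0\<close> to \<open>0\<close>.\<close>

lemma smooth_abs_values: "1 \<le> \<bar>s\<bar> \<Longrightarrow> smooth_abs s = \<bar>s\<bar> - 1/3" "smooth_abs 0 = 0"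
proof -
  show "smooth_abs 0 = 0" by (simp add: smooth_abs_def)
  assume "1 \<le> \<bar>s\<bar>"
  then consider "s \<ge> 1" | "s \<le> -1" by linarith
  then show "smooth_abs s = \<bar>s\<bar> - 1/3"
    by cases (auto simp: smooth_abs_def max_def power3_eq_cube algebra_simps)
qed

lemma smooth_abs_bound: "\<bar>smooth_abs s\<bar> \<le> \<bar>s\<bar>"
proof -
  have "norm (smooth_abs s - smooth_abs 0) \<le> 1 * norm (s - 0)"
    by (rule field_differentiable_bound[of UNIV smooth_abs smooth_abs'])
       (auto intro: has_field_derivative_at_within smooth_abs_derivative simp: smooth_abs'_bound)
  then show ?thesis by (simp add: smooth_abs_values)
qed

section \<open>Entropy pairs approximating \<open>\<bar>s - k\<bar>\<close>\<close>

lemma scaled_smooth_abs_derivative: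
  assumes c: "c > 0"
  shows "((\<lambda>s. smooth_abs (c * (s - k)) / c) has_real_derivative smooth_abs' (c * (s - k))) (at s)"
    "((\<lambda>s. smooth_abs' (c * (s - k))) has_real_derivative c * smooth_abs'' (c * (s - k))) (at s)"
proof -
  have d: "((\<lambda>s. c * (s - k)) has_real_derivative c) (at s)" by (auto intro!: derivative_eq_intros)
  show "((\<lambda>s. smooth_abs (c * (s - k)) / c) has_real_derivative smooth_abs' (c * (s - k))) (at s)"
    using DERIV_cdivide[OF DERIV_chain2[OF smooth_abs_derivative d], of c] c by simp
  show "((\<lambda>s. smooth_abs' (c * (s - k))) has_real_derivative c * smooth_abs'' (c * (s - k))) (at s)"
    using DERIV_chain2[OF smooth_abs'_derivative d] by (simp add: mult.commute)
qed

lemma scaled_smooth_abs_deriv: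
  assumes "c > 0"
  shows "deriv (\<lambda>s. smooth_abs (c * (s - k)) / c) = (\<lambda>s. smooth_abs' (c * (s - k)))"
    "deriv (\<lambda>s. smooth_abs' (c * (s - k))) = (\<lambda>s. c * smooth_abs'' (c * (s - k)))"
  using scaled_smooth_abs_derivative[OF assms] by (auto intro!: ext DERIV_imp_deriv)

text \<open>The base point of the entropy flux is \<open>k\<close> itself. Since
  \<open>smooth_abs' 0 = 0\<close>, integration by parts then leaves no boundary term at
  \<open>k\<close>.\<close>

lemma entropy_pair_scaled_smooth_abs:
  assumes c: "c > 0"
  shows "entropy_pair f (\<lambda>s. smooth_abs (c * (s - k)) / c)
    (\<lambda>x u. LINT \<omega>=ereal k..ereal u|lebesgue. (smooth_abs' (c * (\<omega> - k)) *\<^sub>R vector_derivative (f x) (at \<omega>)))"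
  unfolding entropy_pair_def
proof (intro conjI exI[of _ k] allI)
  show "convex_on UNIV (\<lambda>s. smooth_abs (c * (s - k)) / c)"
    by (rule f''_ge0_imp_convex[where f'="\<lambda>s. smooth_abs' (c * (s - k))" and f''="\<lambda>s. c * smooth_abs'' (c * (s - k))"])
       (use c scaled_smooth_abs_derivative[OF c] smooth_abs''_bounds in auto)
  show "C2 (\<lambda>s. smooth_abs (c * (s - k)) / c)"
    unfolding C2_def scaled_smooth_abs_deriv[OF c]
  proof (intro conjI allI)
    show "(\<lambda>s. smooth_abs (c * (s - k)) / c) differentiable at x" "(\<lambda>s. smooth_abs' (c * (s - k))) differentiable at x" for x
      using scaled_smooth_abs_derivative[OF c] real_differentiable_def by blast+
    show "continuous_on UNIV (\<lambda>s. c * smooth_abs'' (c * (s - k)))"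
      by (intro continuous_intros continuous_on_compose2[OF smooth_abs''_continuous]) auto
  qed
qed (simp add: scaled_smooth_abs_deriv[OF c])

text \<open>The second derivative of the entropy, cut off to the states between \<open>k\<close> and
  \<open>u\<close> and signed by their order. For \<open>u\<close> different from \<open>k\<close>
  it tends, as \<open>c\<close> grows, to a point mass at \<open>k\<close> of weight
  \<open>sgn (u - k)\<close>.\<close>

definition jump_kernel :: "real \<Rightarrow> real \<Rightarrow> real \<Rightarrow> real \<Rightarrow> real" where
  "jump_kernel c k u \<omega> = oriented_indicator k u \<omega> * (c * smooth_abs'' (c * (\<omega> - k)))"

lemma oriented_indicator_measurable [measurable]:
  assumes [measurable]: "a \<in> borel_measurable N" "b \<in> borel_measurable N" "w \<in> borel_measurable N"
  shows "(\<lambda>x. oriented_indicator (a x) (b x) (w x)) \<in> borel_measurable N" "(\<lambda>x. jump_kernel c (a x) (b x) (w x)) \<in> borel_measurable N"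
  unfolding jump_kernel_def oriented_indicator_def by measurable

lemma jump_kernel_support:
  assumes "jump_kernel c k u \<omega> \<noteq> 0" "c > 0"
  shows "\<bar>\<omega> - k\<bar> < 1 / c" "\<bar>\<omega>\<bar> \<le> max \<bar>k\<bar> \<bar>u\<bar>"
proof -
  have "smooth_abs'' (c * (\<omega> - k)) \<noteq> 0" "oriented_indicator k u \<omega> \<noteq> 0" using assms(1) by (auto simp: jump_kernel_def)
  then have "\<bar>c * (\<omega> - k)\<bar> < 1" using smooth_abs''_bounds(3) not_le by blast
  then have "c * \<bar>\<omega> - k\<bar> < 1" using assms(2) unfolding abs_mult by simp
  then show "\<bar>\<omega> - k\<bar> < 1 / c" using assms(2) by (simp add: pos_less_divide_eq mult.commute)
  show "\<bar>\<omega>\<bar> \<le> max \<bar>k\<bar> \<bar>u\<bar>" using \<open>oriented_indicator k u \<omega> \<noteq> 0\<close> by (auto simp: oriented_indicator_def split: if_splits)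
qed

lemma jump_kernel_bound: "c > 0 \<Longrightarrow> \<bar>jump_kernel c k u \<omega>\<bar> \<le> 2 * c"
  using smooth_abs''_bounds(1,2)[of "c * (\<omega> - k)"] by (auto simp: jump_kernel_def oriented_indicator_def abs_mult)

lemma jump_kernel_integrable:
  fixes w :: "real \<Rightarrow> 'b::euclidean_space"
  assumes c: "c > 0" and w: "continuous_on UNIV w"
  shows "integrable lborel (\<lambda>\<omega>. jump_kernel c k u \<omega> *\<^sub>R w \<omega>)"
proof -
  let ?m = "max \<bar>k\<bar> \<bar>u\<bar>"
  have [measurable]: "w \<in> borel_measurable borel" using w by (rule borel_measurable_continuous_onI)
  have "bounded (w ` {-?m..?m})"
    by (intro compact_imp_bounded compact_continuous_image continuous_on_subset[OF w]) auto
  then obtain B where "\<forall>x\<in>w ` {-?m..?m}. norm x \<le> B" unfolding bounded_iff by blast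
  then have B: "\<And>\<omega>. \<omega> \<in> {-?m..?m} \<Longrightarrow> norm (w \<omega>) \<le> B" by blast
  have B0: "B \<ge> 0" by (rule order_trans[OF norm_ge_zero B[of k]]) auto
  show ?thesis
  proof (rule integrable_bounded_support[where B="2 * c * B" and r="?m"])
    show "norm (jump_kernel c k u \<omega> *\<^sub>R w \<omega>) \<le> 2 * c * B" for \<omega>
    proof (cases "jump_kernel c k u \<omega> = 0")
      case False
      then have "norm (w \<omega>) \<le> B" using jump_kernel_support(2)[OF False c] by (intro B) (auto simp: abs_le_iff)
      then show ?thesis unfolding norm_scaleR using jump_kernel_bound[OF c, of k u \<omega>] c by (intro mult_mono) auto
    qed (use B0 c in simp)
    show "jump_kernel c k u \<omega> *\<^sub>R w \<omega> = 0" if "norm \<omega> > ?m" for \<omega>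
    proof -
      have "jump_kernel c k u \<omega> = 0"
      proof (rule ccontr)
        assume "jump_kernel c k u \<omega> \<noteq> 0"
        from jump_kernel_support(2)[OF this c] that show False by (auto simp: max_def split: if_splits)
      qed
      then show ?thesis by simp
    qed
  qed measurable
qed

text \<open>Integration by parts applied to the constant function \<open>1\<close>, whose derivative
  contributes nothing.\<close>

lemma jump_kernel_integral:
  assumes c: "c > 0" shows "(\<integral>\<omega>. jump_kernel c k u \<omega> \<partial>lborel) = smooth_abs' (c * (u - k))"
proof -
  have "(LINT \<omega>=ereal k..ereal u|lebesgue. (smooth_abs' (c * (\<omega> - k)) *\<^sub>R vector_derivative (\<lambda>_. 1::real) (at \<omega>)))
     = smooth_abs' (c * (u - k)) *\<^sub>R 1 - smooth_abs' (c * (k - k)) *\<^sub>R 1 - (\<integral>\<omega>. oriented_indicator k u \<omega> *\<^sub>R ((c * smooth_abs'' (c * (\<omega> - k))) *\<^sub>R 1) \<partial>lborel)"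
  proof (rule integration_by_parts_lipschitz)
    show "\<exists>L. L-lipschitz_on {a..b} (\<lambda>_. 1::real)" for a b :: real by (intro exI[of _ 0]) (simp add: lipschitz_on_def)
    show "continuous_on UNIV (\<lambda>\<omega>. c * smooth_abs'' (c * (\<omega> - k)))"
      by (intro continuous_intros continuous_on_compose2[OF smooth_abs''_continuous]) auto
  qed (rule scaled_smooth_abs_derivative[OF c])
  then show ?thesis
    by (cases "k \<le> u") (simp_all add: jump_kernel_def smooth_abs'_values interval_lebesgue_integral_def set_lebesgue_integral_def)
qed

text \<open>The kernel keeps the sign of \<open>u - k\<close>, so no mass is lost by cancellation in
  its integral; the bound \<open>1\<close> does not depend on \<open>c\<close>.\<close>

lemma jump_kernel_abs_integral:
  assumes c: "c > 0" shows "(\<integral>\<omega>. \<bar>jump_kernel c k u \<omega>\<bar> \<partial>lborel) \<le> 1"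
proof -
  have "\<bar>jump_kernel c k u \<omega>\<bar> = sgn (u - k) * jump_kernel c k u \<omega>" for \<omega>
    using smooth_abs''_bounds(1)[of "c * (\<omega> - k)"] c by (auto simp: jump_kernel_def oriented_indicator_def abs_mult)
  then have "(\<integral>\<omega>. \<bar>jump_kernel c k u \<omega>\<bar> \<partial>lborel) = sgn (u - k) * smooth_abs' (c * (u - k))" using jump_kernel_integral[OF c] by simp
  also have "\<dots> \<le> 1" using smooth_abs'_bound[of "c * (u - k)"] by (auto simp: sgn_if)
  finally show ?thesis .
qed

lemma jump_kernel_integral_bound:
  fixes w :: "real \<Rightarrow> 'b::euclidean_space"
  assumes c: "c > 0" and w: "continuous_on UNIV w" and e: "\<And>\<omega>. jump_kernel c k u \<omega> \<noteq> 0 \<Longrightarrow> norm (w \<omega>) \<le> e" and e0: "0 \<le> e"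
  shows "norm (\<integral>\<omega>. jump_kernel c k u \<omega> *\<^sub>R w \<omega> \<partial>lborel) \<le> e"
proof -
  have i1: "integrable lborel (\<lambda>\<omega>. \<bar>jump_kernel c k u \<omega>\<bar>)" using jump_kernel_integrable[OF c, of "\<lambda>_. 1::real" k u] by simp
  have "norm (\<integral>\<omega>. jump_kernel c k u \<omega> *\<^sub>R w \<omega> \<partial>lborel) \<le> (\<integral>\<omega>. norm (jump_kernel c k u \<omega> *\<^sub>R w \<omega>) \<partial>lborel)" by (rule integral_norm_bound)
  also have "\<dots> \<le> (\<integral>\<omega>. \<bar>jump_kernel c k u \<omega>\<bar> * e \<partial>lborel)"
  proof (rule integral_mono)
    show "norm (jump_kernel c k u \<omega> *\<^sub>R w \<omega>) \<le> \<bar>jump_kernel c k u \<omega>\<bar> * e" for \<omega>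
      using e[of \<omega>] by (cases "jump_kernel c k u \<omega> = 0") (auto intro: mult_left_mono)
    show "integrable lborel (\<lambda>\<omega>. norm (jump_kernel c k u \<omega> *\<^sub>R w \<omega>))" by (rule integrable_norm[OF jump_kernel_integrable[OF c w]])
  qed (use i1 in auto)
  also have "\<dots> \<le> 1 * e" using mult_right_mono[OF jump_kernel_abs_integral[OF c, of k u] e0] by simp
  finally show ?thesis by simp
qed

text \<open>The entropy flux after integration by parts, as an operator on functions of the state.
  For \<open>w = f x\<close> it is the entropy flux, for \<open>w = flux_div x\<close> off the null
  set its divergence; it approximates \<open>sgn (u - k) *\<^sub>R (w u - w k)\<close>.\<close>

definition smoothed_jump :: "real \<Rightarrow> real \<Rightarrow> real \<Rightarrow> (real \<Rightarrow> 'b::euclidean_space) \<Rightarrow> 'b" where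
  "smoothed_jump c k u w = smooth_abs' (c * (u - k)) *\<^sub>R w u - (\<integral>\<omega>. jump_kernel c k u \<omega> *\<^sub>R w \<omega> \<partial>lborel)"

lemma smoothed_jump_linear:
  fixes w w' :: "real \<Rightarrow> 'b::euclidean_space"
  assumes c: "c > 0" and w: "continuous_on UNIV w" "continuous_on UNIV w'"
  shows "smoothed_jump c k u (\<lambda>\<omega>. w \<omega> + w' \<omega>) = smoothed_jump c k u w + smoothed_jump c k u w'"
    "smoothed_jump c k u (\<lambda>\<omega>. w \<omega> - w' \<omega>) = smoothed_jump c k u w - smoothed_jump c k u w'"
    "smoothed_jump c k u (\<lambda>\<omega>. r *\<^sub>R w \<omega>) = r *\<^sub>R smoothed_jump c k u w"
    "smoothed_jump c k u (\<lambda>\<omega>. w \<omega> \<bullet> b) = smoothed_jump c k u w \<bullet> b"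
proof -
  note i = jump_kernel_integrable[OF c w(1), of k u] jump_kernel_integrable[OF c w(2), of k u]
  show "smoothed_jump c k u (\<lambda>\<omega>. w \<omega> + w' \<omega>) = smoothed_jump c k u w + smoothed_jump c k u w'"
    using Bochner_Integration.integral_add[OF i] by (simp add: smoothed_jump_def scaleR_add_right)
  show "smoothed_jump c k u (\<lambda>\<omega>. w \<omega> - w' \<omega>) = smoothed_jump c k u w - smoothed_jump c k u w'"
    using Bochner_Integration.integral_diff[OF i] by (simp add: smoothed_jump_def scaleR_diff_right)
  show "smoothed_jump c k u (\<lambda>\<omega>. r *\<^sub>R w \<omega>) = r *\<^sub>R smoothed_jump c k u w"
    using integral_scaleR_right[where c=r and M=lborel and f="\<lambda>\<omega>. jump_kernel c k u \<omega> *\<^sub>R w \<omega>"] by (simp add: smoothed_jump_def scaleR_diff_right mult.commute)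
  show "smoothed_jump c k u (\<lambda>\<omega>. w \<omega> \<bullet> b) = smoothed_jump c k u w \<bullet> b"
    using integral_inner_left[where c=b and M=lborel and f="\<lambda>\<omega>. jump_kernel c k u \<omega> *\<^sub>R w \<omega>"] i(1) by (simp add: smoothed_jump_def inner_diff_left)
qed

lemma smoothed_jump_sum:
  fixes w :: "'i \<Rightarrow> real \<Rightarrow> 'b::euclidean_space"
  assumes c: "c > 0" and w: "\<And>i. i \<in> I \<Longrightarrow> continuous_on UNIV (w i)"
  shows "smoothed_jump c k u (\<lambda>\<omega>. \<Sum>i\<in>I. w i \<omega>) = (\<Sum>i\<in>I. smoothed_jump c k u (w i))"
proof -
  have "(\<integral>\<omega>. (\<Sum>i\<in>I. jump_kernel c k u \<omega> *\<^sub>R w i \<omega>) \<partial>lborel) = (\<Sum>i\<in>I. \<integral>\<omega>. jump_kernel c k u \<omega> *\<^sub>R w i \<omega> \<partial>lborel)"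
    by (rule Bochner_Integration.integral_sum) (intro jump_kernel_integrable c w)
  then show ?thesis by (simp add: smoothed_jump_def scaleR_sum_right sum_subtractf)
qed

lemma smoothed_jump_bound:
  fixes w :: "real \<Rightarrow> 'b::euclidean_space"
  assumes c: "c > 0" and w: "continuous_on UNIV w" and e: "\<And>\<omega>. \<bar>\<omega>\<bar> \<le> max \<bar>k\<bar> \<bar>u\<bar> \<Longrightarrow> norm (w \<omega>) \<le> e"
  shows "norm (smoothed_jump c k u w) \<le> 2 * e"
proof -
  have e0: "e \<ge> 0" by (rule order_trans[OF norm_ge_zero e[of k]]) simp
  have "norm (smooth_abs' (c * (u - k)) *\<^sub>R w u) \<le> 1 * e"
    unfolding norm_scaleR using e[of u] smooth_abs'_bound by (intro mult_mono) auto
  moreover have "norm (\<integral>\<omega>. jump_kernel c k u \<omega> *\<^sub>R w \<omega> \<partial>lborel) \<le> e"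
    by (rule jump_kernel_integral_bound[OF c w _ e0]) (use e jump_kernel_support(2) c in blast)
  ultimately show ?thesis unfolding smoothed_jump_def using norm_triangle_le_diff[of "smooth_abs' (c * (u - k)) *\<^sub>R w u" _ "2 * e"] by auto
qed

lemma smooth_abs'_scaled_sgn:
  assumes c: "c > 0" and n: "1 / c < \<bar>u - k\<bar>"
  shows "smooth_abs' (c * (u - k)) = sgn (u - k)"
proof -
  have "1 < c * \<bar>u - k\<bar>" using n c by (simp add: pos_divide_less_eq mult.commute)
  then have big: "1 \<le> \<bar>c * (u - k)\<bar>" unfolding abs_mult using c by simp
  show ?thesis
  proof (cases "u > k")
    case True
    then have "c * (u - k) \<ge> 1" using big c by (simp add: abs_mult)
    then show ?thesis using True smooth_abs'_values(1) by simp
  next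
    case False
    then have "c * (u - k) \<le> 0" using c by (intro mult_nonneg_nonpos) auto
    then have "c * (u - k) \<le> -1" using big by linarith
    moreover have "sgn (u - k) = -1" using False n c by (auto simp: sgn_if)
    ultimately show ?thesis using smooth_abs'_values(2) by simp
  qed
qed

lemma smooth_abs'_tendsto_sgn: "(\<lambda>n. smooth_abs' (real (Suc n) * (u - k))) \<longlonglongrightarrow> sgn (u - k)"
proof (cases "u = k")
  case False
  have "eventually (\<lambda>n. 1 / real (Suc n) < \<bar>u - k\<bar>) sequentially"
    using order_tendstoD(2)[OF LIMSEQ_inverse_real_of_nat, of "\<bar>u - k\<bar>"] False by (simp add: inverse_eq_divide)
  then have "eventually (\<lambda>n. sgn (u - k) = smooth_abs' (real (Suc n) * (u - k))) sequentially"
    by eventually_elim (simp add: smooth_abs'_scaled_sgn del: of_nat_Suc)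
  from Lim_transform_eventually[OF tendsto_const this] show ?thesis .
qed (simp add: smooth_abs'_values)

lemma smoothed_jump_tendsto:
  fixes w :: "real \<Rightarrow> 'b::euclidean_space"
  assumes w: "continuous_on UNIV w"
  shows "(\<lambda>n. smoothed_jump (real (Suc n)) k u w) \<longlonglongrightarrow> sgn (u - k) *\<^sub>R (w u - w k)"
proof (cases "u = k")
  case True
  have "oriented_indicator k k \<omega> = 0" for \<omega> by (simp add: oriented_indicator_def)
  then have "smoothed_jump (real (Suc n)) k u w = 0" for n using True by (simp add: smoothed_jump_def smooth_abs'_values jump_kernel_def)
  then show ?thesis using True by simp
next
  case False
  show ?thesis
  proof (rule tendstoI)
    fix e :: real assume e: "e > 0"
    have "continuous (at k) w" using w by (simp add: continuous_on_eq_continuous_at)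
    then obtain d where d: "d > 0" "\<And>\<omega>. dist \<omega> k < d \<Longrightarrow> dist (w \<omega>) (w k) < e / 2"
      unfolding continuous_at_eps_delta using e by (meson half_gt_zero)
    \<comment> \<open>Once \<open>1 / c\<close> is below \<open>m\<close>, the half of the tent on
      the side of \<open>u\<close> fits between \<open>k\<close> and \<open>u\<close>, so the kernel
      has its full mass \<open>sgn (u - k)\<close>, and it lives where \<open>w\<close> is within
      \<open>e / 2\<close> of \<open>w k\<close>.\<close>
    define m where "m = min d \<bar>u - k\<bar>"
    have "m > 0" using d False by (simp add: m_def)
    have "eventually (\<lambda>n. 1 / real (Suc n) < m) sequentially"
      using order_tendstoD(2)[OF LIMSEQ_inverse_real_of_nat \<open>m > 0\<close>] by (simp add: inverse_eq_divide)
    then show "eventually (\<lambda>n. dist (smoothed_jump (real (Suc n)) k u w) (sgn (u - k) *\<^sub>R (w u - w k)) < e) sequentially"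
    proof eventually_elim
      case (elim n)
      let ?c = "real (Suc n)"
      have c: "?c > 0" by simp
      have s: "smooth_abs' (?c * (u - k)) = sgn (u - k)" using elim by (intro smooth_abs'_scaled_sgn c) (simp add: m_def)
      have i: "integrable lborel (\<lambda>\<omega>. jump_kernel ?c k u \<omega>)" using jump_kernel_integrable[OF c, of "\<lambda>_. 1::real" k u] by simp
      have "(\<integral>\<omega>. jump_kernel ?c k u \<omega> *\<^sub>R (w \<omega> - w k) \<partial>lborel)
        = (\<integral>\<omega>. jump_kernel ?c k u \<omega> *\<^sub>R w \<omega> \<partial>lborel) - (\<integral>\<omega>. jump_kernel ?c k u \<omega> *\<^sub>R w k \<partial>lborel)"
        unfolding scaleR_diff_right by (rule Bochner_Integration.integral_diff) (intro jump_kernel_integrable c w continuous_intros)+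
      also have "(\<integral>\<omega>. jump_kernel ?c k u \<omega> *\<^sub>R w k \<partial>lborel) = sgn (u - k) *\<^sub>R w k"
        using integral_scaleR_left[where c="w k" and M=lborel and f="jump_kernel ?c k u"] i jump_kernel_integral[OF c, of k u] s by simp
      finally have "smoothed_jump ?c k u w - sgn (u - k) *\<^sub>R (w u - w k) = - (\<integral>\<omega>. jump_kernel ?c k u \<omega> *\<^sub>R (w \<omega> - w k) \<partial>lborel)"
        by (simp add: smoothed_jump_def s scaleR_diff_right del: of_nat_Suc)
      then have "dist (smoothed_jump ?c k u w) (sgn (u - k) *\<^sub>R (w u - w k)) = norm (\<integral>\<omega>. jump_kernel ?c k u \<omega> *\<^sub>R (w \<omega> - w k) \<partial>lborel)"
        by (simp add: dist_norm)
      also have "\<dots> \<le> e / 2"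
      proof (rule jump_kernel_integral_bound[OF c])
        show "norm (w \<omega> - w k) \<le> e / 2" if "jump_kernel ?c k u \<omega> \<noteq> 0" for \<omega>
        proof -
          have "dist \<omega> k < d" using jump_kernel_support(1)[OF that c] elim by (simp add: m_def dist_real_def)
          from d(2)[OF this] show ?thesis by (simp add: dist_norm)
        qed
      qed (use e w in \<open>auto intro!: continuous_intros\<close>)
      finally show ?case using e by simp
    qed
  qed
qed

section \<open>Kruzhkov's inequalities for entropy solutions\<close>

lemma test_fnD:
  assumes "test_fn \<Omega> \<phi> \<phi>'"
  shows "(\<phi> has_derivative (\<lambda>h. \<phi>' z \<bullet> h)) (at z)" "0 \<le> \<phi> z"
  using assms unfolding test_fn_def by blast+

context divergence_flux
begin

definition entropy_flux :: "real \<Rightarrow> real \<Rightarrow> 'a \<Rightarrow> real \<Rightarrow> 'a" where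
  "entropy_flux c k x u = (LINT \<omega>=ereal k..ereal u|lebesgue. (smooth_abs' (c * (\<omega> - k)) *\<^sub>R vector_derivative (f x) (at \<omega>)))"

lemma f_continuous_k: "continuous_on S (f x)"
  using f_continuous_compose[of S "\<lambda>_. x" "\<lambda>k. k"] by (simp add: continuous_on_id)

lemma entropy_flux_eq:
  assumes c: "c > 0" shows "entropy_flux c k x u = smoothed_jump c k u (f x)"
proof -
  have "entropy_flux c k x u = smooth_abs' (c * (u - k)) *\<^sub>R f x u - smooth_abs' (c * (k - k)) *\<^sub>R f x k
      - (\<integral>\<omega>. oriented_indicator k u \<omega> *\<^sub>R ((c * smooth_abs'' (c * (\<omega> - k))) *\<^sub>R f x \<omega>) \<partial>lborel)"
    unfolding entropy_flux_def
  proof (rule integration_by_parts_lipschitz)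
    show "\<exists>L. L-lipschitz_on {a..b} (f x)" for a b using f_lip_k[of "norm x" a b] by blast
    show "continuous_on UNIV (\<lambda>\<omega>. c * smooth_abs'' (c * (\<omega> - k)))"
      by (intro continuous_intros continuous_on_compose2[OF smooth_abs''_continuous]) auto
  qed (rule scaled_smooth_abs_derivative[OF c])
  then show ?thesis by (simp add: smoothed_jump_def jump_kernel_def smooth_abs'_values)
qed

lemma Dx_apply_continuous: "x \<notin> T \<Longrightarrow> continuous_on S (\<lambda>k. Dx f x k h)"
  using continuous_on_subset[OF Dx_continuous] by (intro continuous_intros) auto

text \<open>\<open>smoothed_jump c k u\<close> is linear and bounded by twice the supremum of its
  argument. It can therefore be applied to the first-order expansion of the flux in position, whose
  remainder is small uniformly over a compact range of states.\<close>

lemma divergence_entropy_flux: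
  assumes c: "c > 0" and x: "x \<notin> T"
  shows "divergence (\<lambda>y. entropy_flux c k y u) x = smoothed_jump c k u (flux_div x)"
proof -
  let ?D = "\<lambda>h. smoothed_jump c k u (\<lambda>\<omega>. Dx f x \<omega> h)"
  have lin: "linear ?D"
  proof (rule linearI)
    show "?D (h + h') = ?D h + ?D h'" for h h'
      using smoothed_jump_linear(1)[OF c Dx_apply_continuous[OF x] Dx_apply_continuous[OF x], of k u h h'] by (simp add: blinfun.add_right)
    show "?D (r *\<^sub>R h) = r *\<^sub>R ?D h" for r h
      using smoothed_jump_linear(3)[OF c Dx_apply_continuous[OF x] Dx_apply_continuous[OF x], of k u r h] by (simp add: blinfun.scaleR_right)
  qed
  have "((\<lambda>y. entropy_flux c k y u) has_derivative ?D) (at x)"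
    unfolding has_derivative_at_alt
  proof (intro conjI allI impI)
    show "bounded_linear ?D" using lin linear_conv_bounded_linear by blast
    fix e :: real assume e: "e > 0"
    let ?m = "max \<bar>k\<bar> \<bar>u\<bar>"
    obtain d where d: "d > 0" "\<And>y \<omega>. norm (y - x) < d \<Longrightarrow> \<omega> \<in> {-?m..?m} \<Longrightarrow>
        norm (f y \<omega> - f x \<omega> - Dx f x \<omega> (y - x)) \<le> e / 2 * norm (y - x)"
      using Dx_uniform[OF x compact_Icc[of "-?m" ?m], of "e / 2"] e by auto
    have "norm (entropy_flux c k y u - entropy_flux c k x u - ?D (y - x)) \<le> e * norm (y - x)" if y: "norm (y - x) < d" for y
    proof -
      have "entropy_flux c k y u - entropy_flux c k x u - ?D (y - x) = smoothed_jump c k u (\<lambda>\<omega>. f y \<omega> - f x \<omega> - Dx f x \<omega> (y - x))"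
        using x by (simp add: entropy_flux_eq[OF c] smoothed_jump_linear(2)[OF c] f_continuous_k Dx_apply_continuous continuous_on_diff)
      also have "norm \<dots> \<le> 2 * (e / 2 * norm (y - x))"
        using x by (intro smoothed_jump_bound c continuous_intros f_continuous_k Dx_apply_continuous d(2) y) (auto simp: abs_le_iff)
      finally show ?thesis by simp
    qed
    then show "\<exists>d>0. \<forall>y. norm (y - x) < d \<longrightarrow> norm (entropy_flux c k y u - entropy_flux c k x u - ?D (y - x)) \<le> e * norm (y - x)"
      using d(1) by blast
  qed
  then have "frechet_derivative (\<lambda>y. entropy_flux c k y u) (at x) = ?D" by (rule frechet_derivative_at[symmetric])
  then have "divergence (\<lambda>y. entropy_flux c k y u) x = (\<Sum>b\<in>Basis. smoothed_jump c k u (\<lambda>\<omega>. Dx f x \<omega> b) \<bullet> b)"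
    by (simp only: divergence_def)
  also have "\<dots> = (\<Sum>b\<in>Basis. smoothed_jump c k u (\<lambda>\<omega>. Dx f x \<omega> b \<bullet> b))"
    using smoothed_jump_linear(4)[OF c Dx_apply_continuous[OF x] Dx_apply_continuous[OF x]] by simp
  also have "\<dots> = smoothed_jump c k u (\<lambda>\<omega>. \<Sum>b\<in>Basis. Dx f x \<omega> b \<bullet> b)"
    by (rule smoothed_jump_sum[OF c, symmetric]) (intro continuous_intros Dx_apply_continuous x)
  also have "(\<lambda>\<omega>. \<Sum>b\<in>Basis. Dx f x \<omega> b \<bullet> b) = flux_div x" using flux_div_eq[OF x] by auto
  finally show ?thesis .
qed

lemma smoothed_jump_measurable:
  fixes w :: "'p \<Rightarrow> real \<Rightarrow> 'b::euclidean_space"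
  assumes u[measurable]: "u \<in> borel_measurable N" and w: "(\<lambda>(x, k). w x k) \<in> borel_measurable (N \<Otimes>\<^sub>M borel)"
  shows "(\<lambda>x. smoothed_jump c k (u x) (w x)) \<in> borel_measurable N"
proof -
  have w1: "(\<lambda>x. w x (u x)) \<in> borel_measurable N"
    using measurable_compose[OF measurable_Pair[OF measurable_ident_sets[OF refl] u] w] by simp
  have w2: "(\<lambda>p. w (fst p) (snd p)) \<in> borel_measurable (N \<Otimes>\<^sub>M lborel)"
    using w by (simp add: split_beta' measurable_cong_sets[OF sets_pair_measure_cong[OF refl sets_lborel] refl])
  have "case_prod (\<lambda>x \<omega>. jump_kernel c k (u x) \<omega> *\<^sub>R w x \<omega>) \<in> borel_measurable (N \<Otimes>\<^sub>M lborel)"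
    unfolding case_prod_beta' by (intro borel_measurable_scaleR w2 oriented_indicator_measurable) measurable
  then have "(\<lambda>x. \<integral>\<omega>. jump_kernel c k (u x) \<omega> *\<^sub>R w x \<omega> \<partial>lborel) \<in> borel_measurable N"
    by (rule lborel.borel_measurable_lebesgue_integral)
  then show ?thesis unfolding smoothed_jump_def using w1 by measurable
qed

end

lemma AE_lebesgue_on_iff:
  assumes "S \<in> sets borel"
  shows "(AE z in lebesgue_on S. P z) \<longleftrightarrow> (AE z in lborel. z \<in> S \<longrightarrow> P z)"
  using assms by (subst AE_restrict_space_iff) (auto simp: AE_completion_iff)

lemma test_fn_partial_derivatives:
  fixes \<phi> :: "'a::euclidean_space \<times> real \<Rightarrow> real"
  assumes "(\<phi> has_derivative (\<lambda>h. p \<bullet> h)) (at (x, t))"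
  shows "deriv (\<lambda>s. \<phi> (x, s)) t = snd p" "gradient (\<lambda>y. \<phi> (y, t)) x = fst p"
proof -
  have "((\<lambda>s. (x, s)) has_derivative (\<lambda>h. (0, h))) (at t)" by (auto intro!: derivative_eq_intros)
  from has_derivative_compose[OF this assms]
  have "((\<lambda>s. \<phi> (x, s)) has_derivative (\<lambda>h. snd p * h)) (at t)" by (simp add: inner_prod_def)
  then show "deriv (\<lambda>s. \<phi> (x, s)) t = snd p"
    by (intro DERIV_imp_deriv) (simp add: has_field_derivative_def)
  have "((\<lambda>y. (y, t)) has_derivative (\<lambda>h. (h, 0))) (at x)" by (auto intro!: derivative_eq_intros)
  from has_derivative_compose[OF this assms]
  have "((\<lambda>y. \<phi> (y, t)) has_derivative (\<lambda>h. fst p \<bullet> h)) (at x)" by (simp add: inner_prod_def)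
  then have "frechet_derivative (\<lambda>y. \<phi> (y, t)) (at x) = (\<lambda>h. fst p \<bullet> h)"
    by (rule frechet_derivative_at[symmetric])
  then show "gradient (\<lambda>y. \<phi> (y, t)) x = fst p" by (simp add: gradient_def euclidean_representation)
qed

lemma test_fn_imp_Lip_c:
  assumes "test_fn S \<phi> \<phi>'"
  shows "Lip_c S \<phi>"
proof -
  obtain K r B where K: "compact K" "K \<subseteq> S" "\<And>z. z \<notin> K \<Longrightarrow> \<phi> z = 0 \<and> \<phi>' z = 0"
    and B: "B \<ge> 0" "\<And>z. norm (\<phi>' z) \<le> B" using test_fnE[OF assms] by metis
  have "B-lipschitz_on S \<phi>"
  proof (rule lipschitz_onI)
    fix x y
    have "norm (\<phi> x - \<phi> y) \<le> B * norm (x - y)"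
    proof (rule differentiable_bound[of UNIV \<phi> "\<lambda>z h. \<phi>' z \<bullet> h"])
      show "(\<phi> has_derivative (\<lambda>h. \<phi>' z \<bullet> h)) (at z within UNIV)" for z using test_fnD(1)[OF assms] by simp
      show "onorm (\<lambda>h. \<phi>' z \<bullet> h) \<le> B" for z
      proof (rule onorm_bound[OF B(1)])
        fix h show "norm (\<phi>' z \<bullet> h) \<le> B * norm h"
          using order_trans[OF Cauchy_Schwarz_ineq2 mult_right_mono[OF B(2)[of z] norm_ge_zero[of h]]] by simp
      qed
    qed auto
    then show "dist (\<phi> x) (\<phi> y) \<le> B * dist x y" by (simp add: dist_norm)
  qed (rule B)
  moreover have cl: "closure {z \<in> S. \<phi> z \<noteq> 0} \<subseteq> K"
    using K by (intro closure_minimal compact_imp_closed) auto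
  moreover have "compact (closure {z \<in> S. \<phi> z \<noteq> 0})"
    using compact_Int_closed[OF K(1) closed_closure, of "{z \<in> S. \<phi> z \<noteq> 0}"] cl by (simp only: inf.absorb2)
  ultimately show ?thesis using K(2) unfolding Lip_c_def by blast
qed

context divergence_flux
begin

text \<open>A Borel version of the integrand in the entropy inequality, for a Borel representative
  \<open>u\<close>. It agrees with the original almost everywhere at positive times and vanishes
  where the test function and its gradient do.\<close>

definition entropy_integrand :: "real \<Rightarrow> real \<Rightarrow> ('a \<times> real \<Rightarrow> real) \<Rightarrow> ('a \<times> real \<Rightarrow> real) \<Rightarrow> ('a \<times> real \<Rightarrow> 'a \<times> real) \<Rightarrow> 'a \<times> real \<Rightarrow> real" where
  "entropy_integrand c k u \<phi> \<phi>' z = snd (\<phi>' z) * (smooth_abs (c * (u z - k)) / c)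
     + \<phi> z * (smoothed_jump c k (u z) (flux_div (fst z)) - smooth_abs' (c * (u z - k)) * flux_div (fst z) (u z))
     + fst (\<phi>' z) \<bullet> smoothed_jump c k (u z) (f (fst z))"

lemma fst_compose_measurable:
  assumes "(\<lambda>(x, k). w x k) \<in> borel_measurable (borel \<Otimes>\<^sub>M borel)"
  shows "(\<lambda>(z :: 'a \<times> real, k :: real). w (fst z) k :: 'b::euclidean_space) \<in> borel_measurable (borel \<Otimes>\<^sub>M borel)"
proof -
  have "(\<lambda>x::('a \<times> real) \<times> real. (fst (fst x), snd x)) \<in> borel \<Otimes>\<^sub>M borel \<rightarrow>\<^sub>M borel \<Otimes>\<^sub>M borel"
    unfolding borel_prod by (intro borel_measurable_continuous_onI continuous_intros)
  from measurable_compose[OF this assms] show ?thesis by (simp add: split_beta')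
qed

lemma measurable_curried_compose:
  fixes w :: "'p \<Rightarrow> real \<Rightarrow> 'b::euclidean_space"
  assumes "(\<lambda>(x, k). w x k) \<in> borel_measurable (N \<Otimes>\<^sub>M borel)" "u \<in> borel_measurable N"
  shows "(\<lambda>x. w x (u x)) \<in> borel_measurable N"
  using measurable_compose[OF measurable_Pair[OF measurable_ident_sets[OF refl] assms(2)] assms(1)] by simp

lemma entropy_integrand_measurable:
  assumes [measurable]: "u \<in> borel_measurable borel" "\<phi> \<in> borel_measurable borel" "\<phi>' \<in> borel_measurable borel"
  shows "entropy_integrand c k u \<phi> \<phi>' \<in> borel_measurable borel"
proof -
  have [measurable]: "(\<lambda>z. smoothed_jump c k (u z) (flux_div (fst z))) \<in> borel_measurable borel" "(\<lambda>z. smoothed_jump c k (u z) (f (fst z))) \<in> borel_measurable borel"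
    by (intro smoothed_jump_measurable assms fst_compose_measurable flux_div_measurable f_measurable)+
  have [measurable]: "(\<lambda>z. flux_div (fst z) (u z)) \<in> borel_measurable borel"
    by (rule measurable_curried_compose[OF fst_compose_measurable[OF flux_div_measurable] assms(1)])
  have [measurable]: "(\<lambda>z. fst (\<phi>' z)) \<in> borel_measurable borel" "(\<lambda>z. snd (\<phi>' z)) \<in> borel_measurable borel"
    using measurable_compose[OF assms(3) borel_measurable_continuous_onI[OF continuous_on_fst[OF continuous_on_id]]]
      measurable_compose[OF assms(3) borel_measurable_continuous_onI[OF continuous_on_snd[OF continuous_on_id]]] by auto
  show ?thesis unfolding entropy_integrand_def by measurable
qed

lemma entropy_integrand_integral_nonneg:
  fixes v :: "'a \<times> real \<Rightarrow> real"
  assumes sol: "entropy_solution f {0<..} u0 v" and u: "u \<in> borel_measurable borel"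
    and eq: "AE z in lebesgue_on (UNIV \<times> {0<..}). v z = u z" and t: "test_fn (UNIV \<times> {0<..}) \<phi> \<phi>'" and c: "c > 0"
  shows "0 \<le> (\<integral>z. entropy_integrand c k u \<phi> \<phi>' z \<partial>lborel)"
proof -
  let ?S = "UNIV \<times> {0<..} :: ('a \<times> real) set"
  have S: "?S \<in> sets borel" by (intro borel_open open_Times) auto
  define h where "h = (\<lambda>(x, t). deriv (\<lambda>s. \<phi> (x, s)) t * (smooth_abs (c * (v (x, t) - k)) / c)
          + \<phi> (x, t) * (divergence (\<lambda>y. entropy_flux c k y (v (x, t))) x
                         - smooth_abs' (c * (v (x, t) - k)) * divergence (\<lambda>y. f y (v (x, t))) x)
          + gradient (\<lambda>y. \<phi> (y, t)) x \<bullet> entropy_flux c k x (v (x, t)))"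
  have "entropy_pair f (\<lambda>s. smooth_abs (c * (s - k)) / c) (entropy_flux c k)"
    using entropy_pair_scaled_smooth_abs[OF c, of f k] by (simp add: entropy_flux_def[abs_def])
  note ep = this
  have lip: "Lip_c ?S \<phi>" "\<forall>z\<in>?S. 0 \<le> \<phi> z" using t test_fn_imp_Lip_c test_fnD(2) by blast+
  have "\<forall>\<eta> q \<phi>. entropy_pair f \<eta> q \<longrightarrow> Lip_c ?S \<phi> \<longrightarrow> (\<forall>z\<in>?S. 0 \<le> \<phi> z) \<longrightarrow>
        (LINT (x, t)|lebesgue_on ?S. (deriv (\<lambda>s. \<phi> (x, s)) t * \<eta> (v (x, t))
          + \<phi> (x, t) * (divergence (\<lambda>y. q y (v (x, t))) x
                         - deriv \<eta> (v (x, t)) * divergence (\<lambda>y. f y (v (x, t))) x)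
          + gradient (\<lambda>y. \<phi> (y, t)) x \<bullet> q x (v (x, t)))) \<ge> 0"
    using sol unfolding entropy_solution_def by (elim conjE)
  from this[rule_format, OF ep lip(1)] lip(2) have 0: "0 \<le> (\<integral>z. h z \<partial>lebesgue_on ?S)"
    unfolding h_def scaled_smooth_abs_deriv[OF c] by blast
  note [measurable] = test_fn_measurable[OF t]
  have Hm: "entropy_integrand c k u \<phi> \<phi>' \<in> borel_measurable borel" by (intro entropy_integrand_measurable u) measurable
  have "AE z in lborel. z \<in> ?S \<longrightarrow> entropy_integrand c k u \<phi> \<phi>' z = h z"
    using eq[unfolded AE_lebesgue_on_iff[OF S]] AE_lborel_fst[OF T_null]
  proof eventually_elim
    case (elim z)
    obtain x t where z: "z = (x, t)" by (cases z)
    have d: "(\<phi> has_derivative (\<lambda>h. \<phi>' z \<bullet> h)) (at (x, t))" using test_fnD(1)[OF t, of z] unfolding z .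
    have x: "x \<notin> T" using elim(2) z by simp
    have "divergence (\<lambda>y. f y k) x = flux_div x k" for k using x by (simp add: flux_div_def)
    then show ?case
      using elim(1) by (simp add: z entropy_integrand_def h_def test_fn_partial_derivatives[OF d, unfolded z] divergence_entropy_flux[OF c x] entropy_flux_eq[OF c, where x=x])
  qed
  then have ae: "AE z in lebesgue_on ?S. entropy_integrand c k u \<phi> \<phi>' z = h z" unfolding AE_lebesgue_on_iff[OF S] .
  have Hl: "entropy_integrand c k u \<phi> \<phi>' \<in> borel_measurable (lebesgue_on ?S)"
    using Hm by (intro measurable_restrict_space1 measurable_completion) simp
  \<comment> \<open>\<open>h\<close> contains derivatives that are unspecified on a null set; by
    completeness of Lebesgue measure the almost everywhere equality still makes it
    measurable.\<close>
  have hl: "h \<in> borel_measurable (lebesgue_on ?S)"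
  proof -
    have Sl: "?S \<inter> space lebesgue \<in> sets lebesgue" using S by auto
    have 1: "(\<lambda>z. indicator ?S z *\<^sub>R entropy_integrand c k u \<phi> \<phi>' z) \<in> borel_measurable lebesgue"
      using Hl unfolding borel_measurable_restrict_space_iff[OF Sl] .
    have "AE z in lebesgue. indicator ?S z *\<^sub>R entropy_integrand c k u \<phi> \<phi>' z = indicator ?S z *\<^sub>R h z"
      using \<open>AE z in lborel. z \<in> ?S \<longrightarrow> entropy_integrand c k u \<phi> \<phi>' z = h z\<close> unfolding AE_completion_iff
      by eventually_elim (auto simp: indicator_def)
    from borel_measurable_AE[OF 1 this] show ?thesis unfolding borel_measurable_restrict_space_iff[OF Sl] .
  qed
  have "(\<integral>z. h z \<partial>lebesgue_on ?S) = (\<integral>z. entropy_integrand c k u \<phi> \<phi>' z \<partial>lebesgue_on ?S)"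
    by (rule integral_cong_AE[OF hl Hl]) (use ae in eventually_elim, simp)
  also have "\<dots> = (\<integral>z. indicator ?S z *\<^sub>R entropy_integrand c k u \<phi> \<phi>' z \<partial>lebesgue)"
    by (rule integral_restrict_space) (use S in auto)
  also have "\<dots> = (\<integral>z. entropy_integrand c k u \<phi> \<phi>' z \<partial>lebesgue)"
  proof (rule Bochner_Integration.integral_cong[OF refl])
    fix z
    obtain K where "K \<subseteq> ?S" "\<And>z. z \<notin> K \<Longrightarrow> \<phi> z = 0 \<and> \<phi>' z = 0" using t unfolding test_fn_def by blast
    then show "indicator ?S z *\<^sub>R entropy_integrand c k u \<phi> \<phi>' z = entropy_integrand c k u \<phi> \<phi>' z"
      by (cases "z \<in> K") (auto simp: indicator_def entropy_integrand_def)
  qed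
  also have "\<dots> = (\<integral>z. entropy_integrand c k u \<phi> \<phi>' z \<partial>lborel)"
    using Hm by (intro integral_completion) simp
  finally show ?thesis using 0 by simp
qed

lemma entropy_solution_imp_kruzhkov:
  fixes v :: "'a \<times> real \<Rightarrow> real"
  assumes sol: "entropy_solution f {0<..} u0 v" and u[measurable]: "u \<in> borel_measurable borel"
    and eq: "AE z in lebesgue_on (UNIV \<times> {0<..}). v z = u z" and M: "0 < M" and uM: "\<And>z. u z \<in> {-M..M}"
  shows "kruzhkov (UNIV \<times> {0<..}) st_flux (\<lambda>z. flux_div (fst z)) M u"
  unfolding kruzhkov_def
proof (intro ballI allI impI)
  fix k \<phi> \<phi>' assume k: "k \<in> {-M..M}" and t: "test_fn (UNIV \<times> {0<..}) \<phi> (\<phi>' :: 'a \<times> real \<Rightarrow> 'a \<times> real)"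
  interpret lipschitz_flux st_flux "\<lambda>z. flux_div (fst z)" M using lipschitz_flux_st_flux[OF M] .
  note [measurable] = test_fn_measurable[OF t]
  obtain K r B where K: "compact K" "\<And>z. z \<notin> K \<Longrightarrow> \<phi> z = 0 \<and> \<phi>' z = 0" "\<And>z. z \<in> K \<Longrightarrow> norm z \<le> r"
    and B: "B \<ge> 0" "\<And>z. \<phi> z \<le> B" "\<And>z. norm (\<phi>' z) \<le> B" and r: "r \<ge> 0" using test_fnE[OF t] by metis
  note \<phi>0 = test_fnD(2)[OF t]
  obtain Cf where Cf: "Cf \<ge> 0" "\<And>z k. norm z \<le> r \<Longrightarrow> k \<in> {-M..M} \<Longrightarrow> norm (st_flux z k) \<le> Cf" using F_bound[of r] by blast
  obtain Cd where Cd: "Cd \<ge> 0" "\<And>x k. norm x \<le> r \<Longrightarrow> k \<in> {-M..M} \<Longrightarrow> \<bar>flux_div x k\<bar> \<le> Cd" using flux_div_bound[of r M] by blast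
  have fst_le: "norm (fst z) \<le> norm z" and snd_le: "\<bar>snd z\<bar> \<le> norm z" for z :: "'b::real_normed_vector \<times> real"
    using norm_fst_le[of "fst z" "snd z"] norm_snd_le[of "snd z" "fst z"] by auto
  have mem: "\<omega> \<in> {-M..M}" if "\<bar>\<omega>\<bar> \<le> max \<bar>k\<bar> \<bar>u z\<bar>" for \<omega> z
    using that k uM[of z] by (auto simp: abs_le_iff)
  \<comment> \<open>Bounds for the three terms of \<open>entropy_integrand\<close>:
    \<open>2 * M\<close> is the largest distance of \<open>u z\<close> and \<open>k\<close>, and
    \<open>2 * Cd\<close> and \<open>2 * Cf\<close> come from
    \<open>smoothed_jump_bound\<close>.\<close>
  define W where "W = B * (2 * M) + B * (2 * Cd + 1 * Cd) + B * (2 * Cf)"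
  have W0: "W \<ge> 0" unfolding W_def using B(1) M Cd(1) Cf(1) by (intro add_nonneg_nonneg mult_nonneg_nonneg) auto
  have bound: "\<bar>entropy_integrand (real (Suc n)) k u \<phi> \<phi>' z\<bar> \<le> indicator (cball 0 r) z * W" for n z
  proof (cases "z \<in> K")
    case True
    let ?c = "real (Suc n)"
    have c: "?c > 0" by simp
    have z: "norm z \<le> r" "norm (fst z) \<le> r" using K(3)[OF True] fst_le[of z] by auto
    have 1: "\<bar>snd (\<phi>' z) * (smooth_abs (?c * (u z - k)) / ?c)\<bar> \<le> B * (2 * M)"
      unfolding abs_mult
    proof (rule mult_mono)
      have "\<bar>smooth_abs (?c * (u z - k))\<bar> \<le> ?c * \<bar>u z - k\<bar>" using smooth_abs_bound[of "?c * (u z - k)"] by (simp add: abs_mult)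
      also have "\<dots> \<le> ?c * (2 * M)" using k uM[of z] by (intro mult_left_mono) auto
      finally show "\<bar>smooth_abs (?c * (u z - k)) / ?c\<bar> \<le> 2 * M" by (simp add: abs_divide divide_le_eq mult.commute del: of_nat_Suc)
      show "\<bar>snd (\<phi>' z)\<bar> \<le> B" using snd_le[of "\<phi>' z"] B(3)[of z] by linarith
    qed (use B in auto)
    have 2: "\<bar>\<phi> z * (smoothed_jump ?c k (u z) (flux_div (fst z)) - smooth_abs' (?c * (u z - k)) * flux_div (fst z) (u z))\<bar> \<le> B * (2 * Cd + 1 * Cd)"
      unfolding abs_mult[of "\<phi> z"]
    proof (rule mult_mono)
      have "norm (smoothed_jump ?c k (u z) (flux_div (fst z))) \<le> 2 * Cd"
        using Cd(2)[OF z(2) mem] by (intro smoothed_jump_bound[OF c flux_div_continuous]) simp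
      moreover have "\<bar>smooth_abs' (?c * (u z - k)) * flux_div (fst z) (u z)\<bar> \<le> 1 * Cd"
        unfolding abs_mult using Cd(2)[OF z(2) uM] smooth_abs'_bound by (intro mult_mono) auto
      ultimately show "\<bar>smoothed_jump ?c k (u z) (flux_div (fst z)) - smooth_abs' (?c * (u z - k)) * flux_div (fst z) (u z)\<bar> \<le> 2 * Cd + 1 * Cd"
        by simp
    qed (use B \<phi>0[of z] in auto)
    have 3: "\<bar>fst (\<phi>' z) \<bullet> smoothed_jump ?c k (u z) (f (fst z))\<bar> \<le> B * (2 * Cf)"
    proof -
      have "norm (f (fst z) \<omega>) \<le> Cf" if "\<bar>\<omega>\<bar> \<le> max \<bar>k\<bar> \<bar>u z\<bar>" for \<omega>
        using Cf(2)[OF z(1) mem[OF that]] fst_le[of "st_flux z \<omega>"] by (simp add: st_flux_def)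
      then have "norm (smoothed_jump ?c k (u z) (f (fst z))) \<le> 2 * Cf" by (intro smoothed_jump_bound[OF c f_continuous_k]) simp
      moreover have "norm (fst (\<phi>' z)) \<le> B" using fst_le[of "\<phi>' z"] B(3)[of z] by linarith
      ultimately show ?thesis using B(1) by (intro order_trans[OF Cauchy_Schwarz_ineq2] mult_mono) auto
    qed
    have "\<bar>entropy_integrand ?c k u \<phi> \<phi>' z\<bar> \<le> W" unfolding entropy_integrand_def W_def using 1 2 3 by linarith
    then show ?thesis using z by simp
  next
    case False
    then show ?thesis using K(2)[of z] W0 by (simp add: entropy_integrand_def)
  qed
  have lim: "(\<lambda>n. entropy_integrand (real (Suc n)) k u \<phi> \<phi>' z) \<longlonglongrightarrow> sgn (u z - k) * ((st_flux z (u z) - st_flux z k) \<bullet> \<phi>' z - flux_div (fst z) k * \<phi> z)" for z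
  proof -
    \<comment> \<open>For \<open>u z\<close> different from \<open>k\<close> the tent eventually
      ends before \<open>u z\<close>, and from then on the approximation falls short of the absolute
      value by just a third of \<open>1 / real (Suc n)\<close>.\<close>
    have e: "(\<lambda>n. smooth_abs (real (Suc n) * (u z - k)) / real (Suc n)) \<longlonglongrightarrow> \<bar>u z - k\<bar>"
    proof (cases "u z = k")
      case False
      have "(\<lambda>n. \<bar>u z - k\<bar> - (1/3) * inverse (real (Suc n))) \<longlonglongrightarrow> \<bar>u z - k\<bar> - (1/3) * 0"
        by (intro tendsto_intros LIMSEQ_inverse_real_of_nat)
      then have l: "(\<lambda>n. \<bar>u z - k\<bar> - (1/3) * inverse (real (Suc n))) \<longlonglongrightarrow> \<bar>u z - k\<bar>" by simp
      have "eventually (\<lambda>n. inverse (real (Suc n)) < \<bar>u z - k\<bar>) sequentially"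
        by (rule order_tendstoD(2)[OF LIMSEQ_inverse_real_of_nat]) (use False in simp)
      then have "eventually (\<lambda>n. \<bar>u z - k\<bar> - (1/3) * inverse (real (Suc n)) = smooth_abs (real (Suc n) * (u z - k)) / real (Suc n)) sequentially"
      proof eventually_elim
        case (elim n)
        then have "1 < real (Suc n) * \<bar>u z - k\<bar>" by (simp add: inverse_eq_divide pos_divide_less_eq mult.commute del: of_nat_Suc)
        then have "1 \<le> \<bar>real (Suc n) * (u z - k)\<bar>" unfolding abs_mult by simp
        from smooth_abs_values(1)[OF this] have "smooth_abs (real (Suc n) * (u z - k)) = real (Suc n) * \<bar>u z - k\<bar> - 1/3" unfolding abs_mult by simp
        then show ?case by (simp add: diff_divide_distrib inverse_eq_divide del: of_nat_Suc)
      qed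
      from Lim_transform_eventually[OF l this] show ?thesis .
    qed (simp add: smooth_abs_values)
    note s = smooth_abs'_tendsto_sgn[of "u z" k]
    \<comment> \<open>The two occurrences of \<open>flux_div\<close> at \<open>u z\<close> cancel in
      the limit; \<open>- sgn (u z - k) * flux_div (fst z) k\<close> remains, the zero-order term of
      \<open>kruzhkov\<close>.\<close>
    have "(\<lambda>n. entropy_integrand (real (Suc n)) k u \<phi> \<phi>' z) \<longlonglongrightarrow> snd (\<phi>' z) * \<bar>u z - k\<bar>
       + \<phi> z * (sgn (u z - k) *\<^sub>R (flux_div (fst z) (u z) - flux_div (fst z) k) - sgn (u z - k) * flux_div (fst z) (u z))
       + fst (\<phi>' z) \<bullet> (sgn (u z - k) *\<^sub>R (f (fst z) (u z) - f (fst z) k))"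
      unfolding entropy_integrand_def by (intro tendsto_intros e s smoothed_jump_tendsto flux_div_continuous f_continuous_k)
    also have "\<bar>u z - k\<bar> = sgn (u z - k) * (u z - k)" by (simp add: abs_sgn mult.commute)
    finally show ?thesis by (simp add: st_flux_def inner_prod_def inner_diff_right inner_diff_left algebra_simps inner_commute)
  qed
  have "(\<lambda>n. \<integral>z. entropy_integrand (real (Suc n)) k u \<phi> \<phi>' z \<partial>lborel) \<longlonglongrightarrow> (\<integral>z. sgn (u z - k) * ((st_flux z (u z) - st_flux z k) \<bullet> \<phi>' z - flux_div (fst z) k * \<phi> z) \<partial>lborel)"
  proof (rule integral_dominated_convergence[where w="\<lambda>z. indicator (cball 0 r) z * W"])
    show "integrable lborel (\<lambda>z::'a\<times>real. indicator (cball 0 r) z * W)"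
      by (intro integrable_mult_left integrable_indicator_bounded) auto
    show "entropy_integrand (real (Suc n)) k u \<phi> \<phi>' \<in> borel_measurable lborel" for n
      by (simp add: entropy_integrand_measurable[OF u test_fn_measurable[OF t]])
    show "(\<lambda>z. sgn (u z - k) * ((st_flux z (u z) - st_flux z k) \<bullet> \<phi>' z - flux_div (fst z) k * \<phi> z)) \<in> borel_measurable lborel"
      unfolding measurable_lborel1 by measurable
  qed (use bound lim in auto)
  then show "0 \<le> (\<integral>z. sgn (u z - k) * ((st_flux z (u z) - st_flux z k) \<bullet> \<phi>' z - flux_div (fst z) k * \<phi> z) \<partial>lborel)"
    by (rule LIMSEQ_le_const) (use entropy_integrand_integral_nonneg[OF sol u eq t] in auto)
qed

end

section \<open>Uniqueness in backward cones\<close>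

lemma AE_lborel_slices:
  fixes P :: "'a::euclidean_space \<times> real \<Rightarrow> bool"
  assumes "AE z in lborel. P z"
  shows "AE t in lborel. AE x in lborel. P (x, t)"
proof -
  obtain N where N: "{z \<in> space lborel. \<not> P z} \<subseteq> N" "emeasure lborel N = 0" "N \<in> sets (lborel :: ('a \<times> real) measure)"
    using AE_E[OF assms] by metis
  have Ns: "N \<in> sets (lborel \<Otimes>\<^sub>M lborel)" using N(3) by (simp only: lborel_prod)
  have "(\<integral>\<^sup>+t. emeasure lborel ((\<lambda>x. (x, t)) -` N) \<partial>lborel) = 0"
    using lborel_pair.emeasure_pair_measure_alt2[OF Ns] N(2) by (simp only: lborel_prod)
  then have "AE t in lborel. emeasure lborel ((\<lambda>x. (x, t)) -` N) = 0"
    using lborel_pair.measurable_emeasure_Pair2[OF Ns] by (simp add: nn_integral_0_iff_AE)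
  then show ?thesis
  proof eventually_elim
    case (elim t)
    have "(\<lambda>x. (x, t)) -` N \<in> sets lborel"
      using measurable_sets[OF measurable_Pair2'[of t lborel "lborel :: 'a measure"] Ns] by simp
    then have "(\<lambda>x. (x, t)) -` N \<in> null_sets lborel" using elim by auto
    from AE_not_in[OF this] show ?case by eventually_elim (use N(1) in auto)
  qed
qed

text \<open>A C1 step from \<open>0\<close> to \<open>1\<close> on \<open>{a..2 * a}\<close>. It
  keeps the test function away from time \<open>0\<close>, and its slope of at most
  \<open>4 / a\<close> acts on an interval of length \<open>a\<close>, so its total effect stays
  bounded for small \<open>a\<close>.\<close>

definition ramp :: "real \<Rightarrow> real \<Rightarrow> real" where
  "ramp a t = 1 - (max 0 (1 - (max 0 ((t - a) / a))\<^sup>2))\<^sup>2"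

definition ramp' :: "real \<Rightarrow> real \<Rightarrow> real" where
  "ramp' a t = 2 * max 0 (1 - (max 0 ((t - a) / a))\<^sup>2) * (2 * max 0 ((t - a) / a)) / a"

lemma has_real_derivative_pos_part_square:
  "((\<lambda>s::real. (max 0 s)\<^sup>2) has_real_derivative 2 * max 0 s) (at s)"
  using has_real_derivative_pos_part_power[of 0 s] by (simp add: numeral_2_eq_2)

lemma ramp_derivative: "a > 0 \<Longrightarrow> (ramp a has_real_derivative ramp' a t) (at t)"
proof -
  assume a: "a > 0"
  have "((\<lambda>t. (t - a) / a) has_real_derivative 1 / a) (at t)" using a by (auto intro!: derivative_eq_intros)
  from DERIV_chain2[OF has_real_derivative_pos_part_square this]
  have "((\<lambda>t. 1 - (max 0 ((t - a) / a))\<^sup>2) has_real_derivative 0 - 2 * max 0 ((t - a) / a) * (1 / a)) (at t)"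
    by (intro DERIV_diff DERIV_const)
  from DERIV_chain2[OF has_real_derivative_pos_part_square this]
  have "(ramp a has_real_derivative 0 - 2 * max 0 (1 - (max 0 ((t - a) / a))\<^sup>2) * (0 - 2 * max 0 ((t - a) / a) * (1 / a))) (at t)"
    unfolding ramp_def[abs_def] by (intro DERIV_diff DERIV_const)
  then show ?thesis by (simp add: ramp'_def)
qed

lemma ramp_facts:
  assumes a: "a > 0"
  shows "t \<le> a \<Longrightarrow> ramp a t = 0" "t \<le> a \<Longrightarrow> ramp' a t = 0" "2 * a \<le> t \<Longrightarrow> ramp a t = 1" "2 * a \<le> t \<Longrightarrow> ramp' a t = 0"
    "0 \<le> ramp a t" "ramp a t \<le> 1" "0 \<le> ramp' a t" "ramp' a t \<le> 4 / a"
    "continuous_on UNIV (ramp a)" "continuous_on UNIV (ramp' a)"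
proof -
  define y where "y = max 0 ((t - a) / a)"
  have y0: "y \<ge> 0" by (simp add: y_def)
  have r: "ramp a t = 1 - (max 0 (1 - y\<^sup>2))\<^sup>2" "ramp' a t = 2 * max 0 (1 - y\<^sup>2) * (2 * y) / a"
    by (simp_all add: ramp_def ramp'_def y_def)
  have m: "0 \<le> max 0 (1 - y\<^sup>2)" "max 0 (1 - y\<^sup>2) \<le> 1" by auto
  { assume "t \<le> a"
    then have "y = 0" using a by (simp add: y_def max_def divide_nonpos_pos field_simps)
    then show "ramp a t = 0" "ramp' a t = 0" by (simp_all add: r) }
  { assume "2 * a \<le> t"
    then have "y \<ge> 1" using a by (simp add: y_def le_max_iff_disj field_simps)
    then have "y\<^sup>2 \<ge> 1" by simp
    then have "max 0 (1 - y\<^sup>2) = 0" by simp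
    then show "ramp a t = 1" "ramp' a t = 0" by (simp_all add: r) }
  show "0 \<le> ramp a t" "ramp a t \<le> 1" using m by (simp_all add: r power_le_one)
  show "0 \<le> ramp' a t" using y0 m a by (simp add: r)
  have "max 0 (1 - y\<^sup>2) * y \<le> 1"
  proof (cases "y \<le> 1")
    case True
    then show ?thesis using m y0 by (intro mult_le_one) auto
  next
    case False
    then have "y\<^sup>2 \<ge> 1" by simp
    then show ?thesis by simp
  qed
  then show "ramp' a t \<le> 4 / a" using a by (simp add: r divide_right_mono)
  show "continuous_on UNIV (ramp a)" "continuous_on UNIV (ramp' a)"
    unfolding ramp_def[abs_def] ramp'_def[abs_def] using a by (auto intro!: continuous_intros)
qed

text \<open>Positive inside a backward cone. \<open>sqrt (1 + fst z \<bullet> fst z)\<close> stands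
  in for the norm: it is smooth on the axis, and its gradient is shorter than \<open>1\<close>, so
  the speed estimate loses nothing.\<close>

definition cone_depth :: "real \<Rightarrow> real \<Rightarrow> 'a::euclidean_space \<times> real \<Rightarrow> real" where
  "cone_depth R L z = R - L * snd z - sqrt (1 + fst z \<bullet> fst z)"

definition cone_fn :: "real \<Rightarrow> real \<Rightarrow> real \<Rightarrow> 'a::euclidean_space \<times> real \<Rightarrow> real" where
  "cone_fn a R L z = ramp a (snd z) * (max 0 (cone_depth R L z))\<^sup>2"

definition cone_grad :: "real \<Rightarrow> real \<Rightarrow> real \<Rightarrow> 'a::euclidean_space \<times> real \<Rightarrow> 'a \<times> real" where
  "cone_grad a R L z = (- (ramp a (snd z) * (2 * max 0 (cone_depth R L z)) / sqrt (1 + fst z \<bullet> fst z)) *\<^sub>R fst z,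
     ramp' a (snd z) * (max 0 (cone_depth R L z))\<^sup>2 - ramp a (snd z) * (2 * max 0 (cone_depth R L z)) * L)"

lemma one_plus_inner_pos: "0 < 1 + x \<bullet> (x :: 'a::real_inner)"
  using inner_ge_zero[of x] by linarith

lemma norm_less_sqrt: "norm x < sqrt (1 + x \<bullet> (x :: 'a::real_inner))"
  unfolding norm_eq_sqrt_inner by (intro real_sqrt_less_mono) simp

lemma cone_derivative:
  fixes z :: "'a::euclidean_space \<times> real"
  shows "(cone_depth R L has_derivative (\<lambda>h. - (L * snd h) - (fst z \<bullet> fst h) / sqrt (1 + fst z \<bullet> fst z))) (at z)"
proof -
  have i: "((\<lambda>z :: 'a \<times> real. 1 + fst z \<bullet> fst z) has_derivative (\<lambda>h. 2 * (fst z \<bullet> fst h))) (at z)"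
    by (auto intro!: derivative_eq_intros simp: inner_commute)
  have d: "((\<lambda>z :: 'a \<times> real. sqrt (1 + fst z \<bullet> fst z)) has_derivative (\<lambda>h. (2 * (fst z \<bullet> fst h)) * (inverse (sqrt (1 + fst z \<bullet> fst z)) / 2))) (at z)"
    by (rule DERIV_compose_FDERIV[OF DERIV_real_sqrt[OF one_plus_inner_pos] i])
  have eq: "2 * x * (inverse y / 2) = x / y" for x y :: real by (simp add: field_simps)
  from d have s: "((\<lambda>z :: 'a \<times> real. sqrt (1 + fst z \<bullet> fst z)) has_derivative (\<lambda>h. (fst z \<bullet> fst h) / sqrt (1 + fst z \<bullet> fst z))) (at z)"
    unfolding eq .
  have "((\<lambda>z :: 'a \<times> real. R - L * snd z) has_derivative (\<lambda>h. - (L * snd h))) (at z)"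
    by (auto intro!: derivative_eq_intros)
  from has_derivative_diff[OF this s] show ?thesis unfolding cone_depth_def[abs_def] .
qed

lemma cone_continuous: "continuous_on UNIV (cone_depth R L :: 'a::euclidean_space \<times> real \<Rightarrow> real)"
  unfolding cone_depth_def[abs_def] by (intro continuous_intros)

lemma cone_fn_derivative:
  fixes z :: "'a::euclidean_space \<times> real"
  assumes a: "a > 0"
  shows "(cone_fn a R L has_derivative (\<lambda>h. cone_grad a R L z \<bullet> h)) (at z)"
proof -
  have r: "((\<lambda>z :: 'a \<times> real. ramp a (snd z)) has_derivative (\<lambda>h. snd h * ramp' a (snd z))) (at z)"
    by (rule DERIV_compose_FDERIV[OF ramp_derivative[OF a]]) (auto intro!: derivative_eq_intros)
  have p: "((\<lambda>z :: 'a \<times> real. (max 0 (cone_depth R L z))\<^sup>2) has_derivative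
      (\<lambda>h. (- (L * snd h) - (fst z \<bullet> fst h) / sqrt (1 + fst z \<bullet> fst z)) * (2 * max 0 (cone_depth R L z)))) (at z)"
    by (rule DERIV_compose_FDERIV[OF has_real_derivative_pos_part_square cone_derivative])
  show ?thesis
    unfolding cone_fn_def[abs_def]
    by (rule has_derivative_eq_rhs[OF has_derivative_mult[OF r p]])
       (auto simp: cone_grad_def inner_prod_def algebra_simps)
qed

lemma cone_fn_test_fn:
  assumes a: "a > 0" and L: "L > 0" and R: "R > 0"
  shows "test_fn (UNIV \<times> {0<..}) (cone_fn a R L) (cone_grad a R L :: 'a::euclidean_space \<times> real \<Rightarrow> 'a \<times> real)"
  unfolding test_fn_def
proof (intro conjI allI exI[of _ "cball 0 R \<times> {a..R / L}"] impI)
  show "(cone_fn a R L has_derivative (\<lambda>h. cone_grad a R L z \<bullet> h)) (at z)" for z :: "'a \<times> real"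
    by (rule cone_fn_derivative[OF a])
  have rc: "continuous_on UNIV (\<lambda>z :: 'a \<times> real. ramp a (snd z))" "continuous_on UNIV (\<lambda>z :: 'a \<times> real. ramp' a (snd z))"
    using ramp_facts(9,10)[OF a] by (auto intro!: continuous_on_compose2[of UNIV _ UNIV snd] continuous_intros)
  show "continuous_on UNIV (cone_grad a R L :: 'a \<times> real \<Rightarrow> 'a \<times> real)"
    unfolding cone_grad_def[abs_def]
  proof (intro continuous_intros rc cone_continuous ballI)
    fix z :: "'a \<times> real"
    show "sqrt (1 + fst z \<bullet> fst z) \<noteq> 0" using one_plus_inner_pos[of "fst z"] by simp
  qed
  show "0 \<le> cone_fn a R L z" for z :: "'a \<times> real" using ramp_facts(5)[OF a] by (simp add: cone_fn_def)
  show "compact (cball (0::'a) R \<times> {a..R / L})" by (intro compact_Times) auto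
  show "cball (0::'a) R \<times> {a..R / L} \<subseteq> UNIV \<times> {0<..}" using a by auto
  fix z :: "'a \<times> real" assume z: "z \<notin> cball 0 R \<times> {a..R / L}"
  \<comment> \<open>After time \<open>a\<close>, positive depth forces both
    \<open>norm (fst z) < R\<close> and \<open>L * snd z < R\<close>; earlier times are removed by
    the ramp.\<close>
  have "snd z \<le> a \<or> max 0 (cone_depth R L z) = 0"
  proof (cases "snd z \<le> a")
    case False
    have "cone_depth R L z \<le> 0"
    proof (cases "norm (fst z) \<le> R")
      case True
      then have "R / L < snd z" using z False by (cases z) auto
      then have "R < L * snd z" using L by (simp add: pos_divide_less_eq mult.commute)
      then show ?thesis using one_plus_inner_pos[of "fst z"] real_sqrt_ge_zero[of "1 + fst z \<bullet> fst z"] unfolding cone_depth_def by linarith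
    next
      case far: False
      have "0 \<le> L * snd z" using L False a by simp
      then show ?thesis using norm_less_sqrt[of "fst z"] far unfolding cone_depth_def by linarith
    qed
    then show ?thesis by simp
  qed simp
  then show "cone_fn a R L z = 0" "cone_grad a R L z = 0"
    using ramp_facts(1,2)[OF a] by (auto simp: cone_fn_def cone_grad_def zero_prod_def)
qed

lemma sgn_mult_add: "sgn d * (A + d * X) = sgn d * A + \<bar>d\<bar> * (X :: real)"
  by (auto simp: sgn_if algebra_simps)

context divergence_flux
begin

text \<open>
  The cone moves faster than the maximal speed \<open>N\<close> by at least one; the excess produces the last term.
\<close>

lemma cone_flux_estimate:
  fixes z :: "'a \<times> real"
  assumes a: "a > 0" and L: "L \<ge> N + 1" and N: "N \<ge> 0"
    and lip: "\<And>x. norm x < R \<Longrightarrow> norm (f x k - f x l) \<le> N * \<bar>k - l\<bar>" and z: "0 \<le> snd z"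
  shows "sgn (k - l) * ((st_flux z k - st_flux z l) \<bullet> cone_grad a R L z)
     \<le> \<bar>k - l\<bar> * (ramp' a (snd z) * (max 0 (cone_depth R L z))\<^sup>2) - \<bar>k - l\<bar> * (ramp a (snd z) * (2 * max 0 (cone_depth R L z)))"
proof (cases "cone_depth R L z \<le> 0")
  case True
  then have "max 0 (cone_depth R L z) = 0" by simp
  then show ?thesis by (simp add: cone_grad_def zero_prod_def[symmetric])
next
  case False
  define c where "c = ramp a (snd z) * (2 * max 0 (cone_depth R L z))"
  have c0: "c \<ge> 0" using ramp_facts(5)[OF a] by (simp add: c_def)
  define q where "q = sqrt (1 + fst z \<bullet> fst z)"
  have q: "norm (fst z) < q" "q > 0" using norm_less_sqrt[of "fst z"] one_plus_inner_pos[of "fst z"] by (auto simp: q_def)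
  have "0 \<le> L * snd z" using L N z by simp
  then have "norm (fst z) < R" using False q by (simp add: cone_depth_def q_def)
  then have l: "norm (f (fst z) k - f (fst z) l) \<le> N * \<bar>k - l\<bar>" by (rule lip)
  have "(st_flux z k - st_flux z l) \<bullet> cone_grad a R L z = - (c / q) * ((f (fst z) k - f (fst z) l) \<bullet> fst z)
      + (k - l) * (ramp' a (snd z) * (max 0 (cone_depth R L z))\<^sup>2 - c * L)"
    by (simp add: st_flux_def cone_grad_def c_def q_def inner_prod_def)
  then have "sgn (k - l) * ((st_flux z k - st_flux z l) \<bullet> cone_grad a R L z) = sgn (k - l) * (- (c / q) * ((f (fst z) k - f (fst z) l) \<bullet> fst z))
      + \<bar>k - l\<bar> * (ramp' a (snd z) * (max 0 (cone_depth R L z))\<^sup>2 - c * L)"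
    by (simp only: sgn_mult_add)
  also have "sgn (k - l) * (- (c / q) * ((f (fst z) k - f (fst z) l) \<bullet> fst z)) \<le> \<bar>k - l\<bar> * (c * N)"
  proof -
    have "\<bar>(f (fst z) k - f (fst z) l) \<bullet> fst z\<bar> \<le> (N * \<bar>k - l\<bar>) * q"
      using q l N by (intro order_trans[OF Cauchy_Schwarz_ineq2] mult_mono) auto
    then have "(c / q) * \<bar>(f (fst z) k - f (fst z) l) \<bullet> fst z\<bar> \<le> (c / q) * ((N * \<bar>k - l\<bar>) * q)"
      using c0 q by (intro mult_left_mono) auto
    also have "\<dots> = \<bar>k - l\<bar> * (c * N)" using q by simp
    finally have 1: "(c / q) * \<bar>(f (fst z) k - f (fst z) l) \<bullet> fst z\<bar> \<le> \<bar>k - l\<bar> * (c * N)" .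
    have "\<bar>sgn (k - l)\<bar> * \<bar>- (c / q) * ((f (fst z) k - f (fst z) l) \<bullet> fst z)\<bar> \<le> 1 * ((c / q) * \<bar>(f (fst z) k - f (fst z) l) \<bullet> fst z\<bar>)"
      using c0 q by (intro mult_mono) (auto simp: sgn_if abs_mult)
    with 1 show ?thesis unfolding abs_mult[symmetric] by linarith
  qed
  also have "\<bar>k - l\<bar> * (c * N) + \<bar>k - l\<bar> * (ramp' a (snd z) * (max 0 (cone_depth R L z))\<^sup>2 - c * L)
     = \<bar>k - l\<bar> * (ramp' a (snd z) * (max 0 (cone_depth R L z))\<^sup>2) - \<bar>k - l\<bar> * (c * (L - N))"
    by (simp add: algebra_simps)
  also have "\<dots> \<le> \<bar>k - l\<bar> * (ramp' a (snd z) * (max 0 (cone_depth R L z))\<^sup>2) - \<bar>k - l\<bar> * (c * 1)"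
    using L c0 by (intro diff_left_mono mult_left_mono) auto
  finally show ?thesis by (simp add: c_def)
qed

end

context divergence_flux
begin

text \<open>Tested with \<open>cone_fn\<close>, the comparison inequality bounds the mass of
  \<open>\<bar>u z - v z\<bar>\<close> inside the cone by its mass in the initial layer
  \<open>{a..2 * a}\<close>, which the initial condition makes arbitrarily small. The level
  \<open>b\<close> is fixed before \<open>a\<close> is chosen.\<close>

lemma cone_uniqueness:
  fixes u v :: "'a \<times> real \<Rightarrow> real"
  assumes M: "0 < M" and um[measurable]: "u \<in> borel_measurable borel" and vm[measurable]: "v \<in> borel_measurable borel"
    and uM: "\<And>z. u z \<in> {-M..M}" and vM: "\<And>z. v z \<in> {-M..M}"
    and ku: "kruzhkov (UNIV \<times> {0<..}) st_flux (\<lambda>z. flux_div (fst z)) M u" and kv: "kruzhkov (UNIV \<times> {0<..}) st_flux (\<lambda>z. flux_div (fst z)) M v"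
    and N: "N \<ge> 0" "\<And>x k l. norm x < R \<Longrightarrow> k \<in> {-M..M} \<Longrightarrow> l \<in> {-M..M} \<Longrightarrow> norm (f x k - f x l) \<le> N * \<bar>k - l\<bar>"
    and ic: "\<And>e. e > 0 \<Longrightarrow> \<exists>\<tau>>0. AE t in lborel. 0 < t \<and> t < \<tau> \<longrightarrow>
       (\<integral>x. indicator (ball 0 R) x * \<bar>u (x, t) - v (x, t)\<bar> \<partial>lborel) \<le> e"
    and R: "R > 0" and b: "b > 0"
  shows "AE z in lborel. 2 * b \<le> snd z \<longrightarrow> 0 < cone_depth R (N + 1) z \<longrightarrow> u z = v z"
proof -
  interpret lipschitz_flux st_flux "\<lambda>z. flux_div (fst z)" M using lipschitz_flux_st_flux[OF M] .
  let ?L = "N + 1"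
  have L: "?L > 0" using N(1) by simp
  define c where "c = (\<lambda>z :: 'a \<times> real. max 0 (cone_depth R ?L z))"
  have c0: "c z \<ge> 0" for z by (simp add: c_def)
  have [measurable]: "c \<in> borel_measurable borel"
    unfolding c_def by (intro borel_measurable_continuous_onI continuous_intros cone_continuous)
  have [measurable]: "ramp a \<in> borel_measurable borel" "ramp' a \<in> borel_measurable borel" if "a > 0" for a
    using ramp_facts(9,10)[OF that] by (auto intro: borel_measurable_continuous_onI)
  have [measurable]: "(snd :: 'a \<times> real \<Rightarrow> real) \<in> borel_measurable borel" "(fst :: 'a \<times> real \<Rightarrow> 'a) \<in> borel_measurable borel"
    by (auto intro!: borel_measurable_continuous_onI continuous_intros)
  have cR: "c z \<le> R" if "0 \<le> snd z" for z :: "'a \<times> real"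
  proof -
    have "0 \<le> ?L * snd z" using that L by simp
    moreover have "0 \<le> sqrt (1 + fst z \<bullet> fst z)" by (intro real_sqrt_ge_zero less_imp_le one_plus_inner_pos)
    ultimately have "cone_depth R ?L z \<le> R" unfolding cone_depth_def by linarith
    then show ?thesis using R by (simp add: c_def)
  qed
  have supp: "norm (fst z) < R \<and> norm z \<le> R + R / ?L" if "0 \<le> snd z" "c z \<noteq> 0" for z :: "'a \<times> real"
  proof -
    have p: "0 < cone_depth R ?L z" using that(2) by (auto simp: c_def max_def split: if_splits)
    have "0 \<le> ?L * snd z" using that(1) L by simp
    then have 1: "norm (fst z) < R" using p norm_less_sqrt[of "fst z"] unfolding cone_depth_def by linarith
    have "?L * snd z < R" using p real_sqrt_ge_zero[of "1 + fst z \<bullet> fst z"] one_plus_inner_pos[of "fst z"] unfolding cone_depth_def by linarith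
    then have "snd z \<le> R / ?L" using L by (simp add: pos_le_divide_eq mult.commute)
    then have "norm (fst z) + norm (snd z) \<le> R + R / ?L" using 1 that(1) by simp
    moreover have "norm z \<le> norm (fst z) + norm (snd z)" using norm_Pair_le[of "fst z" "snd z"] by simp
    ultimately show ?thesis using 1 by linarith
  qed
  have dM: "\<bar>u z - v z\<bar> \<le> 2 * M" for z using uM[of z] vM[of z] by auto
  \<comment> \<open>This weight does not involve \<open>a\<close>, so every positive bound obtained
    by a choice of \<open>a\<close> applies to the same integral.\<close>
  define W where "W = (\<lambda>z. \<bar>u z - v z\<bar> * (indicator {2 * b..} (snd z) * (2 * c z)))"
  have W0: "W z \<ge> 0" for z using c0 by (simp add: W_def)
  have Wi: "integrable lborel W"
  proof (rule integrable_bounded_support[where B="2 * M * (1 * (2 * R))" and r="R + R / ?L"])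
    show "W \<in> borel_measurable borel" unfolding W_def by measurable
    show "norm (W z) \<le> 2 * M * (1 * (2 * R))" for z
    proof (cases "2 * b \<le> snd z")
      case True
      then show ?thesis unfolding W_def real_norm_def abs_mult
        using dM[of z] cR[of z] c0[of z] b R M by (intro mult_mono) auto
    qed (use M R in \<open>simp add: W_def\<close>)
    show "W z = 0" if "norm z > R + R / ?L" for z
      using supp[of z] that b by (cases "2 * b \<le> snd z") (auto simp: W_def)
  qed
  have "(\<integral>z. W z \<partial>lborel) \<le> 4 * R\<^sup>2 * e" if e: "e > 0" for e
  proof -
    obtain \<tau> where \<tau>: "\<tau> > 0" "AE t in lborel. 0 < t \<and> t < \<tau> \<longrightarrow>
       (\<integral>x. indicator (ball 0 R) x * \<bar>u (x, t) - v (x, t)\<bar> \<partial>lborel) \<le> e" using ic[OF e] by blast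
    \<comment> \<open>\<open>a \<le> b\<close> makes the ramp equal to \<open>1\<close> from time
      \<open>2 * b\<close> on, and \<open>3 * a \<le> \<tau>\<close> keeps the layer
      \<open>{a..2 * a}\<close> inside the time range of the initial condition.\<close>
    define a where "a = min b (\<tau> / 3)"
    have a: "a > 0" "a \<le> b" "2 * a < \<tau>" using b \<tau>(1) by (auto simp: a_def)
    note [measurable] = this(1)
    define X where "X = (\<lambda>z. \<bar>u z - v z\<bar> * (ramp' a (snd z) * (c z)\<^sup>2))"
    define Y where "Y = (\<lambda>z. \<bar>u z - v z\<bar> * (ramp a (snd z) * (2 * c z)))"
    have Xi: "integrable lborel X"
    proof (rule integrable_bounded_support[where B="2 * M * (4 / a * R\<^sup>2)" and r="R + R / ?L"])
      show "X \<in> borel_measurable borel" unfolding X_def using a(1) by measurable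
      show "norm (X z) \<le> 2 * M * (4 / a * R\<^sup>2)" for z
      proof (cases "snd z \<le> a")
        case False
        then show ?thesis unfolding X_def real_norm_def abs_mult
          using dM[of z] cR[of z] c0[of z] a R M ramp_facts(7,8)[OF a(1), of "snd z"]
          by (intro mult_mono) (auto simp: power_mono)
      qed (use M a ramp_facts(2)[OF a(1)] in \<open>simp add: X_def\<close>)
      show "X z = 0" if "norm z > R + R / ?L" for z
        using supp[of z] that a ramp_facts(2)[OF a(1), of "snd z"] by (cases "snd z \<le> a") (auto simp: X_def)
    qed
    have Yi: "integrable lborel Y"
    proof (rule integrable_bounded_support[where B="2 * M * (1 * (2 * R))" and r="R + R / ?L"])
      show "Y \<in> borel_measurable borel" unfolding Y_def using a(1) by measurable
      show "norm (Y z) \<le> 2 * M * (1 * (2 * R))" for z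
      proof (cases "snd z \<le> a")
        case False
        then show ?thesis unfolding Y_def real_norm_def abs_mult
          using dM[of z] cR[of z] c0[of z] a R M ramp_facts(5,6)[OF a(1), of "snd z"] by (intro mult_mono) auto
      qed (use M R ramp_facts(1)[OF a(1)] in \<open>simp add: Y_def\<close>)
      show "Y z = 0" if "norm z > R + R / ?L" for z
        using supp[of z] that a ramp_facts(1)[OF a(1), of "snd z"] by (cases "snd z \<le> a") (auto simp: Y_def)
    qed
    have test: "test_fn (UNIV \<times> {0<..}) (cone_fn a R ?L) (cone_grad a R ?L :: 'a \<times> real \<Rightarrow> 'a \<times> real)"
      by (rule cone_fn_test_fn[OF a(1) L R])
    interpret two_solutions st_flux "\<lambda>z. flux_div (fst z)" M u v "UNIV \<times> {0<..}" "cone_fn a R ?L" "cone_grad a R ?L"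
      by unfold_locales (use um vm uM vM ku kv test in \<open>auto intro: open_Times\<close>)
    define I where "I = (\<lambda>z. sgn (u z - v z) * ((st_flux z (u z) - st_flux z (v z)) \<bullet> cone_grad a R ?L z))"
    have Ii: "integrable lborel I"
    proof -
      obtain K r B where K: "\<And>z. z \<notin> K \<Longrightarrow> cone_fn a R ?L z = 0 \<and> cone_grad a R ?L (z :: 'a \<times> real) = 0" "\<And>z. z \<in> K \<Longrightarrow> norm z \<le> r"
        and B: "B \<ge> 0" "\<And>z. norm (cone_grad a R ?L (z :: 'a \<times> real)) \<le> B" using test_fnE[OF test] by metis
      obtain CF where CF: "CF \<ge> 0" "\<And>z k. norm z \<le> r \<Longrightarrow> k \<in> {-M..M} \<Longrightarrow> norm (st_flux z k) \<le> CF" using F_bound[of r] by blast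
      show ?thesis
      proof (rule integrable_bounded_support[where B="1 * ((CF + CF) * B)" and r=r])
        show "I \<in> borel_measurable borel" unfolding I_def by measurable
        show "norm (I z) \<le> 1 * ((CF + CF) * B)" for z
        proof (cases "z \<in> K")
          case True
          have "\<bar>(st_flux z (u z) - st_flux z (v z)) \<bullet> cone_grad a R ?L z\<bar> \<le> (CF + CF) * B"
            using CF(1) B K(2)[OF True]
            by (intro order_trans[OF Cauchy_Schwarz_ineq2] mult_mono norm_triangle_le_diff add_mono CF(2) uM vM) auto
          then show ?thesis unfolding I_def real_norm_def abs_mult using CF(1) B(1) by (intro mult_mono) (auto simp: sgn_if)
        qed (use K(1) CF(1) B(1) in \<open>simp add: I_def\<close>)
        show "I z = 0" if "norm z > r" for z
        proof -
          have "z \<notin> K" using K(2)[of z] that by auto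
          then show ?thesis using K(1) by (simp add: I_def)
        qed
      qed
    qed
    have IXY: "I z \<le> X z - Y z" for z
    proof (cases "0 \<le> snd z")
      case True
      show ?thesis unfolding I_def X_def Y_def c_def
        by (rule cone_flux_estimate[OF a(1) order_refl N(1)]) (use True N(2) uM vM in auto)
    next
      case False
      then have "snd z \<le> a" using a(1) by simp
      then show ?thesis using ramp_facts(1,2)[OF a(1), of "snd z"] by (simp add: I_def X_def Y_def cone_grad_def zero_prod_def[symmetric])
    qed
    have "0 \<le> (\<integral>z. I z \<partial>lborel)" using comparison_inequality by (simp add: I_def)
    also have "\<dots> \<le> (\<integral>z. X z - Y z \<partial>lborel)" using Ii Xi Yi IXY by (intro integral_mono) auto
    also have "\<dots> = (\<integral>z. X z \<partial>lborel) - (\<integral>z. Y z \<partial>lborel)" using Xi Yi by simp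
    finally have YX: "(\<integral>z. Y z \<partial>lborel) \<le> (\<integral>z. X z \<partial>lborel)" by simp
    have "W z \<le> Y z" for z
    proof (cases "2 * b \<le> snd z")
      case True
      then have "ramp a (snd z) = 1" using a by (intro ramp_facts(3)) auto
      then show ?thesis using True by (simp add: W_def Y_def)
    qed (use c0[of z] ramp_facts(5)[OF a(1), of "snd z"] in \<open>simp add: W_def Y_def\<close>)
    then have "(\<integral>z. W z \<partial>lborel) \<le> (\<integral>z. Y z \<partial>lborel)" using Wi Yi by (intro integral_mono) auto
    also note YX
    also have "(\<integral>z. X z \<partial>lborel) \<le> 4 * R\<^sup>2 * e"
    proof -
      \<comment> \<open>Bounding \<open>ramp'\<close> by \<open>4 / a\<close> and the depth by
        \<open>R\<close> separates time from space. Integration in time gives the length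
        \<open>a\<close> of the layer, which cancels \<open>1 / a\<close> and leaves
        \<open>4 * R\<^sup>2 * e\<close>.\<close>
      define Z where "Z = (\<lambda>z. indicator (ball 0 R) (fst z) * \<bar>u z - v z\<bar> * (indicator {a..2*a} (snd z) * (4 / a * R\<^sup>2)))"
      have XZ: "X z \<le> Z z" for z
      proof (cases "a < snd z \<and> snd z < 2 * a \<and> c z \<noteq> 0")
        case True
        then have s: "0 \<le> snd z" using a by simp
        have "ramp' a (snd z) * (c z)\<^sup>2 \<le> 4 / a * R\<^sup>2"
          using ramp_facts(7,8)[OF a(1), of "snd z"] cR[OF s] c0[of z] a(1) by (intro mult_mono power_mono) auto
        then have "\<bar>u z - v z\<bar> * (ramp' a (snd z) * (c z)\<^sup>2) \<le> \<bar>u z - v z\<bar> * (4 / a * R\<^sup>2)" by (intro mult_left_mono) auto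
        then show ?thesis using supp[OF s] True by (simp add: X_def Z_def)
      next
        case False
        have "X z = 0" using False ramp_facts(2,4)[OF a(1), of "snd z"] by (auto simp: X_def not_less)
        then show ?thesis using a by (simp add: Z_def)
      qed
      have Zm: "Z \<in> borel_measurable borel" unfolding Z_def by measurable
      have Zi: "integrable lborel Z"
      proof (rule integrable_bounded_support[where B="1 * (2 * M) * (1 * (4 / a * R\<^sup>2))" and r="R + 2 * a"])
        show "norm (Z z) \<le> 1 * (2 * M) * (1 * (4 / a * R\<^sup>2))" for z
          unfolding Z_def real_norm_def abs_mult using dM[of z] M a by (intro mult_mono) (auto simp: indicator_def)
        show "Z z = 0" if "norm z > R + 2 * a" for z
        proof -
          have "norm z \<le> norm (fst z) + norm (snd z)" using norm_Pair_le[of "fst z" "snd z"] by simp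
          then show ?thesis using that by (auto simp: Z_def indicator_def)
        qed
      qed (rule Zm)
      have Zi': "integrable (lborel \<Otimes>\<^sub>M lborel) (case_prod (\<lambda>x t. Z (x, t)))" using Zi by (simp add: lborel_prod)
      have "(\<integral>z. X z \<partial>lborel) \<le> (\<integral>z. Z z \<partial>lborel)" using Xi Zi XZ by (intro integral_mono) auto
      also have "\<dots> = (\<integral>t. (\<integral>x. Z (x, t) \<partial>lborel) \<partial>lborel)"
        using lborel_pair.integral_snd[OF Zi'] by (simp add: lborel_prod)
      also have "\<dots> \<le> (\<integral>t. indicator {a..2*a} t * (4 / a * R\<^sup>2 * e) \<partial>lborel)"
      proof (rule integral_mono_AE)
        show "integrable lborel (\<lambda>t. \<integral>x. Z (x, t) \<partial>lborel)" by (rule lborel_pair.integrable_snd[OF Zi'])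
        show "integrable lborel (\<lambda>t. indicator {a..2*a} t * (4 / a * R\<^sup>2 * e))"
          by (intro integrable_mult_left integrable_indicator_bounded) auto
        show "AE t in lborel. (\<integral>x. Z (x, t) \<partial>lborel) \<le> indicator {a..2*a} t * (4 / a * R\<^sup>2 * e)"
          using \<tau>(2)
        proof eventually_elim
          case (elim t)
          have "(\<integral>x. Z (x, t) \<partial>lborel) = (\<integral>x. indicator (ball 0 R) x * \<bar>u (x, t) - v (x, t)\<bar> \<partial>lborel) * (indicator {a..2*a} t * (4 / a * R\<^sup>2))"
            unfolding Z_def by simp
          also have "\<dots> \<le> indicator {a..2*a} t * (4 / a * R\<^sup>2 * e)"
          proof (cases "t \<in> {a..2*a}")
            case True
            then have "(\<integral>x. indicator (ball 0 R) x * \<bar>u (x, t) - v (x, t)\<bar> \<partial>lborel) \<le> e" using elim a by auto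
            then have "(\<integral>x. indicator (ball 0 R) x * \<bar>u (x, t) - v (x, t)\<bar> \<partial>lborel) * (4 / a * R\<^sup>2) \<le> e * (4 / a * R\<^sup>2)"
              using a by (intro mult_right_mono) auto
            then show ?thesis using True by (simp add: mult_ac)
          qed simp
          finally show ?case .
        qed
      qed
      also have "\<dots> = a * (4 / a * R\<^sup>2 * e)" using a(1) by simp
      also have "\<dots> = 4 * R\<^sup>2 * e" using a(1) by simp
      finally show ?thesis .
    qed
    finally show ?thesis .
  qed
  note small = this
  have "(\<integral>z. W z \<partial>lborel) \<le> 0"
  proof (rule field_le_epsilon)
    fix e :: real assume "e > 0"
    then show "(\<integral>z. W z \<partial>lborel) \<le> 0 + e" using small[of "e / (4 * R\<^sup>2)"] R by simp
  qed
  moreover have "0 \<le> (\<integral>z. W z \<partial>lborel)" using W0 by simp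
  ultimately have "(\<integral>z. W z \<partial>lborel) = 0" by simp
  then have "AE z in lborel. W z = 0" using integral_nonneg_eq_0_iff_AE[OF Wi] W0 by simp
  then show ?thesis
  proof eventually_elim
    case (elim z)
    then show ?case by (auto simp: W_def c_def max_def)
  qed
qed

end

section \<open>Borel representatives and the initial condition\<close>

lemma AE_abs_le_Linf_norm:
  assumes "Linf S u"
  shows "AE z in lebesgue_on S. \<bar>u z\<bar> \<le> Linf_norm S u"
proof -
  obtain C where C: "AE z in lebesgue_on S. \<bar>u z\<bar> \<le> C" and [measurable]: "u \<in> borel_measurable (lebesgue_on S)"
    using assms unfolding Linf_def by blast
  let ?e = "esssup (lebesgue_on S) (\<lambda>z. ereal \<bar>u z\<bar>)"
  have "?e \<le> ereal C"
  proof (rule esssup_I)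
    show "AE z in lebesgue_on S. ereal \<bar>u z\<bar> \<le> ereal C" using C by eventually_elim simp
  qed measurable
  \<comment> \<open>\<open>real_of_ereal\<close> maps \<infinity> to \<open>0\<close>; the essential
    bound \<open>C\<close> excludes this case.\<close>
  then have fin: "?e \<noteq> \<infinity>" by auto
  have "AE z in lebesgue_on S. ereal \<bar>u z\<bar> \<le> ?e" by (rule esssup_AE)
  then show ?thesis
  proof eventually_elim
    case (elim z)
    then show ?case using fin unfolding Linf_norm_def by (cases ?e) auto
  qed
qed

text \<open>Clipping puts the values in \<open>{-M..M}\<close> everywhere and not just almost
  everywhere, so that every value of one solution is an admissible constant \<open>k\<close> for the
  other.\<close>

lemma Linf_borel_representative:
  fixes u :: "'b::euclidean_space \<Rightarrow> real"
  assumes S: "S \<in> sets borel" and u: "Linf S u" and M: "Linf_norm S u \<le> M" "0 \<le> M"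
  obtains w where "w \<in> borel_measurable borel" "\<And>z. w z \<in> {-M..M}" "AE z in lebesgue_on S. u z = w z"
proof -
  have Sl: "S \<inter> space lebesgue \<in> sets lebesgue" using S by auto
  have "(\<lambda>z. indicator S z *\<^sub>R u z) \<in> borel_measurable lebesgue"
    using u unfolding Linf_def borel_measurable_restrict_space_iff[OF Sl] by blast
  then obtain w0 where w0: "w0 \<in> borel_measurable lborel" "AE z in lborel. indicator S z *\<^sub>R u z = w0 z"
    using completion_ex_borel_measurable_real by blast
  have bound: "AE z in lebesgue_on S. \<bar>u z\<bar> \<le> M"
    using AE_abs_le_Linf_norm[OF u] by eventually_elim (use M in linarith)
  show ?thesis
  proof (rule that[of "\<lambda>z. max (- M) (min M (w0 z))"])
    show "(\<lambda>z. max (- M) (min M (w0 z))) \<in> borel_measurable borel" using w0(1) by simp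
    show "max (- M) (min M (w0 z)) \<in> {-M..M}" for z using M(2) by auto
    show "AE z in lebesgue_on S. u z = max (- M) (min M (w0 z))"
      using bound w0(2) unfolding AE_lebesgue_on_iff[OF S]
      by eventually_elim (auto simp: indicator_def abs_le_iff)
  qed
qed

lemma initial_trace:
  fixes u :: "'a::euclidean_space \<times> real \<Rightarrow> real"
  assumes sol: "entropy_solution f {0<..} u0 u" and e: "e > 0" and R: "R > 0"
  shows "\<exists>\<tau>>0. AE t in lborel. 0 < t \<and> t < \<tau> \<longrightarrow>
     integrable (lebesgue_on (ball 0 R)) (\<lambda>x. u (x, t) - u0 x) \<and>
     (LINT x|lebesgue_on (ball 0 R). \<bar>u (x, t) - u0 x\<bar>) < e"
proof -
  obtain \<Psi> where \<Psi>: "\<Psi> \<in> null_sets lebesgue"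
    and i: "\<forall>t\<in>{0<..} - \<Psi>. integrable (lebesgue_on (ball 0 R)) (\<lambda>x. u (x, t) - u0 x)"
    and l: "((\<lambda>t. LINT x|lebesgue_on (ball 0 R). \<bar>u (x, t) - u0 x\<bar>) \<longlongrightarrow> 0) (at 0 within ({0<..} \<inter> ({0<..} - \<Psi>)))"
    using sol R unfolding entropy_solution_def by blast
  obtain \<tau> where \<tau>: "\<tau> > 0" "\<And>t. t \<in> {0<..} \<inter> ({0<..} - \<Psi>) \<Longrightarrow> t \<noteq> 0 \<Longrightarrow> dist t 0 < \<tau> \<Longrightarrow>
      (LINT x|lebesgue_on (ball 0 R). \<bar>u (x, t) - u0 x\<bar>) < e"
    using order_tendstoD(2)[OF l e] unfolding eventually_at by blast
  have "AE t in lborel. t \<notin> \<Psi>"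
    using AE_not_in[OF \<Psi>] by (simp add: AE_completion_iff)
  then have "AE t in lborel. 0 < t \<and> t < \<tau> \<longrightarrow>
     integrable (lebesgue_on (ball 0 R)) (\<lambda>x. u (x, t) - u0 x) \<and>
     (LINT x|lebesgue_on (ball 0 R). \<bar>u (x, t) - u0 x\<bar>) < e"
    by eventually_elim (use i \<tau>(2) in auto)
  then show ?thesis using \<tau>(1) by blast
qed

text \<open>Triangle inequality through the common initial data. By Fubini, solutions and Borel
  representatives agree on almost every time slice, which is why the bound is claimed for almost
  every \<open>t\<close>.\<close>

lemma initial_difference:
  fixes u v :: "'a::euclidean_space \<times> real \<Rightarrow> real"
  assumes su: "entropy_solution f {0<..} u0 u" and sv: "entropy_solution f {0<..} u0 v"
    and um[measurable]: "u1 \<in> borel_measurable borel" and vm[measurable]: "v1 \<in> borel_measurable borel"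
    and eu: "AE z in lebesgue_on (UNIV \<times> {0<..}). u z = u1 z" and ev: "AE z in lebesgue_on (UNIV \<times> {0<..}). v z = v1 z"
    and R: "R > 0" and e: "e > 0"
  shows "\<exists>\<tau>>0. AE t in lborel. 0 < t \<and> t < \<tau> \<longrightarrow>
       (\<integral>x. indicator (ball 0 R) x * \<bar>u1 (x, t) - v1 (x, t)\<bar> \<partial>lborel) \<le> e"
proof -
  have e2: "e / 2 > 0" using e by simp
  have S: "UNIV \<times> {0<..} \<in> sets (borel :: ('a \<times> real) measure)" by (intro borel_open open_Times) auto
  let ?B = "lebesgue_on (ball (0::'a) R)"
  obtain \<tau>1 where 1: "\<tau>1 > 0" "AE t in lborel. 0 < t \<and> t < \<tau>1 \<longrightarrow>
     integrable ?B (\<lambda>x. u (x, t) - u0 x) \<and> (LINT x|?B. \<bar>u (x, t) - u0 x\<bar>) < e / 2"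
    using initial_trace[OF su e2 R] by blast
  obtain \<tau>2 where 2: "\<tau>2 > 0" "AE t in lborel. 0 < t \<and> t < \<tau>2 \<longrightarrow>
     integrable ?B (\<lambda>x. v (x, t) - u0 x) \<and> (LINT x|?B. \<bar>v (x, t) - u0 x\<bar>) < e / 2"
    using initial_trace[OF sv e2 R] by blast
  have "AE z in lborel. 0 < snd z \<longrightarrow> u z = u1 z \<and> v z = v1 z"
    using eu ev unfolding AE_lebesgue_on_iff[OF S] by eventually_elim auto
  from AE_lborel_slices[OF this]
  have sl: "AE t in lborel. AE x in lborel. 0 < t \<longrightarrow> u (x, t) = u1 (x, t) \<and> v (x, t) = v1 (x, t)" by simp
  have "AE t in lborel. 0 < t \<and> t < min \<tau>1 \<tau>2 \<longrightarrow>
       (\<integral>x. indicator (ball 0 R) x * \<bar>u1 (x, t) - v1 (x, t)\<bar> \<partial>lborel) \<le> e"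
    using 1(2) 2(2) sl
  proof eventually_elim
    case (elim t)
    show ?case
    proof
      assume t: "0 < t \<and> t < min \<tau>1 \<tau>2"
      then have iu: "integrable ?B (\<lambda>x. u (x, t) - u0 x)" and lu: "(LINT x|?B. \<bar>u (x, t) - u0 x\<bar>) < e / 2"
        and iv: "integrable ?B (\<lambda>x. v (x, t) - u0 x)" and lv: "(LINT x|?B. \<bar>v (x, t) - u0 x\<bar>) < e / 2"
        using elim by auto
      have [measurable]: "(\<lambda>x. (x, t)) \<in> borel \<rightarrow>\<^sub>M borel" by (intro borel_measurable_continuous_onI continuous_intros)
      have m: "(\<lambda>x. \<bar>u1 (x, t) - v1 (x, t)\<bar>) \<in> borel_measurable borel" by measurable
      have mB: "(\<lambda>x. \<bar>u1 (x, t) - v1 (x, t)\<bar>) \<in> borel_measurable ?B"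
        using m by (intro measurable_restrict_space1 measurable_completion) simp
      have id: "integrable ?B (\<lambda>x. \<bar>u (x, t) - v (x, t)\<bar>)"
        using integrable_abs[OF Bochner_Integration.integrable_diff[OF iu iv]] by simp
      have "(\<integral>x. indicator (ball 0 R) x * \<bar>u1 (x, t) - v1 (x, t)\<bar> \<partial>lborel)
          = (\<integral>x. indicator (ball 0 R) x *\<^sub>R \<bar>u1 (x, t) - v1 (x, t)\<bar> \<partial>lebesgue)"
        using m by (subst integral_completion) auto
      also have "\<dots> = (LINT x|?B. \<bar>u1 (x, t) - v1 (x, t)\<bar>)"
        by (rule integral_restrict_space[symmetric]) auto
      also have "\<dots> = (LINT x|?B. \<bar>u (x, t) - v (x, t)\<bar>)"
      proof (rule integral_cong_AE[OF mB borel_measurable_integrable[OF id]])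
        show "AE x in ?B. \<bar>u1 (x, t) - v1 (x, t)\<bar> = \<bar>u (x, t) - v (x, t)\<bar>"
          using elim(3) t by (subst AE_lebesgue_on_iff) auto
      qed
      also have "\<dots> \<le> (LINT x|?B. \<bar>u (x, t) - u0 x\<bar> + \<bar>v (x, t) - u0 x\<bar>)"
        using id iu iv by (intro integral_mono) (auto intro!: Bochner_Integration.integrable_add integrable_abs)
      also have "\<dots> = (LINT x|?B. \<bar>u (x, t) - u0 x\<bar>) + (LINT x|?B. \<bar>v (x, t) - u0 x\<bar>)"
        using iu iv by (intro Bochner_Integration.integral_add integrable_abs)
      also have "\<dots> \<le> e" using lu lv by linarith
      finally show "(\<integral>x. indicator (ball 0 R) x * \<bar>u1 (x, t) - v1 (x, t)\<bar> \<partial>lborel) \<le> e" .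
    qed
  qed
  then show ?thesis using 1(1) 2(1) by (intro exI[of _ "min \<tau>1 \<tau>2"]) auto
qed

context divergence_flux
begin

lemma N_flux_bound:
  assumes M: "0 < M"
  shows "norm x < R \<Longrightarrow> k \<in> {-M..M} \<Longrightarrow> l \<in> {-M..M} \<Longrightarrow> norm (f x k - f x l) \<le> N_flux f M R * \<bar>k - l\<bar>"
    "0 < R \<Longrightarrow> 0 \<le> N_flux f M R"
proof -
  let ?Q = "{norm (f x k - f x k') / \<bar>k - k'\<bar> | x k k'. x \<in> ball 0 R \<and> k \<in> {-M..M} \<and> k' \<in> {-M..M} \<and> k \<noteq> k'}"
  have N: "N_flux f M R = Sup ?Q" using M by (simp add: N_flux_def)
  obtain L where L: "\<And>x. norm x \<le> R \<Longrightarrow> L-lipschitz_on {-M..M} (f x)" using f_lip_k by blast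
  \<comment> \<open>\<open>Sup\<close> is meaningful only for a set bounded above; a common
    Lipschitz constant in \<open>k\<close> over the ball provides the bound.\<close>
  have bdd: "bdd_above ?Q"
  proof (rule bdd_aboveI[of _ L])
    fix q assume "q \<in> ?Q"
    then obtain x k l where q: "q = norm (f x k - f x l) / \<bar>k - l\<bar>" "norm x < R" "k \<in> {-M..M}" "l \<in> {-M..M}" "k \<noteq> l" by auto
    then show "q \<le> L" using lipschitz_onD[OF L[of x], of k l] by (simp add: dist_norm divide_le_eq)
  qed
  show "norm (f x k - f x l) \<le> N_flux f M R * \<bar>k - l\<bar>" if "norm x < R" "k \<in> {-M..M}" "l \<in> {-M..M}" for x k l
  proof (cases "k = l")
    case False
    have "norm (f x k - f x l) / \<bar>k - l\<bar> \<in> ?Q" using that False by auto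
    from cSup_upper[OF this bdd] show ?thesis using False by (simp add: N divide_le_eq)
  qed simp
  show "0 \<le> N_flux f M R" if "0 < R"
  proof -
    \<comment> \<open>The states \<open>M\<close> and \<open>- M\<close> differ because
      \<open>M\<close> is positive, so the set has a member, and a nonnegative one.\<close>
    have "norm (f 0 M - f 0 (-M)) / \<bar>M - (-M)\<bar> \<in> ?Q" using that M by (intro CollectI exI[of _ 0] exI[of _ M] exI[of _ "-M"]) auto
    from cSup_upper2[OF this _ bdd, of 0] show ?thesis by (simp add: N)
  qed
qed

text \<open>Integer radii and the time levels \<open>1 / real (Suc m)\<close> give countably many
  truncated cones, so their exceptional sets stay null together; every point at positive time lies
  in one of them.\<close>

lemma borel_representatives_agree:
  fixes u v :: "'a \<times> real \<Rightarrow> real"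
  assumes su: "entropy_solution f {0<..} u0 u" and sv: "entropy_solution f {0<..} u0 v" and M: "0 < M"
    and um: "u1 \<in> borel_measurable borel" and vm: "v1 \<in> borel_measurable borel"
    and uM: "\<And>z. u1 z \<in> {-M..M}" and vM: "\<And>z. v1 z \<in> {-M..M}"
    and eu: "AE z in lebesgue_on (UNIV \<times> {0<..}). u z = u1 z" and ev: "AE z in lebesgue_on (UNIV \<times> {0<..}). v z = v1 z"
    and growth: "((\<lambda>R. N_flux f M R / R) \<longlongrightarrow> 0) at_top"
  shows "AE z in lborel. 0 < snd z \<longrightarrow> u1 z = v1 z"
proof -
  have "AE z in lborel. \<forall>n m. 2 * (1 / real (Suc m)) \<le> snd z \<longrightarrow> 0 < cone_depth (real (Suc n)) (N_flux f M (real (Suc n)) + 1) z \<longrightarrow> u1 z = v1 z"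
    unfolding AE_all_countable
  proof (intro allI)
    fix n m :: nat
    have R: "0 < real (Suc n)" by simp
    show "AE z in lborel. 2 * (1 / real (Suc m)) \<le> snd z \<longrightarrow> 0 < cone_depth (real (Suc n)) (N_flux f M (real (Suc n)) + 1) z \<longrightarrow> u1 z = v1 z"
      by (rule cone_uniqueness[OF M um vm uM vM entropy_solution_imp_kruzhkov[OF su um eu M uM]
            entropy_solution_imp_kruzhkov[OF sv vm ev M vM] N_flux_bound(2)[OF M R] N_flux_bound(1)[OF M]
            initial_difference[OF su sv um vm eu ev R] R]) auto
  qed
  then show ?thesis
  proof eventually_elim
    case (elim z)
    show ?case
    proof
      assume t: "0 < snd z"
      define q where "q = sqrt (1 + fst z \<bullet> fst z)"
      have inv: "((\<lambda>R::real. a / R) \<longlongrightarrow> 0) at_top" for a by (intro real_tendsto_divide_at_top[OF tendsto_const] filterlim_ident)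
      \<comment> \<open>The function is \<open>cone_depth\<close> divided by \<open>R\<close>. Its
        limit \<open>1\<close> puts the point inside the cone of every large radius.\<close>
      have "((\<lambda>R. 1 - (N_flux f M R / R + 1 / R) * snd z - q / R) \<longlongrightarrow> 1 - (0 + 0) * snd z - 0) at_top"
        by (intro tendsto_intros growth inv)
      then have "eventually (\<lambda>R. 0 < 1 - (N_flux f M R / R + 1 / R) * snd z - q / R) at_top"
        by (rule order_tendstoD(1)) simp
      then obtain R0 where R0: "\<And>R. R \<ge> R0 \<Longrightarrow> 0 < 1 - (N_flux f M R / R + 1 / R) * snd z - q / R"
        unfolding eventually_at_top_linorder by blast
      obtain n where n: "R0 \<le> real n" using real_arch_simple by blast
      let ?R = "real (Suc n)"
      have "0 < ?R * (1 - (N_flux f M ?R / ?R + 1 / ?R) * snd z - q / ?R)" using n by (intro mult_pos_pos R0) auto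
      also have "\<dots> = cone_depth ?R (N_flux f M ?R + 1) z"
        by (simp add: cone_depth_def q_def field_simps del: of_nat_Suc)
      finally have c: "0 < cone_depth ?R (N_flux f M ?R + 1) z" .
      obtain m where "1 / real (Suc m) < snd z / 2" using nat_approx_posE[of "snd z / 2"] t by auto
      then have "2 * (1 / real (Suc m)) \<le> snd z" by simp
      with elim c show "u1 z = v1 z" by blast
    qed
  qed
qed

end

theorem corollary5p5:
  fixes f :: "'a::euclidean_space \<Rightarrow> real \<Rightarrow> 'a"
    and u0 :: "'a \<Rightarrow> real"
    and u v :: "'a \<times> real \<Rightarrow> real"
    and I :: "real set"
    and M :: real
  assumes "flux_assumption f"
    and "I = {0<..}"
    and "Linf UNIV u0"
    and "entropy_solution f I u0 u"
    and "entropy_solution f I u0 v"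
    and "M = max (Linf_norm (UNIV \<times> I) u) (Linf_norm (UNIV \<times> I) v)"
    and "((\<lambda>R. N_flux f M R / R) \<longlongrightarrow> 0) at_top"
  shows "AE z in lebesgue_on (UNIV \<times> I). u z = v z"
proof -
  note I = assms(2)
  let ?S = "UNIV \<times> {0<..} :: ('a \<times> real) set"
  have S: "?S \<in> sets borel" by (intro borel_open open_Times) auto
  have su: "entropy_solution f {0<..} u0 u" and sv: "entropy_solution f {0<..} u0 v" using assms(4,5) I by simp_all
  have Lu: "Linf ?S u" and Lv: "Linf ?S v" using su sv by (simp_all add: entropy_solution_def)
  have Mu: "Linf_norm ?S u \<le> M" and Mv: "Linf_norm ?S v \<le> M" using assms(6) I by simp_all
  show ?thesis
  proof (cases "0 < M")
    case True
    obtain u1 where u1: "u1 \<in> borel_measurable borel" "\<And>z. u1 z \<in> {-M..M}" "AE z in lebesgue_on ?S. u z = u1 z"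
      using Linf_borel_representative[OF S Lu Mu] True by auto
    obtain v1 where v1: "v1 \<in> borel_measurable borel" "\<And>z. v1 z \<in> {-M..M}" "AE z in lebesgue_on ?S. v z = v1 z"
      using Linf_borel_representative[OF S Lv Mv] True by auto
    obtain T where "divergence_flux f T" using flux_assumption_imp_divergence_flux[OF assms(1)] .
    then interpret divergence_flux f T .
    have "AE z in lborel. 0 < snd z \<longrightarrow> u1 z = v1 z"
      by (rule borel_representatives_agree[OF su sv True u1(1) v1(1) u1(2) v1(2) u1(3) v1(3) assms(7)])
    then have "AE z in lebesgue_on ?S. u1 z = v1 z" unfolding AE_lebesgue_on_iff[OF S] by eventually_elim auto
    with u1(3) v1(3) show ?thesis unfolding I by eventually_elim simp
  next
    case False
    \<comment> \<open>If \<open>M\<close> is not positive, both solutions vanish almost everywhere.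
      The case stands apart because \<open>lipschitz_flux\<close> asks for a positive
      \<open>M\<close> and the set of quotients in \<open>N_flux\<close> would be empty.\<close>
    have "AE z in lebesgue_on ?S. \<bar>u z\<bar> \<le> Linf_norm ?S u" "AE z in lebesgue_on ?S. \<bar>v z\<bar> \<le> Linf_norm ?S v"
      by (rule AE_abs_le_Linf_norm[OF Lu], rule AE_abs_le_Linf_norm[OF Lv])
    then show ?thesis unfolding I by eventually_elim (use Mu Mv False in linarith)
  qed
qed

end
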